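(* Let $M\longrightarrow\Sigma$ be a Kuga–Shimura projective threefold over a Shimura curve $\Sigma$ of false elliptic curves. Then the following hold: (i) The projective equivalence classes of holomorphic projective connections on $M$ are parametrized by a complex affine space for the complex vector space $\left(H^0(\Sigma,K_\Sigma^{3/2})\right)^{2}$. (ii) All holomorphic projective connections on $M$ are flat. The fibers of the Kuga–Shimura fibration $M\longrightarrow\Sigma$ are totally geodesic with respect to every holomorphic projective connection on $M$.
   Context: Projective connections. A holomorphic affine connection on a complex manifold is a holomorphic connection $\nabla$ on its holomorphic tangent bundle; it is torsionfree if $\nabla_XY-\nabla_YX=[X,Y]$. Two torsionfree holomorphic affine connections $\nabla^1,\nabla^2$ are projectively equivalent if there is a holomorphic $1$-form $\theta$ with $\nabla^1_XY=\nabla^2_XY+\theta(X)Y+\theta(Y)X$ (equivalently, they have the same unparametrized holomorphic geodesics). A holomorphic projective connection on a complex manifold $M$ of dimension $n>1$ is a collection $(U_i,\nabla_i)_{i\in I}$ where the $U_i$ cover $M$, $\nabla_i$ is a torsionfree holomorphic affine connection on the open set $U_i$, and $\nabla_i,\nabla_j$ are projectively equivalent on $U_i\cap U_j$. Two projective connections are projectively equivalent if their union is again a projective connection. A projective connection is flat if it is projectively equivalent to one, $(U_i,\nabla_i)_{i\in I}$, such that in suitable holomorphic coordinates on $U_i$ each $\nabla_i$ is the standard connection of $\mathbb{C}^n$. The affine structure in (i) is the one in which a trace-free holomorphic section $\Theta$ of $S^2(T^*M)\otimes TM$ (trace-free: the contraction $S^2(T^*M)\otimes TM\to T^*M\otimes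 \mathrm{End}(TM)\to T^*M$, the second map being the trace, kills $\Theta$) acts on classes of projective connections by $(U_i,\nabla_i)\mapsto(U_i,\nabla_i+\Theta|_{U_i})$. Kuga–Shimura projective threefolds. Let $\mathcal{B}$ be a totally indefinite quaternion algebra over $\mathbb{Q}$ which is a division algebra: $\mathcal{B}$ is generated by $i,j$ with $ij=-ji$, $i^2=a$, $j^2=b$, where $a,b\in\mathbb{Q}$ are not both negative; then $\mathcal{B}\otimes_{\mathbb{Q}}\mathbb{R}\simeq M_{2,2}(\mathbb{R})$, and elements of $\mathcal{B}$ are viewed as $2\times2$ matrices with coefficients in some real quadratic number field. (A false elliptic curve is an abelian surface $T$ with $\mathrm{End}(T)\otimes\mathbb{Q}\simeq\mathcal{B}$.) Let $\Lambda\simeq\mathbb{Z}^4$ be a lattice in $\mathcal{B}$, and choose a nontrivial antisymmetric matrix $N=\begin{pmatrix}0&\alpha\\-\alpha&0\end{pmatrix}\in\mathcal{B}$ with $\mathrm{tr}(\Lambda N\Lambda^t)\subset\mathbb{Z}$. Let $\mathcal{H}$ be the upper half plane. For $\tau\in\mathcal{H}$ let $j_\tau:\mathcal{B}\otimes_{\mathbb{Q}}\mathbb{R}\to\mathbb{C}^2$, $A\mapsto A\begin{pmatrix}\tau\\\alpha\end{pmatrix}$, an $\mathbb{R}$-linear isomorphism; $\lambda\in\Lambda$ acts on $\mathcal{H}\times\mathbb{C}^2$ by $(\tau,z)\mapsto(\tau,z+j_\tau(\lambda))$. Let $\overline{\Gamma}\subset\mathrm{SL}(2,\mathbb{R})$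 be the stabilizer (for right multiplication) of the lattice $\Lambda\begin{pmatrix}1&0\\0&\alpha\end{pmatrix}\subset M_{2,2}(\mathbb{R})$, and let $\Gamma\subset\overline{\Gamma}$ be a torsionfree finite index subgroup. Writing $\lambda\in\Lambda$ as $(m,n,k,l)$, where $\lambda\begin{pmatrix}1&0\\0&\alpha\end{pmatrix}=\begin{pmatrix}m&n\\k&l\end{pmatrix}$, the semidirect product $\Gamma\ltimes\Lambda$ acts on $\mathcal{H}\times\mathbb{C}^2$ by $$(\gamma,\lambda)\cdot(\tau,z_1,z_2)=\left(\frac{a\tau+b}{c\tau+d},\frac{z_1+m\tau+n}{c\tau+d},\frac{z_2+k\tau+l}{c\tau+d}\right),\qquad\gamma=\begin{pmatrix}a&b\\c&d\end{pmatrix}\in\Gamma.$$ The quotient $M=(\mathcal{H}\times\mathbb{C}^2)/(\Gamma\ltimes\Lambda)$ is a smooth projective threefold, with abelian fibration $M\to\Sigma=\mathcal{H}/\Gamma$ over a compact Riemann surface of genus $\geq2$ (the Shimura curve). Such an $M\to\Sigma$ is called a Kuga–Shimura projective threefold, and $M\to\Sigma$ the Kuga–Shimura fibration. $K_\Sigma$ is the canonical bundle; $K_\Sigma^{1/2}$ is the square root determined by $\Gamma\subset\mathrm{SL}(2,\mathbb{R})$, so that sections of $K_\Sigma^{3/2}$ are holomorphic functions $f$ on $\mathcal{H}$ with $f(\gamma\tau)=(c\tau+d)^3f(\tau)$ for all $\gamma\in\Gamma$. *)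

theory Defs
  imports
    "HOL-Analysis.Analysis"
    "HOL-Algebra.Coset"
    "HOL-Library.Function_Algebras"
begin

section \<open>Complex manifolds\<close>

definition holo_fun_on :: "(complex^'n \<Rightarrow> complex) \<Rightarrow> (complex^'n) set \<Rightarrow> bool" where
  "holo_fun_on f S \<longleftrightarrow>
     (\<forall>x\<in>S. \<exists>f'. (f has_derivative f') (at x) \<and> (\<forall>k v. f' (k *s v) = k * f' v))"

definition holo_map_on :: "(complex^'n \<Rightarrow> complex^'m) \<Rightarrow> (complex^'n) set \<Rightarrow> bool" where
  "holo_map_on f S \<longleftrightarrow> (\<forall>i. holo_fun_on (\<lambda>x. f x $ i) S)"

text \<open>
  A chart is a pair of a domain and a coordinate map; the values of the coordinate map off the
  domain are irrelevant. A manifold is given by its maximal atlas, and its points, topology and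
  holomorphic functions are read off from that atlas. In particular \<open>(U, \<psi>)\<close> belongs to the
  maximal atlas if and only if \<open>\<psi>\<close> is a system of holomorphic coordinates on \<open>U\<close>.
\<close>

type_synonym ('a, 'n) chart = "'a set \<times> ('a \<Rightarrow> complex^'n)"

definition coord :: "('a, 'n::finite) chart \<Rightarrow> 'a \<Rightarrow> complex^'n" where
  "coord c = snd c"

definition param :: "('a, 'n::finite) chart \<Rightarrow> complex^'n \<Rightarrow> 'a" where
  "param c = inv_into (fst c) (snd c)"

definition transition :: "('a, 'n::finite) chart \<Rightarrow> ('a, 'n) chart \<Rightarrow> complex^'n \<Rightarrow> complex^'n" where
  "transition c d = coord d \<circ> param c"

definition carrier_of :: "('a, 'n::finite) chart set \<Rightarrow> 'a set" where
  "carrier_of A = \<Union> (fst ` A)"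

definition maximal_atlas :: "('a, 'n::finite) chart set \<Rightarrow> ('a, 'n) chart set" where
  "maximal_atlas A =
     {c. fst c \<subseteq> carrier_of A \<and> inj_on (coord c) (fst c) \<and>
         (\<forall>d\<in>A. open (coord c ` (fst c \<inter> fst d)) \<and> open (coord d ` (fst c \<inter> fst d)) \<and>
                holo_map_on (transition c d) (coord c ` (fst c \<inter> fst d)) \<and>
                holo_map_on (transition d c) (coord d ` (fst c \<inter> fst d)))}"

definition open_in_mfd :: "('a, 'n::finite) chart set \<Rightarrow> 'a set \<Rightarrow> bool" where
  "open_in_mfd A V \<longleftrightarrow> V \<subseteq> carrier_of A \<and> (\<forall>c\<in>A. open (coord c ` (fst c \<inter> V)))"

definition holo_functions :: "('a, 'n::finite) chart set \<Rightarrow> 'a set \<Rightarrow> ('a \<Rightarrow> complex) set" where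
  "holo_functions A V = {f. \<forall>c\<in>A. holo_fun_on (f \<circ> param c) (coord c ` (fst c \<inter> V))}"


section \<open>Tangent vectors and tensors\<close>

text \<open>
  A tangent vector at \<open>p\<close> is the family of its components in all charts around \<open>p\<close>, subject to
  the transformation law; components in charts not containing \<open>p\<close> are set to 0. Likewise, vector
  fields on \<open>V\<close> vanish off \<open>V\<close>, and tensors vanish on arguments that are not tangent vectors, so
  that equality of these objects is equality of HOL functions. Sums are pointwise.
\<close>

type_synonym ('a, 'n) tvec = "('a, 'n) chart \<Rightarrow> complex^'n"
type_synonym ('a, 'n) vfield = "'a \<Rightarrow> ('a, 'n) tvec"

definition tangent_space :: "('a, 'n::finite) chart set \<Rightarrow> 'a \<Rightarrow> ('a, 'n) tvec set" where
  "tangent_space A p =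
     {v. (\<forall>c\<in>A. \<forall>d\<in>A. p \<in> fst c \<inter> fst d \<longrightarrow>
            v d = frechet_derivative (transition c d) (at (coord c p)) (v c)) \<and>
         (\<forall>c. \<not> (c \<in> A \<and> p \<in> fst c) \<longrightarrow> v c = 0)}"

definition tscale :: "complex \<Rightarrow> ('a, 'n::finite) tvec \<Rightarrow> ('a, 'n) tvec" where
  "tscale k v = (\<lambda>c. k *s v c)"

definition vector_fields :: "('a, 'n::finite) chart set \<Rightarrow> 'a set \<Rightarrow> ('a, 'n) vfield set" where
  "vector_fields A V =
     {X. (\<forall>p\<in>V. X p \<in> tangent_space A p) \<and> (\<forall>p. p \<notin> V \<longrightarrow> X p = 0) \<and>
         (\<forall>c\<in>A. holo_map_on (\<lambda>x. X (param c x) c) (coord c ` (fst c \<inter> V)))}"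

definition fscale :: "('a \<Rightarrow> complex) \<Rightarrow> ('a, 'n::finite) vfield \<Rightarrow> ('a, 'n) vfield" where
  "fscale f X = (\<lambda>p. tscale (f p) (X p))"

definition restrict_field :: "'a set \<Rightarrow> ('a, 'n::finite) vfield \<Rightarrow> ('a, 'n) vfield" where
  "restrict_field W X = (\<lambda>p. if p \<in> W then X p else 0)"

definition chart_at :: "('a, 'n::finite) chart set \<Rightarrow> 'a \<Rightarrow> ('a, 'n) chart" where
  "chart_at A p = (SOME c. c \<in> A \<and> p \<in> fst c)"

text \<open>
  By the chain rule, \<open>field_apply\<close> and \<open>tangent_trace\<close> do not depend on the chart chosen.
\<close>

definition field_apply ::
    "('a, 'n::finite) chart set \<Rightarrow> ('a, 'n) vfield \<Rightarrow> ('a \<Rightarrow> complex) \<Rightarrow> 'a \<Rightarrow> complex" where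
  "field_apply A X f p =
     (let c = chart_at A p in
      frechet_derivative (f \<circ> param c) (at (coord c p)) (X p c))"

definition lie_bracket ::
    "('a, 'n::finite) chart set \<Rightarrow> 'a set \<Rightarrow> ('a, 'n) vfield \<Rightarrow> ('a, 'n) vfield \<Rightarrow> ('a, 'n) vfield" where
  "lie_bracket A V X Y = (\<lambda>p c.
     if c \<in> A \<and> p \<in> fst c \<inter> V
     then frechet_derivative (\<lambda>x. Y (param c x) c) (at (coord c p)) (X p c)
        - frechet_derivative (\<lambda>x. X (param c x) c) (at (coord c p)) (Y p c)
     else 0)"

definition coord_vector :: "('a, 'n::finite) chart set \<Rightarrow> ('a, 'n) chart \<Rightarrow> 'a \<Rightarrow> 'n \<Rightarrow> ('a, 'n) tvec" where
  "coord_vector A c p i = (\<lambda>d.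
     if d \<in> A \<and> p \<in> fst d
     then frechet_derivative (transition c d) (at (coord c p)) (axis i 1) else 0)"

definition tangent_trace ::
    "('a, 'n::finite) chart set \<Rightarrow> 'a \<Rightarrow> (('a, 'n) tvec \<Rightarrow> ('a, 'n) tvec) \<Rightarrow> complex" where
  "tangent_trace A p E =
     (let c = chart_at A p in \<Sum>i\<in>UNIV. E (coord_vector A c p i) c $ i)"

definition holo_one_form ::
    "('a, 'n::finite) chart set \<Rightarrow> 'a set \<Rightarrow> ('a \<Rightarrow> ('a, 'n) tvec \<Rightarrow> complex) \<Rightarrow> bool" where
  "holo_one_form A U \<theta> \<longleftrightarrow>
     (\<forall>p\<in>U. \<forall>v\<in>tangent_space A p. \<forall>w\<in>tangent_space A p. \<forall>k.
        \<theta> p (v + w) = \<theta> p v + \<theta> p w \<and> \<theta> p (tscale k v) = k * \<theta> p v) \<and>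
     (\<forall>V X. open_in_mfd A V \<and> V \<subseteq> U \<and> X \<in> vector_fields A V \<longrightarrow>
        (\<lambda>p. \<theta> p (X p)) \<in> holo_functions A V)"

text \<open>Global holomorphic sections of \<open>S\<^sup>2(T\<^sup>*M) \<otimes> TM\<close>, and the trace-free ones.\<close>

type_synonym ('a, 'n) sym_tensor = "'a \<Rightarrow> ('a, 'n) tvec \<Rightarrow> ('a, 'n) tvec \<Rightarrow> ('a, 'n) tvec"

definition sym_tensors :: "('a, 'n::finite) chart set \<Rightarrow> ('a, 'n) sym_tensor set" where
  "sym_tensors A =
     {\<Theta>. (\<forall>p\<in>carrier_of A. \<forall>u\<in>tangent_space A p. \<forall>v\<in>tangent_space A p. \<forall>w\<in>tangent_space A p. \<forall>k.
             \<Theta> p u v \<in> tangent_space A p \<and> \<Theta> p u v = \<Theta> p v u \<and>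
             \<Theta> p (u + v) w = \<Theta> p u w + \<Theta> p v w \<and> \<Theta> p (tscale k u) v = tscale k (\<Theta> p u v)) \<and>
          (\<forall>p v w. \<not> (p \<in> carrier_of A \<and> v \<in> tangent_space A p \<and> w \<in> tangent_space A p) \<longrightarrow>
             \<Theta> p v w = 0) \<and>
          (\<forall>V X Y. open_in_mfd A V \<and> X \<in> vector_fields A V \<and> Y \<in> vector_fields A V \<longrightarrow>
             (\<lambda>p. \<Theta> p (X p) (Y p)) \<in> vector_fields A V)}"

definition tracefree_tensors :: "('a, 'n::finite) chart set \<Rightarrow> ('a, 'n) sym_tensor set" where
  "tracefree_tensors A =
     {\<Theta>\<in>sym_tensors A. \<forall>p\<in>carrier_of A. \<forall>v\<in>tangent_space A p. tangent_trace A p (\<Theta> p v) = 0}"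

definition tensor_scale :: "complex \<Rightarrow> ('a, 'n::finite) sym_tensor \<Rightarrow> ('a, 'n) sym_tensor" where
  "tensor_scale k \<Theta> = (\<lambda>p v w. tscale k (\<Theta> p v w))"


section \<open>Holomorphic affine connections\<close>

text \<open>
  A connection on \<open>U\<close> is a morphism of sheaves: \<open>D V X Y\<close> is the covariant derivative of \<open>Y\<close> along
  \<open>X\<close>, for holomorphic vector fields \<open>X\<close>, \<open>Y\<close> on an open subset \<open>V\<close> of \<open>U\<close>; other
  values of \<open>D\<close> are irrelevant.
\<close>

type_synonym ('a, 'n) conn =
  "'a set \<Rightarrow> ('a, 'n) vfield \<Rightarrow> ('a, 'n) vfield \<Rightarrow> ('a, 'n) vfield"

definition affine_connection ::
    "('a, 'n::finite) chart set \<Rightarrow> 'a set \<Rightarrow> ('a, 'n) conn \<Rightarrow> bool" where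
  "affine_connection A U D \<longleftrightarrow>
     (\<forall>V. open_in_mfd A V \<and> V \<subseteq> U \<longrightarrow>
        (\<forall>X\<in>vector_fields A V. \<forall>Y\<in>vector_fields A V.
           D V X Y \<in> vector_fields A V \<and>
           (\<forall>Z\<in>vector_fields A V. D V (X + Z) Y = D V X Y + D V Z Y \<and>
                                   D V X (Y + Z) = D V X Y + D V X Z) \<and>
           (\<forall>f\<in>holo_functions A V.
              D V (fscale f X) Y = fscale f (D V X Y) \<and>
              D V X (fscale f Y) = fscale (field_apply A X f) Y + fscale f (D V X Y)) \<and>
           (\<forall>W. open_in_mfd A W \<and> W \<subseteq> V \<longrightarrow>
              D W (restrict_field W X) (restrict_field W Y) = restrict_field W (D V X Y))))"

definition torsionfree :: "('a, 'n::finite) chart set \<Rightarrow> 'a set \<Rightarrow> ('a, 'n) conn \<Rightarrow> bool" where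
  "torsionfree A U D \<longleftrightarrow>
     (\<forall>V. open_in_mfd A V \<and> V \<subseteq> U \<longrightarrow>
        (\<forall>X\<in>vector_fields A V. \<forall>Y\<in>vector_fields A V.
           D V X Y - D V Y X = lie_bracket A V X Y))"

definition proj_equiv_on ::
    "('a, 'n::finite) chart set \<Rightarrow> 'a set \<Rightarrow> ('a, 'n) conn \<Rightarrow> ('a, 'n) conn \<Rightarrow> bool" where
  "proj_equiv_on A U D D' \<longleftrightarrow>
     (\<exists>\<theta>. holo_one_form A U \<theta> \<and>
        (\<forall>V. open_in_mfd A V \<and> V \<subseteq> U \<longrightarrow>
           (\<forall>X\<in>vector_fields A V. \<forall>Y\<in>vector_fields A V.
              D V X Y = D' V X Y + fscale (\<lambda>p. \<theta> p (X p)) Y + fscale (\<lambda>p. \<theta> p (Y p)) X)))"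

definition standard_in_chart ::
    "('a, 'n::finite) chart set \<Rightarrow> ('a, 'n) chart \<Rightarrow> ('a, 'n) conn \<Rightarrow> bool" where
  "standard_in_chart A c D \<longleftrightarrow>
     (\<forall>V. open_in_mfd A V \<and> V \<subseteq> fst c \<longrightarrow>
        (\<forall>X\<in>vector_fields A V. \<forall>Y\<in>vector_fields A V. \<forall>p\<in>V.
           D V X Y p c = frechet_derivative (\<lambda>x. Y (param c x) c) (at (coord c p)) (X p c)))"


section \<open>Holomorphic projective connections\<close>

type_synonym ('a, 'n) pconn = "('a set \<times> ('a, 'n) conn) set"

definition projective_connection :: "('a, 'n::finite) chart set \<Rightarrow> ('a, 'n) pconn \<Rightarrow> bool" where
  "projective_connection A P \<longleftrightarrow>
     \<Union> (fst ` P) = carrier_of A \<and>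
     (\<forall>(U, D)\<in>P. open_in_mfd A U \<and> affine_connection A U D \<and> torsionfree A U D) \<and>
     (\<forall>(U, D)\<in>P. \<forall>(U', D')\<in>P. proj_equiv_on A (U \<inter> U') D D')"

definition proj_equiv :: "('a, 'n::finite) chart set \<Rightarrow> ('a, 'n) pconn rel" where
  "proj_equiv A =
     {(P, Q). projective_connection A P \<and> projective_connection A Q \<and>
              projective_connection A (P \<union> Q)}"

definition projective_classes :: "('a, 'n::finite) chart set \<Rightarrow> ('a, 'n) pconn set set" where
  "projective_classes A = {P. projective_connection A P} // proj_equiv A"

definition translate :: "('a, 'n::finite) sym_tensor \<Rightarrow> ('a, 'n) pconn \<Rightarrow> ('a, 'n) pconn" where
  "translate \<Theta> P =
     (\<lambda>(U, D). (U, \<lambda>V X Y p. D V X Y p + \<Theta> p (X p) (Y p))) ` P"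

text \<open>
  The union of the classes of all \<open>translate \<Theta> P\<close> with \<open>P \<in> C\<close>. It is again a single class
  precisely when translation by \<open>\<Theta>\<close> is well defined on \<open>C\<close>.
\<close>

definition translate_class ::
    "('a, 'n::finite) chart set \<Rightarrow> ('a, 'n) sym_tensor \<Rightarrow> ('a, 'n) pconn set \<Rightarrow> ('a, 'n) pconn set" where
  "translate_class A \<Theta> C = proj_equiv A `` (translate \<Theta> ` C)"

definition flat :: "('a, 'n::finite) chart set \<Rightarrow> ('a, 'n) pconn \<Rightarrow> bool" where
  "flat A P \<longleftrightarrow>
     (\<exists>Q. (P, Q) \<in> proj_equiv A \<and>
          (\<forall>(U, D)\<in>Q. \<exists>\<psi>. (U, \<psi>) \<in> A \<and> standard_in_chart A (U, \<psi>) D))"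

text \<open>
  Velocities at \<open>p\<close> of holomorphic curves contained in \<open>F\<close>. For a complex submanifold \<open>F\<close>
  this is its tangent space at \<open>p\<close>.
\<close>

definition tangent_to :: "('a, 'n::finite) chart set \<Rightarrow> 'a set \<Rightarrow> 'a \<Rightarrow> ('a, 'n) tvec set" where
  "tangent_to A F p =
     {v\<in>tangent_space A p. \<exists>g :: complex \<Rightarrow> 'a. g 0 = p \<and>
        (\<forall>c\<in>A. p \<in> fst c \<longrightarrow>
           (\<exists>e>0. g ` ball 0 e \<subseteq> fst c \<inter> F \<and>
              (\<forall>i. (\<lambda>t. coord c (g t) $ i) holomorphic_on ball 0 e \<and>
                   deriv (\<lambda>t. coord c (g t) $ i) 0 = v c $ i)))}"

text \<open>Vanishing of the second fundamental form of \<open>F\<close>, for each of the local connections.\<close>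

definition totally_geodesic :: "('a, 'n::finite) chart set \<Rightarrow> ('a, 'n) pconn \<Rightarrow> 'a set \<Rightarrow> bool" where
  "totally_geodesic A P F \<longleftrightarrow>
     (\<forall>(U, D)\<in>P. \<forall>V. open_in_mfd A V \<and> V \<subseteq> U \<longrightarrow>
        (\<forall>X\<in>vector_fields A V. \<forall>Y\<in>vector_fields A V.
           (\<forall>p\<in>V \<inter> F. X p \<in> tangent_to A F p \<and> Y p \<in> tangent_to A F p) \<longrightarrow>
           (\<forall>p\<in>V \<inter> F. D V X Y p \<in> tangent_to A F p)))"


section \<open>Affine spaces\<close>

definition affine_space_over :: "'v::{zero, plus} set \<Rightarrow> ('v \<Rightarrow> 's \<Rightarrow> 's) \<Rightarrow> 's set \<Rightarrow> bool" where
  "affine_space_over V act S \<longleftrightarrow>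
     S \<noteq> {} \<and>
     (\<forall>v\<in>V. \<forall>s\<in>S. act v s \<in> S) \<and>
     (\<forall>s\<in>S. act 0 s = s) \<and>
     (\<forall>v\<in>V. \<forall>w\<in>V. \<forall>s\<in>S. act (v + w) s = act v (act w s)) \<and>
     (\<forall>s\<in>S. \<forall>t\<in>S. \<exists>!v. v \<in> V \<and> act v s = t)"


section \<open>Kuga--Shimura threefolds\<close>

type_synonym mat2 = "real^2^2"

definition quaternion_division_algebra :: "mat2 set \<Rightarrow> bool" where
  "quaternion_division_algebra B \<longleftrightarrow>
     (\<exists>(a::rat) (b::rat) (i::mat2) (j::mat2).
        a \<noteq> 0 \<and> b \<noteq> 0 \<and> \<not> (a < 0 \<and> b < 0) \<and>
        i ** i = mat (of_rat a) \<and> j ** j = mat (of_rat b) \<and> i ** j = - (j ** i) \<and>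
        B = {mat (of_rat x) + of_rat y *\<^sub>R i + of_rat z *\<^sub>R j + of_rat w *\<^sub>R (i ** j) |
             x y z w :: rat. True}) \<and>
     (\<exists>d::rat. d > 0 \<and> sqrt (of_rat d) \<notin> \<rat> \<and>
        (\<forall>X\<in>B. \<forall>r s. \<exists>x y :: rat. X $ r $ s = of_rat x + of_rat y * sqrt (of_rat d))) \<and>
     (\<forall>X\<in>B. X \<noteq> 0 \<longrightarrow> (\<exists>Y\<in>B. X ** Y = mat 1 \<and> Y ** X = mat 1))"

text \<open>
  Four elements spanning the four-dimensional rational vector space \<open>B\<close> form a basis of it.
\<close>

definition lattice_in :: "mat2 set \<Rightarrow> mat2 set \<Rightarrow> bool" where
  "lattice_in B \<Lambda> \<longleftrightarrow>
     (\<exists>e :: 4 \<Rightarrow> mat2.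
        B = {\<Sum>r\<in>UNIV. of_rat (q r) *\<^sub>R e r | q :: 4 \<Rightarrow> rat. True} \<and>
        \<Lambda> = {\<Sum>r\<in>UNIV. of_int (k r) *\<^sub>R e r | k :: 4 \<Rightarrow> int. True})"

definition antisym :: "real \<Rightarrow> mat2" where
  "antisym \<alpha> = vector [vector [0, \<alpha>], vector [- \<alpha>, 0]]"

definition lattice_coords :: "real \<Rightarrow> mat2 \<Rightarrow> mat2" where
  "lattice_coords \<alpha> l = l ** vector [vector [1, 0], vector [0, \<alpha>]]"

definition lattice_stabilizer :: "mat2 set \<Rightarrow> mat2 monoid" where
  "lattice_stabilizer L =
     \<lparr>carrier = {g. det g = 1 \<and> (\<lambda>X. X ** g) ` L = L}, mult = (**), one = mat 1\<rparr>"

text \<open>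
  The action below depends on \<open>l \<in> \<Lambda>\<close> through the entries of \<open>lattice_coords \<alpha> l\<close>, that is through
  \<open>l (\<tau>, \<alpha>)\<^sup>t = lattice_coords \<alpha> l (\<tau>, 1)\<^sup>t\<close>; \<open>\<Gamma>\<close> is accordingly a group of matrices preserving
  the lattice \<open>lattice_coords \<alpha> ` \<Lambda>\<close> under multiplication from the right.
\<close>

definition kuga_shimura :: "mat2 set \<Rightarrow> mat2 set \<Rightarrow> real \<Rightarrow> mat2 set \<Rightarrow> bool" where
  "kuga_shimura B \<Lambda> \<alpha> \<Gamma> \<longleftrightarrow>
     quaternion_division_algebra B \<and> lattice_in B \<Lambda> \<and>
     \<alpha> \<noteq> 0 \<and> antisym \<alpha> \<in> B \<and>
     (\<forall>l\<in>\<Lambda>. \<forall>m\<in>\<Lambda>. trace (l ** antisym \<alpha> ** Finite_Cartesian_Product.transpose m) \<in> \<int>) \<and>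
     (let G = lattice_stabilizer (lattice_coords \<alpha> ` \<Lambda>) in
        subgroup \<Gamma> G \<and> finite (rcosets\<^bsub>G\<^esub> \<Gamma>) \<and>
        (\<forall>g\<in>\<Gamma>. \<forall>n>0::nat. g [^]\<^bsub>G\<^esub> n = \<one>\<^bsub>G\<^esub> \<longrightarrow> g = \<one>\<^bsub>G\<^esub>))"

definition upper_half_plane :: "complex set" where
  "upper_half_plane = {\<tau>. Im \<tau> > 0}"

definition aut_factor :: "mat2 \<Rightarrow> complex \<Rightarrow> complex" where
  "aut_factor g \<tau> = of_real (g $ 2 $ 1) * \<tau> + of_real (g $ 2 $ 2)"

definition moebius :: "mat2 \<Rightarrow> complex \<Rightarrow> complex" where
  "moebius g \<tau> = (of_real (g $ 1 $ 1) * \<tau> + of_real (g $ 1 $ 2)) / aut_factor g \<tau>"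

text \<open>A point \<open>(\<tau>, z\<^sub>1, z\<^sub>2)\<close> is the vector with components 1, 2, 3 in this order.\<close>

definition kuga_cover :: "(complex^3) set" where
  "kuga_cover = {x. x $ 1 \<in> upper_half_plane}"

definition kuga_action :: "real \<Rightarrow> mat2 \<Rightarrow> mat2 \<Rightarrow> complex^3 \<Rightarrow> complex^3" where
  "kuga_action \<alpha> g l x =
     (let \<tau> = x $ 1; L = lattice_coords \<alpha> l in
      vector
        [moebius g \<tau>,
         (x $ 2 + of_real (L $ 1 $ 1) * \<tau> + of_real (L $ 1 $ 2)) / aut_factor g \<tau>,
         (x $ 3 + of_real (L $ 2 $ 1) * \<tau> + of_real (L $ 2 $ 2)) / aut_factor g \<tau>])"

definition kuga_orbit :: "mat2 set \<Rightarrow> real \<Rightarrow> mat2 set \<Rightarrow> complex^3 \<Rightarrow> (complex^3) set" where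
  "kuga_orbit \<Lambda> \<alpha> \<Gamma> x = {kuga_action \<alpha> g l x | g l. g \<in> \<Gamma> \<and> l \<in> \<Lambda>}"

text \<open>The local inverses of the projection generate the complex structure of the quotient.\<close>

definition kuga_threefold :: "mat2 set \<Rightarrow> real \<Rightarrow> mat2 set \<Rightarrow> ((complex^3) set, 3) chart set" where
  "kuga_threefold \<Lambda> \<alpha> \<Gamma> = maximal_atlas
     {(kuga_orbit \<Lambda> \<alpha> \<Gamma> ` W, inv_into W (kuga_orbit \<Lambda> \<alpha> \<Gamma>)) | W.
        open W \<and> W \<subseteq> kuga_cover \<and> inj_on (kuga_orbit \<Lambda> \<alpha> \<Gamma>) W}"

definition shimura_curve :: "mat2 set \<Rightarrow> complex set set" where
  "shimura_curve \<Gamma> = (\<lambda>\<tau>. {moebius g \<tau> | g. g \<in> \<Gamma>}) ` upper_half_plane"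

text \<open>
  The fibration sends the orbit of \<open>(\<tau>, z)\<close> to the set of its first coordinates, which is the
  \<open>\<Gamma>\<close>-orbit of \<open>\<tau>\<close>.
\<close>

definition kuga_fibration :: "(complex^3) set \<Rightarrow> complex set" where
  "kuga_fibration p = (\<lambda>x. x $ 1) ` p"

definition kuga_fiber :: "mat2 set \<Rightarrow> real \<Rightarrow> mat2 set \<Rightarrow> complex set \<Rightarrow> (complex^3) set set" where
  "kuga_fiber \<Lambda> \<alpha> \<Gamma> s = {p \<in> kuga_orbit \<Lambda> \<alpha> \<Gamma> ` kuga_cover. kuga_fibration p = s}"

text \<open>
  Sections of the canonical bundle are modular forms of weight 2, via \<open>f d\<tau>\<close>; the group \<open>\<Gamma>\<close> singles
  out a square root, whose sections have weight 1. The curve is compact, so there is no condition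
  at cusps. Functions are extended by 0 off the upper half plane to make equality meaningful.
\<close>

definition H0_K32 :: "mat2 set \<Rightarrow> (complex \<Rightarrow> complex) set" where
  "H0_K32 \<Gamma> =
     {f. f holomorphic_on upper_half_plane \<and> (\<forall>\<tau>. \<tau> \<notin> upper_half_plane \<longrightarrow> f \<tau> = 0) \<and>
         (\<forall>g\<in>\<Gamma>. \<forall>\<tau>\<in>upper_half_plane. f (moebius g \<tau>) = aut_factor g \<tau> ^ 3 * f \<tau>)}"

end

theory Submission
  imports Defs "HOL-Complex_Analysis.Cauchy_Integral_Formula"
begin

text \<open>
  In the charts coming from \<open>\<H> \<times> \<complex>\<^sup>2\<close> the transition maps are projective transformations, so the
  standard connections of these charts form a projective connection. The projective class of a
  torsionfree connection is determined by the trace-free part of its Christoffel symbols, and the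
  difference of two such trace-free parts is a tensor; this gives the affine structure.

  A trace-free tensor lifts to \<open>\<H> \<times> \<complex>\<^sup>2\<close>. Since the lattice acts by \<open>z \<mapsto> z + m \<tau> + n\<close> and hence
  unipotently on the frame \<open>\<partial>/\<partial>\<tau>, \<partial>/\<partial>z\<^sub>1, \<partial>/\<partial>z\<^sub>2\<close>, a Liouville argument on the fibres kills its
  components one after the other, until only \<open>d\<tau>\<^sup>2 \<otimes> (f\<^sub>1 \<partial>/\<partial>z\<^sub>1 + f\<^sub>2 \<partial>/\<partial>z\<^sub>2)\<close> is left;
  invariance under \<open>\<Gamma>\<close> says that \<open>f\<^sub>1\<close> and \<open>f\<^sub>2\<close> have weight 3. Such a tensor is absorbed by the
  coordinates \<open>(\<tau>, z + F(\<tau>))\<close> with \<open>F'' = f\<close>, whence flatness, and it vanishes along the fibres.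
\<close>

subsection \<open>Holomorphic functions of several variables\<close>

text \<open>A connection is an operator on vector fields, and projective equivalence is the
  existence of a one-form on each overlap, so neither locality nor transitivity is visible. Both
  appear on the level of Christoffel symbols: \<theta>(v) w + \<theta>(w) v has trace (n + 1)
  \<theta>(v), so \<theta> is recovered from a trace and equivalence can be tested point by point.
  Under a change of chart the symbols acquire the second derivative of the transition map. For the
  group acting here this term, pulled back by the Jacobian, is again \<theta>(v) w + \<theta>(w) v,
  with \<theta> = - c d\<tau> / (c \<tau> + d). The Liouville step rests on a clash of linearities:
  derivatives along a fibre are complex linear, whereas the multiplier is only real linear in the
  lattice element and ignores the second column of its matrix. The trace condition enters once, to
  exclude the surviving tensor d\<tau>(v) w + d\<tau>(w) v. The weight 3 is 4 - 1: d\<tau> twice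
  contributes 4, and a vertical vector takes away 1.\<close>

abbreviation fd :: "('a::real_normed_vector \<Rightarrow> 'b::real_normed_vector) \<Rightarrow> 'a \<Rightarrow> 'a \<Rightarrow> 'b" where
  "fd f x \<equiv> frechet_derivative f (at x)"

lemma fd_eqI: "(f has_derivative f') (at x) \<Longrightarrow> fd f x = f'"
  by (metis frechet_derivative_at)

text \<open>\<open>frechet_derivative\<close> is a choice among all derivatives, and the set of
  derivatives depends only on the germ; the equality therefore holds even at points where no
  derivative exists.\<close>

lemma fd_cong:
  assumes "open S" "x \<in> S" "\<And>y. y \<in> S \<Longrightarrow> f y = g y"
  shows "fd f x = fd g x"
proof -
  have "(f has_derivative h) (at x) \<longleftrightarrow> (g has_derivative h) (at x)" for h
    using assms has_derivative_transform_within_open[of _ h x UNIV S]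
    by (metis (no_types, lifting))
  then show ?thesis
    by (simp add: frechet_derivative_def)
qed

lemma holo_fun_onD:
  assumes "holo_fun_on f S" "x \<in> S"
  shows "(f has_derivative fd f x) (at x)" "fd f x (k *s v) = k * fd f x v"
    "fd f x (v + w) = fd f x v + fd f x w" "fd f x 0 = 0"
proof -
  obtain f' where f': "(f has_derivative f') (at x)" "\<And>k v. f' (k *s v) = k * f' v"
    using assms by (auto simp: holo_fun_on_def)
  with fd_eqI have eq: "fd f x = f'" by blast
  show "(f has_derivative fd f x) (at x)" "fd f x (k *s v) = k * fd f x v"
    using f' eq by auto
  then show "fd f x (v + w) = fd f x v + fd f x w" "fd f x 0 = 0"
    by (auto simp: has_derivative_def linear_simps)
qed

lemma vec_expansion: "(\<Sum>i\<in>UNIV. v $ i *s axis i 1) = (v :: 'a::comm_ring_1 ^ 'n)"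
  by (simp add: vec_eq_iff axis_def sum.delta' if_distrib cong: if_cong)

text \<open>Reduces derivatives in a varying direction to finitely many fixed directions, for which
  continuity and holomorphy are available.\<close>

lemma holo_fun_on_fd_expansion:
  assumes "holo_fun_on f S" "x \<in> S"
  shows "fd f x v = (\<Sum>i\<in>UNIV. v $ i * fd f x (axis i 1))"
proof -
  have "linear (fd f x)"
    using holo_fun_onD(1)[OF assms] has_derivative_linear by blast
  then have "fd f x (\<Sum>i\<in>UNIV. v $ i *s axis i 1) = (\<Sum>i\<in>UNIV. fd f x (v $ i *s axis i 1))"
    by (rule linear_sum)
  then show ?thesis
    using holo_fun_onD(2)[OF assms] by (simp add: vec_expansion)
qed

lemma holo_fun_onI:
  assumes "\<And>x. x \<in> S \<Longrightarrow> (f has_derivative f' x) (at x)"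
    and "\<And>x k v. x \<in> S \<Longrightarrow> f' x (k *s v) = k * f' x v"
  shows "holo_fun_on f S"
  unfolding holo_fun_on_def using assms by blast

lemma holo_fun_on_subset: "holo_fun_on f S \<Longrightarrow> T \<subseteq> S \<Longrightarrow> holo_fun_on f T"
  by (auto simp: holo_fun_on_def)

lemma holo_map_on_subset: "holo_map_on f S \<Longrightarrow> T \<subseteq> S \<Longrightarrow> holo_map_on f T"
  by (auto simp: holo_map_on_def intro: holo_fun_on_subset)

lemma holo_fun_on_cong:
  assumes "open S" "\<And>x. x \<in> S \<Longrightarrow> f x = g x" "holo_fun_on f S"
  shows "holo_fun_on g S"
proof (rule holo_fun_onI)
  fix x k v assume x: "x \<in> S"
  show "(g has_derivative fd f x) (at x)"
    by (rule has_derivative_transform_within_open[OF holo_fun_onD(1)[OF assms(3) x] assms(1) x])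
      (use assms(2) in auto)
  show "fd f x (k *s v) = k * fd f x v" by (rule holo_fun_onD(2)[OF assms(3) x])
qed

lemma holo_map_on_cong:
  assumes "open S" "\<And>x. x \<in> S \<Longrightarrow> f x = g x" "holo_map_on f S"
  shows "holo_map_on g S"
  unfolding holo_map_on_def
proof
  fix i show "holo_fun_on (\<lambda>x. g x $ i) S"
    by (rule holo_fun_on_cong[of S "\<lambda>x. f x $ i"]) (use assms in \<open>auto simp: holo_map_on_def\<close>)
qed

lemma holo_fun_on_local:
  assumes "\<And>x. x \<in> S \<Longrightarrow> \<exists>T. open T \<and> x \<in> T \<and> holo_fun_on f T"
  shows "holo_fun_on f S"
proof (rule holo_fun_onI)
  fix x assume "x \<in> S"
  then obtain T where T: "x \<in> T" "holo_fun_on f T" using assms by blast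
  then show "(f has_derivative fd f x) (at x)" "fd f x (k *s v) = k * fd f x v" for k v
    using holo_fun_onD by auto
qed

lemma holo_map_on_local:
  assumes "\<And>x. x \<in> S \<Longrightarrow> \<exists>T. open T \<and> x \<in> T \<and> holo_map_on f T"
  shows "holo_map_on f S"
  unfolding holo_map_on_def
proof
  fix i show "holo_fun_on (\<lambda>x. f x $ i) S"
    by (rule holo_fun_on_local) (use assms in \<open>auto simp: holo_map_on_def\<close>)
qed

lemma holo_fun_on_imp_continuous: "holo_fun_on f S \<Longrightarrow> continuous_on S f"
  by (rule continuous_at_imp_continuous_on) (auto simp: holo_fun_on_def intro: has_derivative_continuous)

lemma holo_fun_on_const [intro, simp]: "holo_fun_on (\<lambda>x. c) S"
  by (rule holo_fun_onI[where f' = "\<lambda>_ _. 0"]) auto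

lemma holo_fun_on_nth [intro, simp]: "holo_fun_on (\<lambda>x. x $ i) S"
  by (rule holo_fun_onI[where f' = "\<lambda>_ x. x $ i"])
    (auto intro: bounded_linear.has_derivative bounded_linear_vec_nth)

lemma holo_fun_on_add [intro]:
  assumes "holo_fun_on f S" "holo_fun_on g S"
  shows "holo_fun_on (\<lambda>x. f x + g x) S"
  by (rule holo_fun_onI[where f' = "\<lambda>x v. fd f x v + fd g x v"])
    (auto intro!: derivative_eq_intros holo_fun_onD(1)[OF assms(1)] holo_fun_onD(1)[OF assms(2)]
      simp: algebra_simps holo_fun_onD(2)[OF assms(1)] holo_fun_onD(2)[OF assms(2)])

lemma holo_fun_on_mult [intro]:
  assumes "holo_fun_on f S" "holo_fun_on g S"
  shows "holo_fun_on (\<lambda>x. f x * g x) S"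
  by (rule holo_fun_onI[where f' = "\<lambda>x v. f x * fd g x v + fd f x v * g x"])
    (auto intro!: derivative_eq_intros holo_fun_onD(1)[OF assms(1)] holo_fun_onD(1)[OF assms(2)]
      simp: algebra_simps holo_fun_onD(2)[OF assms(1)] holo_fun_onD(2)[OF assms(2)])

lemma holo_fun_on_uminus [intro]: "holo_fun_on f S \<Longrightarrow> holo_fun_on (\<lambda>x. - f x) S"
  using holo_fun_on_mult[of "\<lambda>_. -1" S f] by simp

lemma holo_fun_on_diff [intro]:
  "holo_fun_on f S \<Longrightarrow> holo_fun_on g S \<Longrightarrow> holo_fun_on (\<lambda>x. f x - g x) S"
  using holo_fun_on_add[of f S "\<lambda>x. - g x"] by auto

lemma holo_fun_on_sum [intro]:
  assumes "\<And>i. i \<in> I \<Longrightarrow> holo_fun_on (f i) S"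
  shows "holo_fun_on (\<lambda>x. \<Sum>i\<in>I. f i x) S"
  using assms by (induction I rule: infinite_finite_induct) auto

lemma fd_mult:
  assumes "holo_fun_on f S" "holo_fun_on g S" "x \<in> S"
  shows "fd (\<lambda>x. f x * g x) x = (\<lambda>v. f x * fd g x v + fd f x v * g x)"
  using assms holo_fun_onD(1) by (intro fd_eqI) (auto intro!: derivative_eq_intros)

text \<open>The componentwise criterion tests against the real basis, whose members are
  \<open>axis i u\<close>; the inner product with such a member factors through the component
  \<open>f x $ i\<close>.\<close>

lemma fd_vec:
  fixes f :: "'a::real_normed_vector \<Rightarrow> 'b::euclidean_space ^ 'c"
  assumes "\<And>i. ((\<lambda>x. f x $ i) has_derivative (\<lambda>v. f' v $ i)) (at x)"
  shows "(f has_derivative f') (at x)"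
  unfolding has_derivative_componentwise_within[of f f']
proof
  fix b :: "'b ^ 'c" assume "b \<in> Basis"
  then obtain i u where b: "b = axis i u" "u \<in> Basis"
    by (auto simp: Basis_vec_def)
  show "((\<lambda>x. f x \<bullet> b) has_derivative (\<lambda>x. f' x \<bullet> b)) (at x)"
    using assms[of i] by (auto simp: b inner_axis intro!: derivative_eq_intros)
qed

lemma holo_map_onD:
  fixes f :: "complex^'n \<Rightarrow> complex^'m"
  assumes "holo_map_on f S" "x \<in> S"
  shows "(f has_derivative fd f x) (at x)" "fd f x v $ i = fd (\<lambda>y. f y $ i) x v"
    "fd f x (k *s v) = k *s fd f x v" "fd f x (v + w) = fd f x v + fd f x w" "fd f x 0 = 0"
proof -
  define f' where "f' v = (\<chi> i. fd (\<lambda>y. f y $ i) x v)" for v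
  have h: "holo_fun_on (\<lambda>y. f y $ i) S" for i
    using assms(1) by (simp add: holo_map_on_def)
  have f': "(f has_derivative f') (at x)"
    by (rule fd_vec) (use holo_fun_onD(1)[OF h assms(2)] in \<open>simp add: f'_def\<close>)
  then have eq: "fd f x = f'" by (rule fd_eqI)
  show "(f has_derivative fd f x) (at x)" "fd f x v $ i = fd (\<lambda>y. f y $ i) x v"
    "fd f x (k *s v) = k *s fd f x v" "fd f x (v + w) = fd f x v + fd f x w" "fd f x 0 = 0"
    using f' unfolding eq
    by (auto simp: f'_def vec_eq_iff holo_fun_onD[OF h assms(2)])
qed

lemma holo_map_on_imp_continuous: "holo_map_on f S \<Longrightarrow> continuous_on S f"
  by (rule continuous_at_imp_continuous_on) (auto dest!: holo_map_onD(1) has_derivative_continuous)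

lemma holo_map_on_fd_expansion:
  fixes f :: "complex^'n \<Rightarrow> complex^'m"
  assumes "holo_map_on f S" "x \<in> S"
  shows "fd f x v = (\<Sum>i\<in>UNIV. v $ i *s fd f x (axis i 1))"
  unfolding vec_eq_iff
proof
  fix k
  have h: "holo_fun_on (\<lambda>y. f y $ k) S"
    using assms(1) by (simp add: holo_map_on_def)
  show "fd f x v $ k = (\<Sum>i\<in>UNIV. v $ i *s fd f x (axis i 1)) $ k"
    using holo_fun_on_fd_expansion[OF h assms(2), of v]
    by (simp add: holo_map_onD[OF assms] sum_component)
qed

lemma holo_map_on_const [intro, simp]: "holo_map_on (\<lambda>x. c) S"
  by (simp add: holo_map_on_def)

lemma holo_map_on_add [intro]:
  "holo_map_on f S \<Longrightarrow> holo_map_on g S \<Longrightarrow> holo_map_on (\<lambda>x. f x + g x) S"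
  by (auto simp: holo_map_on_def)

lemma holo_map_on_diff [intro]:
  "holo_map_on f S \<Longrightarrow> holo_map_on g S \<Longrightarrow> holo_map_on (\<lambda>x. f x - g x) S"
  by (auto simp: holo_map_on_def)

lemma holo_map_on_scale [intro]:
  "holo_fun_on f S \<Longrightarrow> holo_map_on g S \<Longrightarrow> holo_map_on (\<lambda>x. f x *s g x) S"
  by (auto simp: holo_map_on_def)

lemma holo_map_on_sum [intro]:
  assumes "\<And>i. i \<in> I \<Longrightarrow> holo_map_on (f i) S"
  shows "holo_map_on (\<lambda>x. \<Sum>i\<in>I. f i x) S"
  using assms by (auto simp: holo_map_on_def)

section \<open>Composition, chain rule and product rule\<close>

lemma holo_fun_on_compose:
  assumes "holo_fun_on f T" "holo_map_on g S" "\<And>x. x \<in> S \<Longrightarrow> g x \<in> T"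
  shows "holo_fun_on (\<lambda>x. f (g x)) S"
proof (rule holo_fun_onI)
  fix x k v assume x: "x \<in> S"
  show "((\<lambda>x. f (g x)) has_derivative (\<lambda>v. fd f (g x) (fd g x v))) (at x)"
    by (rule has_derivative_compose[OF holo_map_onD(1)[OF assms(2) x] holo_fun_onD(1)[OF assms(1) assms(3)[OF x]]])
  show "fd f (g x) (fd g x (k *s v)) = k * fd f (g x) (fd g x v)"
    using holo_map_onD(3)[OF assms(2) x] holo_fun_onD(2)[OF assms(1,3)] x by simp
qed

lemma holo_map_on_compose:
  assumes "holo_map_on f T" "holo_map_on g S" "\<And>x. x \<in> S \<Longrightarrow> g x \<in> T"
  shows "holo_map_on (\<lambda>x. f (g x)) S"
  unfolding holo_map_on_def
proof
  fix i show "holo_fun_on (\<lambda>x. f (g x) $ i) S"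
    by (rule holo_fun_on_compose[of "\<lambda>x. f x $ i" T]) (use assms in \<open>auto simp: holo_map_on_def\<close>)
qed

lemma fd_compose_fun:
  assumes "holo_fun_on f T" "holo_map_on g S" "x \<in> S" "g x \<in> T"
  shows "fd (\<lambda>x. f (g x)) x v = fd f (g x) (fd g x v)"
  by (rule fun_cong[OF fd_eqI])
    (rule has_derivative_compose[OF holo_map_onD(1)[OF assms(2,3)] holo_fun_onD(1)[OF assms(1,4)]])

lemma fd_compose_map:
  assumes "holo_map_on f T" "holo_map_on g S" "x \<in> S" "g x \<in> T"
  shows "fd (\<lambda>x. f (g x)) x v = fd f (g x) (fd g x v)"
  by (rule fun_cong[OF fd_eqI])
    (rule has_derivative_compose[OF holo_map_onD(1)[OF assms(2,3)] holo_map_onD(1)[OF assms(1,4)]])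

lemma fd_map_add:
  assumes "holo_map_on f S" "holo_map_on g S" "x \<in> S"
  shows "fd (\<lambda>x. f x + g x) x v = fd f x v + fd g x v"
proof -
  have "((\<lambda>x. f x + g x) has_derivative (\<lambda>v. fd f x v + fd g x v)) (at x)"
    using holo_map_onD(1)[OF assms(1,3)] holo_map_onD(1)[OF assms(2,3)]
    by (rule has_derivative_add)
  from fun_cong[OF fd_eqI[OF this], of v] show ?thesis .
qed

lemma fd_map_scale:
  assumes "holo_fun_on f S" "holo_map_on g S" "x \<in> S"
  shows "fd (\<lambda>x. f x *s g x) x v = fd f x v *s g x + f x *s fd g x v"
  unfolding vec_eq_iff
proof
  fix i
  have g: "holo_fun_on (\<lambda>y. g y $ i) S" using assms(2) by (simp add: holo_map_on_def)
  have fg: "holo_map_on (\<lambda>x. f x *s g x) S" using assms by blast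
  show "fd (\<lambda>x. f x *s g x) x v $ i = (fd f x v *s g x + f x *s fd g x v) $ i"
    using fd_mult[OF assms(1) g assms(3)]
    by (simp add: holo_map_onD(2)[OF fg assms(3)] holo_map_onD(2)[OF assms(2,3)])
qed

lemma fd_map_sum:
  assumes "\<And>i. i \<in> I \<Longrightarrow> holo_map_on (f i) S" "x \<in> S"
  shows "fd (\<lambda>x. \<Sum>i\<in>I. f i x) x v = (\<Sum>i\<in>I. fd (f i) x v)"
proof -
  have "((\<lambda>x. \<Sum>i\<in>I. f i x) has_derivative (\<lambda>v. \<Sum>i\<in>I. fd (f i) x v)) (at x)"
    using holo_map_onD(1)[OF assms] by (intro has_derivative_sum) auto
  from fun_cong[OF fd_eqI[OF this], of v] show ?thesis .
qed

subsection \<open>Cauchy's formula for directional derivatives\<close>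

text \<open>The circle of radius r around 0 in the complex line spanned by v, parametrized by
  [0, 1].\<close>

definition cauchy_pt :: "complex^'n \<Rightarrow> real \<Rightarrow> real \<Rightarrow> complex^'n" where
  "cauchy_pt v r t = circlepath 0 r t *s v"

text \<open>What remains of du / (2 pi i u^2) on u = r exp(2 pi i t) after cancellation.\<close>

definition cauchy_ker :: "real \<Rightarrow> real \<Rightarrow> complex" where
  "cauchy_ker r t = exp (- 2 * of_real pi * \<i> * of_real t) / of_real r"

lemma continuous_cauchy_pt [continuous_intros]:
  "continuous_on S f \<Longrightarrow> continuous_on S (\<lambda>x. cauchy_pt v r (f x))"
  unfolding cauchy_pt_def circlepath scalar_mult_eq_scaleR vector_scalar_mult_def
  by (intro continuous_intros)

lemma continuous_cauchy_ker [continuous_intros]: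
  "r \<noteq> 0 \<Longrightarrow> continuous_on S f \<Longrightarrow> continuous_on S (\<lambda>x. cauchy_ker r (f x))"
  unfolding cauchy_ker_def by (intro continuous_intros) auto

lemma has_field_derivative_line:
  assumes "holo_fun_on f S" "x + z *s v \<in> S"
  shows "((\<lambda>z. f (x + z *s v)) has_field_derivative fd f (x + z *s v) v) (at z)"
proof -
  have "((\<lambda>z. z *s v) has_derivative (\<lambda>k. k *s v)) (at z)"
    by (rule fd_vec) (auto intro!: derivative_eq_intros)
  then have "((\<lambda>z. x + z *s v) has_derivative (\<lambda>k. k *s v)) (at z)"
    by (auto intro!: derivative_eq_intros)
  from has_derivative_compose[OF this holo_fun_onD(1)[OF assms]]
  show ?thesis
    using holo_fun_onD(2)[OF assms] by (simp add: has_field_derivative_def mult.commute[of _ "fd f _ v"])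
qed

text \<open>One-variable Cauchy formula for the restriction of f to the line through x in direction
  v. It writes a derivative as an integral of values of f, so that regularity of f in x passes to
  its derivatives.\<close>

lemma cauchy_formula:
  fixes f :: "complex^'n \<Rightarrow> complex"
  assumes f: "holo_fun_on f S" and r: "r > 0" and S: "\<And>z. norm z \<le> r \<Longrightarrow> x + z *s v \<in> S"
  shows "fd f x v = integral {0..1} (\<lambda>t. f (x + cauchy_pt v r t) * cauchy_ker r t)"
proof -
  let ?g = "\<lambda>z. f (x + z *s v)"
  have d: "(?g has_field_derivative fd f (x + z *s v) v) (at z)" if "norm z \<le> r" for z
    by (rule has_field_derivative_line[OF f S[OF that]])
  have holo: "?g holomorphic_on cball 0 r"
    unfolding holomorphic_on_def field_differentiable_def
    using d by (metis mem_cball_0 has_field_derivative_at_within)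
  have "(?g has_field_derivative (1 / (2 * of_real pi * \<i>) *
      contour_integral (circlepath 0 r) (\<lambda>u. ?g u / (u - 0)\<^sup>2))) (at 0)"
    by (rule Cauchy_derivative_integral_circlepath(2))
      (use r holo in \<open>auto intro: holomorphic_on_imp_continuous_on holomorphic_on_subset\<close>)
  then have "fd f x v = 1 / (2 * of_real pi * \<i>) *
      contour_integral (circlepath 0 r) (\<lambda>u. ?g u / u\<^sup>2)"
    using DERIV_unique d[of 0] r by fastforce
  also have "\<dots> = integral {0..1} (\<lambda>t. 1 / (2 * of_real pi * \<i>) *
      (?g (circlepath 0 r t) / (circlepath 0 r t)\<^sup>2 * (2 * pi * \<i> * r * exp (2 * of_real pi * \<i> * t))))"
    unfolding contour_integral_integral vector_derivative_circlepath integral_mult_right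
    by (simp only: diff_zero)
  also have "\<dots> = integral {0..1} (\<lambda>t. f (x + cauchy_pt v r t) * cauchy_ker r t)"
  proof (rule integral_cong)
    fix t :: real
    have e: "exp (- (2 * of_real pi * \<i> * complex_of_real t)) = 1 / exp (2 * of_real pi * \<i> * complex_of_real t)"
      by (simp add: exp_minus field_simps)
    show "1 / (2 * of_real pi * \<i>) * (?g (circlepath 0 r t) / (circlepath 0 r t)\<^sup>2 *
        (2 * pi * \<i> * r * exp (2 * of_real pi * \<i> * t))) = f (x + cauchy_pt v r t) * cauchy_ker r t"
      using r by (simp add: cauchy_pt_def cauchy_ker_def circlepath e power2_eq_square)
  qed
  finally show ?thesis .
qed

lemma norm_cscale: "norm (k *s (v :: complex^'n)) = cmod k * norm v"
  by (simp add: norm_vec_def L2_set_def norm_mult power_mult_distrib real_sqrt_mult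
      flip: sum_distrib_left)

text \<open>Differentiating Cauchy's formula in the base point needs one radius that serves all
  points near x.\<close>

lemma uniform_radius:
  fixes x v :: "complex^'n"
  assumes "open S" "x \<in> S"
  obtains r e where "r > 0" "e > 0" "\<And>y (z :: complex). y \<in> ball x e \<Longrightarrow> norm z \<le> r \<Longrightarrow> y + z *s v \<in> S"
proof -
  obtain d where d: "d > 0" "ball x d \<subseteq> S"
    using assms by (meson openE)
  \<comment> \<open>Half of d is left for moving the base point; the summand 1 covers the direction
    v = 0.\<close>
  define r where "r = d / (2 * (norm v + 1))"
  have r: "r > 0" "r * norm v \<le> d / 2"
  proof -
    have "norm v + 1 > 0" by (simp add: add_nonneg_pos)
    then show "r > 0" using d by (simp add: r_def)
    show "r * norm v \<le> d / 2"
      using d \<open>norm v + 1 > 0\<close> by (simp add: r_def divide_simps)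
  qed
  show ?thesis
  proof
    show "r > 0" "d / 2 > 0" using r d by auto
    fix y and z :: complex assume y: "y \<in> ball x (d / 2)" and z: "norm z \<le> r"
    have "norm (z *s v) \<le> r * norm v"
      using z by (simp add: norm_cscale mult_right_mono)
    then have "norm (z *s v) \<le> d / 2" using r by simp
    then have "dist x (y + z *s v) < d"
      using y norm_triangle_ineq4[of "x - y" "z *s v"] by (simp add: dist_norm algebra_simps)
    then show "y + z *s v \<in> S" using d by auto
  qed
qed

text \<open>\<open>holo_fun_on\<close> asks only for pointwise derivatives. Near x Cauchy's formula
  presents the derivative as a parameter integral with jointly continuous integrand.\<close>

lemma continuous_on_fd:
  fixes f :: "complex^'n \<Rightarrow> complex"
  assumes f: "holo_fun_on f S" and "open S"
  shows "continuous_on S (\<lambda>x. fd f x v)"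
proof (rule continuous_at_imp_continuous_on, rule ballI)
  fix x assume "x \<in> S"
  obtain r e where re: "r > 0" "e > 0" "\<And>y z. y \<in> ball x e \<Longrightarrow> norm z \<le> r \<Longrightarrow> y + z *s v \<in> S"
    using uniform_radius[OF \<open>open S\<close> \<open>x \<in> S\<close>] by metis
  have inS: "y + cauchy_pt v r t \<in> S" if "y \<in> ball x e" for y t
    unfolding cauchy_pt_def by (rule re(3)[OF that]) (use re in \<open>simp add: circlepath norm_mult\<close>)
  have "continuous_on (ball x e) (\<lambda>y. integral (cbox (0::real) 1) (\<lambda>t. f (y + cauchy_pt v r t) * cauchy_ker r t))"
  proof (rule integral_continuous_on_param)
    have "continuous_on (ball x e \<times> cbox (0::real) 1) (\<lambda>p. f (fst p + cauchy_pt v r (snd p)))"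
      by (rule continuous_on_compose2[OF holo_fun_on_imp_continuous[OF f]])
        (use inS in \<open>auto intro!: continuous_intros\<close>)
    then show "continuous_on (ball x e \<times> cbox (0::real) 1) (\<lambda>(y, t). f (y + cauchy_pt v r t) * cauchy_ker r t)"
      using re(1) by (auto simp: case_prod_beta intro!: continuous_intros)
  qed
  then have "continuous_on (ball x e) (\<lambda>y. fd f y v)"
    by (rule continuous_on_cong[THEN iffD1, rotated -1])
      (use cauchy_formula[OF f re(1) re(3)] in \<open>auto simp: box_real\<close>)
  then show "isCont (\<lambda>x. fd f x v) x"
    using re(2) by (simp add: continuous_on_eq_continuous_at)
qed

lemma has_derivative_fd:
  fixes f :: "complex^'n \<Rightarrow> complex"
  assumes f: "holo_fun_on f S" and S: "open S"
    and re: "r > 0" "e > 0" "\<And>y z. y \<in> ball x e \<Longrightarrow> norm z \<le> r \<Longrightarrow> y + z *s v \<in> S"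
  shows "((\<lambda>y. fd f y v) has_derivative
    (\<lambda>w. integral {0..1} (\<lambda>t. fd f (x + cauchy_pt v r t) w * cauchy_ker r t))) (at x)"
proof -
  have inS: "y + cauchy_pt v r t \<in> S" if "y \<in> ball x e" for y t
    unfolding cauchy_pt_def by (rule re(3)[OF that]) (use re in \<open>simp add: circlepath norm_mult\<close>)
  define P where "P i = Blinfun (\<lambda>w :: complex^'n. w $ i)" for i
  have P: "blinfun_apply (P i) w = w $ i" for i w
    unfolding P_def by (simp add: bounded_linear_Blinfun_apply bounded_linear_vec_nth)
  \<comment> \<open>The Leibniz rule wants the derivative as a bounded linear map that is jointly
    continuous in y and t. Written in coordinates, this is the continuity of finitely many scalar
    derivatives.\<close>
  define F where "F y t = (\<Sum>i\<in>UNIV. blinfun_mult_right (fd f (y + cauchy_pt v r t) (axis i 1) * cauchy_ker r t) o\<^sub>L P i)" for y t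
  have F: "blinfun_apply (F y t) w = fd f (y + cauchy_pt v r t) w * cauchy_ker r t" if "y \<in> ball x e" for y t w
    using holo_fun_on_fd_expansion[OF f inS[OF that], where v = w]
    by (simp add: F_def blinfun.sum_left P sum_distrib_left mult_ac)
  have cF: "continuous_on (ball x e \<times> cbox (0::real) 1) (\<lambda>(y, t). F y t)"
  proof -
    have "continuous_on (ball x e \<times> cbox (0::real) 1) (\<lambda>p. fd f (fst p + cauchy_pt v r (snd p)) w)" for w
      by (rule continuous_on_compose2[OF continuous_on_fd[OF f S]])
        (use inS in \<open>auto intro!: continuous_intros\<close>)
    then show ?thesis
      unfolding F_def using re(1) by (auto simp: case_prod_beta intro!: continuous_intros)
  qed
  have cf: "continuous_on (cbox (0::real) 1) (\<lambda>t. f (y + cauchy_pt v r t) * cauchy_ker r t)" if "y \<in> ball x e" for y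
  proof -
    have "continuous_on (cbox (0::real) 1) (\<lambda>t. f (y + cauchy_pt v r t))"
      by (rule continuous_on_compose2[OF holo_fun_on_imp_continuous[OF f]])
        (use inS that in \<open>auto intro!: continuous_intros\<close>)
    then show ?thesis using re(1) by (auto intro!: continuous_intros)
  qed
  have "((\<lambda>y. integral (cbox (0::real) 1) (\<lambda>t. f (y + cauchy_pt v r t) * cauchy_ker r t)) has_derivative
      integral (cbox (0::real) 1) (F x)) (at x within ball x e)"
  proof (rule leibniz_rule[OF _ _ cF])
    fix y t assume y: "y \<in> ball x e"
    have "((\<lambda>y. f (y + cauchy_pt v r t)) has_derivative fd f (y + cauchy_pt v r t)) (at y within ball x e)"
      by (rule has_derivative_compose[of "\<lambda>y. y + cauchy_pt v r t" "\<lambda>y. y" y "ball x e",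
          OF _ holo_fun_onD(1)[OF f inS[OF y]]]) (auto intro!: derivative_eq_intros)
    then have d: "((\<lambda>y. f (y + cauchy_pt v r t) * cauchy_ker r t) has_derivative
      (\<lambda>w. fd f (y + cauchy_pt v r t) w * cauchy_ker r t)) (at y within ball x e)"
      by (auto intro!: derivative_eq_intros)
    have "blinfun_apply (F y t) = (\<lambda>w. fd f (y + cauchy_pt v r t) w * cauchy_ker r t)"
      by (rule ext) (rule F[OF y])
    with d show "((\<lambda>y. f (y + cauchy_pt v r t) * cauchy_ker r t) has_derivative blinfun_apply (F y t)) (at y within ball x e)"
      by (simp only:)
  qed (use re(2) integrable_continuous[OF cf] in auto)
  moreover have "at x within ball x e = at x"
    by (rule at_within_open) (use re(2) in auto)
  ultimately have "((\<lambda>y. integral (cbox (0::real) 1) (\<lambda>t. f (y + cauchy_pt v r t) * cauchy_ker r t)) has_derivative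
      integral (cbox (0::real) 1) (F x)) (at x)"
    by (simp only:)
  then have d: "((\<lambda>y. fd f y v) has_derivative integral (cbox (0::real) 1) (F x)) (at x)"
  proof (rule has_derivative_transform_within_open[OF _ open_ball[of x e]])
    fix y assume "y \<in> ball x e"
    from cauchy_formula[OF f re(1) re(3)[OF this]]
    show "integral (cbox 0 1) (\<lambda>t. f (y + cauchy_pt v r t) * cauchy_ker r t) = fd f y v"
      by (simp add: box_real)
  qed (use re(2) in auto)
  have "F x integrable_on cbox (0::real) 1"
    by (rule integrable_continuous, rule continuous_on_compose2[OF cF, where f = "Pair x", simplified])
      (use re in \<open>auto intro!: continuous_intros\<close>)
  then have eq: "blinfun_apply (integral (cbox (0::real) 1) (F x)) w =
    integral {0..1} (\<lambda>t. fd f (x + cauchy_pt v r t) w * cauchy_ker r t)" for w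
    using F[of x] re(2) by (simp add: blinfun_apply_integral box_real)
  have "blinfun_apply (integral (cbox (0::real) 1) (F x)) =
      (\<lambda>w. integral {0..1} (\<lambda>t. fd f (x + cauchy_pt v r t) w * cauchy_ker r t))"
    by (rule ext) (rule eq)
  with d show ?thesis by (simp only:)
qed

lemma holo_fun_on_fd:
  fixes f :: "complex^'n \<Rightarrow> complex"
  assumes f: "holo_fun_on f S" and S: "open S"
  shows "holo_fun_on (\<lambda>x. fd f x v) S"
  unfolding holo_fun_on_def
proof
  fix x assume x: "x \<in> S"
  obtain r e where re: "r > 0" "e > 0" "\<And>y z. y \<in> ball x e \<Longrightarrow> norm z \<le> r \<Longrightarrow> y + z *s v \<in> S"
    using uniform_radius[OF S x] by metis
  have inS: "x + cauchy_pt v r t \<in> S" for t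
    unfolding cauchy_pt_def by (rule re(3)) (use re in \<open>simp_all add: circlepath norm_mult\<close>)
  show "\<exists>f'. ((\<lambda>x. fd f x v) has_derivative f') (at x) \<and> (\<forall>k v. f' (k *s v) = k * f' v)"
    using has_derivative_fd[OF f S re]
    by (intro exI conjI) (assumption, simp add: holo_fun_onD(2)[OF f inS] mult.assoc)
qed

text \<open>Applying Cauchy's formula in direction \<open>v\<close> to \<open>y \<mapsto> fd f y w\<close> gives the same integral as
  differentiating Cauchy's formula for \<open>y \<mapsto> fd f y v\<close> in direction \<open>w\<close>.\<close>

lemma fd_fd_commute:
  fixes f :: "complex^'n \<Rightarrow> complex"
  assumes f: "holo_fun_on f S" and S: "open S" and x: "x \<in> S"
  shows "fd (\<lambda>y. fd f y v) x w = fd (\<lambda>y. fd f y w) x v"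
proof -
  obtain r e where re: "r > 0" "e > 0" "\<And>y z. y \<in> ball x e \<Longrightarrow> norm z \<le> r \<Longrightarrow> y + z *s v \<in> S"
    using uniform_radius[OF S x] by metis
  show ?thesis
    using fd_eqI[OF has_derivative_fd[OF f S re]]
      cauchy_formula[OF holo_fun_on_fd[OF f S, of w] re(1) re(3)] re(2) by simp
qed

lemma holo_map_on_fd:
  fixes f :: "complex^'n \<Rightarrow> complex^'m"
  assumes "holo_map_on f S" "open S"
  shows "holo_map_on (\<lambda>x. fd f x v) S"
  unfolding holo_map_on_def
proof
  fix i
  have "holo_fun_on (\<lambda>x. fd (\<lambda>y. f y $ i) x v) S"
    using assms by (intro holo_fun_on_fd) (auto simp: holo_map_on_def)
  then show "holo_fun_on (\<lambda>x. fd f x v $ i) S"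
    by (rule holo_fun_on_cong[OF assms(2), rotated]) (simp add: holo_map_onD(2)[OF assms(1)])
qed

lemma fd_map_fd_commute:
  fixes f :: "complex^'n \<Rightarrow> complex^'m"
  assumes f: "holo_map_on f S" and S: "open S" and x: "x \<in> S"
  shows "fd (\<lambda>y. fd f y v) x w = fd (\<lambda>y. fd f y w) x v"
  unfolding vec_eq_iff
proof
  fix i
  have h: "holo_fun_on (\<lambda>y. f y $ i) S" using f by (simp add: holo_map_on_def)
  have "fd (\<lambda>y. fd f y v) x w $ i = fd (\<lambda>y. fd (\<lambda>y. f y $ i) y v) x w" for v w
    unfolding holo_map_onD(2)[OF holo_map_on_fd[OF f S] x]
    by (rule fun_cong[OF fd_cong[OF S x]]) (rule holo_map_onD(2)[OF f])
  then show "fd (\<lambda>y. fd f y v) x w $ i = fd (\<lambda>y. fd f y w) x v $ i"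
    using fd_fd_commute[OF h S x] by simp
qed

lemma holo_map_on_fd_apply:
  fixes f :: "complex^'n \<Rightarrow> complex^'m"
  assumes "holo_map_on f S" "holo_map_on g S" "open S"
  shows "holo_map_on (\<lambda>x. fd f x (g x)) S"
proof -
  have "holo_map_on (\<lambda>x. \<Sum>i\<in>UNIV. g x $ i *s fd f x (axis i 1)) S"
    using assms(2) by (intro holo_map_on_sum holo_map_on_scale holo_map_on_fd[OF assms(1,3)])
      (auto simp: holo_map_on_def)
  then show ?thesis
    by (rule holo_map_on_cong[OF assms(3), rotated]) (simp add: holo_map_on_fd_expansion[OF assms(1), symmetric])
qed

text \<open>Leibniz rule for \<open>fd f\<close> evaluated on a moving vector. Freezing the vector
  at g x isolates the second derivative of f, the source of the inhomogeneous term in every change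
  of chart below.\<close>

lemma fd_fd_apply:
  fixes f :: "complex^'n \<Rightarrow> complex^'m"
  assumes f: "holo_map_on f S" and g: "holo_map_on g S" and S: "open S" and x: "x \<in> S"
  shows "fd (\<lambda>y. fd f y (g y)) x w = fd (\<lambda>y. fd f y (g x)) x w + fd f x (fd g x w)"
proof -
  have gi: "holo_fun_on (\<lambda>y. g y $ i) S" for i using g by (simp add: holo_map_on_def)
  have fi: "holo_map_on (\<lambda>y. fd f y (axis i 1)) S" for i by (rule holo_map_on_fd[OF f S])
  have "fd (\<lambda>y. fd f y (g y)) x w = fd (\<lambda>y. \<Sum>i\<in>UNIV. g y $ i *s fd f y (axis i 1)) x w"
    by (rule fun_cong[OF fd_cong[OF S x]]) (rule holo_map_on_fd_expansion[OF f])
  also have "\<dots> = (\<Sum>i\<in>UNIV. fd g x w $ i *s fd f x (axis i 1) + g x $ i *s fd (\<lambda>y. fd f y (axis i 1)) x w)"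
    by (subst fd_map_sum[where S = S])
      (use x gi fi in \<open>auto intro!: sum.cong simp: fd_map_scale[where S = S] holo_map_onD(2)[OF g x]\<close>)
  also have "\<dots> = fd f x (fd g x w) + (\<Sum>i\<in>UNIV. g x $ i *s fd (\<lambda>y. fd f y (axis i 1)) x w)"
    by (simp add: sum.distrib holo_map_on_fd_expansion[OF f x, symmetric])
  also have "(\<Sum>i\<in>UNIV. g x $ i *s fd (\<lambda>y. fd f y (axis i 1)) x w) = fd (\<lambda>y. \<Sum>i\<in>UNIV. g x $ i *s fd f y (axis i 1)) x w"
    by (subst fd_map_sum[where S = S]) (use x fi in \<open>auto intro!: sum.cong simp: fd_map_scale[where S = S]\<close>)
  also have "\<dots> = fd (\<lambda>y. fd f y (g x)) x w"
    by (rule fun_cong[OF fd_cong[OF S x]]) (rule holo_map_on_fd_expansion[OF f, symmetric])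
  finally show ?thesis by simp
qed

subsection \<open>Charts and tangent vectors\<close>

locale complex_manifold =
  fixes A :: "('a, 'n::finite) chart set"
  assumes chart_inj: "c \<in> A \<Longrightarrow> inj_on (coord c) (fst c)"
    and chart_open: "c \<in> A \<Longrightarrow> d \<in> A \<Longrightarrow> open (coord c ` (fst c \<inter> fst d))"
    and transition_holo:
      "c \<in> A \<Longrightarrow> d \<in> A \<Longrightarrow> holo_map_on (transition c d) (coord c ` (fst c \<inter> fst d))"

lemma param_coord_inj:
  assumes "inj_on (coord c) (fst c)" "p \<in> fst c"
  shows "param c (coord c p) = p"
  using inv_into_f_f[OF assms] unfolding param_def coord_def .

definition jac :: "('a, 'n::finite) chart \<Rightarrow> ('a, 'n) chart \<Rightarrow> 'a \<Rightarrow> complex^'n \<Rightarrow> complex^'n" where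
  "jac c d p = fd (transition c d) (coord c p)"

context complex_manifold
begin

lemma param_coord [simp]: "c \<in> A \<Longrightarrow> p \<in> fst c \<Longrightarrow> param c (coord c p) = p"
  by (rule param_coord_inj[OF chart_inj])

lemma transition_coord [simp]: "c \<in> A \<Longrightarrow> p \<in> fst c \<Longrightarrow> transition c d (coord c p) = coord d p"
  by (simp add: transition_def)

lemma open_coord: "open_in_mfd A V \<Longrightarrow> c \<in> A \<Longrightarrow> open (coord c ` (fst c \<inter> V))"
  by (simp add: open_in_mfd_def)

lemma chart_subset: "c \<in> A \<Longrightarrow> fst c \<subseteq> carrier_of A"
  by (auto simp: carrier_of_def)

lemma open_mfd_chart: "c \<in> A \<Longrightarrow> open_in_mfd A (fst c)"
  using chart_open chart_subset by (auto simp: open_in_mfd_def)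

lemma open_mfd_Int:
  assumes "open_in_mfd A V" "open_in_mfd A W"
  shows "open_in_mfd A (V \<inter> W)"
  unfolding open_in_mfd_def
proof (intro conjI ballI)
  show "V \<inter> W \<subseteq> carrier_of A" using assms by (auto simp: open_in_mfd_def)
  fix c assume c: "c \<in> A"
  have "coord c ` (fst c \<inter> (V \<inter> W)) = coord c ` (fst c \<inter> V) \<inter> coord c ` (fst c \<inter> W)"
    using chart_inj[OF c] by (auto simp: inj_on_def)
  then show "open (coord c ` (fst c \<inter> (V \<inter> W)))"
    using assms c by (auto simp: open_in_mfd_def)
qed

lemma open_coord_Int:
  assumes "open_in_mfd A V" "c \<in> A" "d \<in> A"
  shows "open (coord c ` (fst c \<inter> fst d \<inter> V))"
  using open_coord[OF open_mfd_Int[OF open_mfd_chart[OF assms(3)] assms(1)] assms(2)]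
  by (simp add: Int_assoc)

lemma chart_at: "p \<in> carrier_of A \<Longrightarrow> chart_at A p \<in> A \<and> p \<in> fst (chart_at A p)"
  unfolding chart_at_def by (rule someI_ex) (auto simp: carrier_of_def)

lemma open_mfdD: "open_in_mfd A V \<Longrightarrow> p \<in> V \<Longrightarrow> p \<in> carrier_of A"
  by (auto simp: open_in_mfd_def)

lemma chart_around:
  assumes "p \<in> carrier_of A" obtains c where "c \<in> A" "p \<in> fst c"
  using assms by (auto simp: carrier_of_def)

lemma jac_works:
  assumes "c \<in> A" "d \<in> A" "p \<in> fst c" "p \<in> fst d"
  shows "(transition c d has_derivative jac c d p) (at (coord c p))"
    "jac c d p (k *s v) = k *s jac c d p v" "jac c d p (v + w) = jac c d p v + jac c d p w"
    "jac c d p 0 = 0"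
  unfolding jac_def
  using holo_map_onD[OF transition_holo[OF assms(1,2)], of "coord c p"] assms(3,4) by auto

lemma jac_linear:
  assumes "c \<in> A" "d \<in> A" "p \<in> fst c" "p \<in> fst d"
  shows "jac c d p (v - w) = jac c d p v - jac c d p w" "jac c d p (- v) = - jac c d p v"
    "jac c d p (\<Sum>i\<in>I. f i) = (\<Sum>i\<in>I. jac c d p (f i))"
proof -
  have "linear (jac c d p)"
    using jac_works(1)[OF assms] has_derivative_linear by blast
  then show "jac c d p (v - w) = jac c d p v - jac c d p w" "jac c d p (- v) = - jac c d p v"
    "jac c d p (\<Sum>i\<in>I. f i) = (\<Sum>i\<in>I. jac c d p (f i))"
    by (auto simp: linear_diff linear_neg linear_sum)
qed

lemma jac_self [simp]:
  assumes "c \<in> A" "p \<in> fst c"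
  shows "jac c c p v = v"
proof -
  have "fd (transition c c) (coord c p) = fd (\<lambda>x. x) (coord c p)"
    by (rule fd_cong[OF chart_open[OF assms(1,1)]]) (use assms in auto)
  then show ?thesis by (simp add: jac_def)
qed

lemma jac_comp:
  assumes c: "c \<in> A" "p \<in> fst c" and d: "d \<in> A" "p \<in> fst d" and e: "e \<in> A" "p \<in> fst e"
  shows "jac d e p (jac c d p v) = jac c e p v"
proof -
  let ?S = "coord c ` (fst c \<inter> fst d \<inter> fst e)"
  have "fd (transition c e) (coord c p) = fd (\<lambda>x. transition d e (transition c d x)) (coord c p)"
    by (rule fd_cong[OF open_coord_Int[OF open_mfd_chart[OF e(1)] c(1) d(1)]])
      (use assms in auto)
  then show ?thesis
    unfolding jac_def using fd_compose_map[OF transition_holo[OF d(1) e(1)] transition_holo[OF c(1) d(1)],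
        of "coord c p" v] assms by simp
qed

lemma jac_inv [simp]:
  assumes "c \<in> A" "p \<in> fst c" "d \<in> A" "p \<in> fst d"
  shows "jac d c p (jac c d p v) = v"
  using jac_comp[OF assms assms(1,2)] assms by simp

text \<open>Inverse of reading off the component in c: tangent vectors at p correspond to their
  components in one chart.\<close>

definition vec_of :: "('a, 'n) chart \<Rightarrow> 'a \<Rightarrow> complex^'n \<Rightarrow> ('a, 'n) tvec" where
  "vec_of c p w = (\<lambda>d. if d \<in> A \<and> p \<in> fst d then jac c d p w else 0)"

lemma vec_of_apply: "d \<in> A \<Longrightarrow> p \<in> fst d \<Longrightarrow> vec_of c p w d = jac c d p w"
  by (simp add: vec_of_def)

lemma vec_of_apply_self [simp]: "c \<in> A \<Longrightarrow> p \<in> fst c \<Longrightarrow> vec_of c p w c = w"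
  by (simp add: vec_of_def)

lemma coord_vector_eq: "coord_vector A c p i = vec_of c p (axis i 1)"
  unfolding coord_vector_def vec_of_def jac_def ..

lemma tangentI:
  assumes "\<And>c d. c \<in> A \<Longrightarrow> p \<in> fst c \<Longrightarrow> d \<in> A \<Longrightarrow> p \<in> fst d \<Longrightarrow> t d = jac c d p (t c)"
    and "\<And>c. \<not> (c \<in> A \<and> p \<in> fst c) \<Longrightarrow> t c = 0"
  shows "t \<in> tangent_space A p"
  unfolding tangent_space_def jac_def[symmetric]
  by (intro CollectI conjI ballI impI allI; (rule assms)?) auto

lemma vec_of_tangent [simp]:
  assumes "c \<in> A" "p \<in> fst c" shows "vec_of c p w \<in> tangent_space A p"
proof (rule tangentI)
  fix d e assume "d \<in> A" "p \<in> fst d" "e \<in> A" "p \<in> fst e"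
  then show "vec_of c p w e = jac d e p (vec_of c p w d)"
    using jac_comp[OF assms] by (simp add: vec_of_apply)
qed (auto simp: vec_of_def)

lemma tangent_jac:
  assumes "t \<in> tangent_space A p" "c \<in> A" "p \<in> fst c" "d \<in> A" "p \<in> fst d"
  shows "t d = jac c d p (t c)"
proof -
  have "\<forall>c\<in>A. \<forall>d\<in>A. p \<in> fst c \<inter> fst d \<longrightarrow> t d = fd (transition c d) (coord c p) (t c)"
    using assms(1) unfolding tangent_space_def by (elim CollectE conjE)
  from this[rule_format, OF assms(2,4)] assms(3,5) show ?thesis
    unfolding jac_def by simp
qed

lemma tangent_off: "t \<in> tangent_space A p \<Longrightarrow> \<not> (c \<in> A \<and> p \<in> fst c) \<Longrightarrow> t c = 0"
  unfolding tangent_space_def by (elim CollectE conjE allE[of _ c], erule mp)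

lemma tangent_eq_vec_of:
  assumes "t \<in> tangent_space A p" "c \<in> A" "p \<in> fst c"
  shows "vec_of c p (t c) = t"
proof
  fix d show "vec_of c p (t c) d = t d"
    using tangent_jac[OF assms, of d] tangent_off[OF assms(1), of d] by (auto simp: vec_of_def)
qed

lemma tangent_eqI:
  assumes "t \<in> tangent_space A p" "u \<in> tangent_space A p" "c \<in> A" "p \<in> fst c" "t c = u c"
  shows "t = u"
proof -
  have "vec_of c p (t c) = vec_of c p (u c)" by (simp only: assms(5))
  then show ?thesis
    unfolding tangent_eq_vec_of[OF assms(1,3,4)] tangent_eq_vec_of[OF assms(2,3,4)] .
qed

lemma tangent_zero [simp]: "0 \<in> tangent_space A p"
  by (rule tangentI) (simp_all add: jac_works(4))

lemma tangent_add:
  assumes "t \<in> tangent_space A p" "u \<in> tangent_space A p"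
  shows "t + u \<in> tangent_space A p"
proof (rule tangentI)
  fix c d assume cd: "c \<in> A" "p \<in> fst c" "d \<in> A" "p \<in> fst d"
  show "(t + u) d = jac c d p ((t + u) c)"
    unfolding plus_fun_def jac_works(3)[OF cd(1,3,2,4)] tangent_jac[OF assms(1) cd] tangent_jac[OF assms(2) cd] ..
qed (use tangent_off[OF assms(1)] tangent_off[OF assms(2)] in auto)

lemma tangent_scale:
  assumes "t \<in> tangent_space A p"
  shows "tscale k t \<in> tangent_space A p"
proof (rule tangentI)
  fix c d assume cd: "c \<in> A" "p \<in> fst c" "d \<in> A" "p \<in> fst d"
  show "tscale k t d = jac c d p (tscale k t c)"
    unfolding tscale_def jac_works(2)[OF cd(1,3,2,4)] tangent_jac[OF assms(1) cd] ..
qed (use tangent_off[OF assms] in \<open>auto simp: tscale_def\<close>)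

lemma tangent_diff:
  assumes "t \<in> tangent_space A p" "u \<in> tangent_space A p"
  shows "t - u \<in> tangent_space A p"
proof (rule tangentI)
  fix c d assume cd: "c \<in> A" "p \<in> fst c" "d \<in> A" "p \<in> fst d"
  show "(t - u) d = jac c d p ((t - u) c)"
    unfolding fun_diff_def jac_linear(1)[OF cd(1,3,2,4)] tangent_jac[OF assms(1) cd] tangent_jac[OF assms(2) cd] ..
qed (use tangent_off[OF assms(1)] tangent_off[OF assms(2)] in auto)

lemma tscale_apply [simp]: "tscale k t c = k *s t c"
  by (simp add: tscale_def)

lemma tscale_zero [simp]: "tscale k 0 = 0"
  by (simp add: tscale_def zero_fun_def)

subsection \<open>Functions and vector fields\<close>

lemma holo_functionsD:
  "f \<in> holo_functions A V \<Longrightarrow> c \<in> A \<Longrightarrow> holo_fun_on (\<lambda>x. f (param c x)) (coord c ` (fst c \<inter> V))"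
  by (simp add: holo_functions_def comp_def)

text \<open>Holomorphy is demanded in every chart of a possibly maximal atlas; composing with
  transition maps, one chart around each point is enough.\<close>

lemma holo_functionsI_local:
  assumes "\<And>p. p \<in> V \<Longrightarrow> \<exists>c N. c \<in> A \<and> p \<in> fst c \<and> open_in_mfd A N \<and> p \<in> N \<and>
      holo_fun_on (\<lambda>x. f (param c x)) (coord c ` (fst c \<inter> N))"
  shows "f \<in> holo_functions A V"
  unfolding holo_functions_def comp_def
proof (intro CollectI ballI, rule holo_fun_on_local)
  fix d y assume d: "d \<in> A" and "y \<in> coord d ` (fst d \<inter> V)"
  then obtain p where p: "p \<in> fst d" "p \<in> V" "y = coord d p" by auto
  with assms obtain c N where c: "c \<in> A" "p \<in> fst c" "open_in_mfd A N" "p \<in> N"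
    and h: "holo_fun_on (\<lambda>x. f (param c x)) (coord c ` (fst c \<inter> N))" by blast
  let ?O = "coord d ` (fst d \<inter> fst c \<inter> N)"
  have "holo_fun_on (\<lambda>y. f (param c (transition d c y))) ?O"
    by (rule holo_fun_on_compose[OF h holo_map_on_subset[OF transition_holo[OF d c(1)]]])
      (use d c in auto)
  then have "holo_fun_on (\<lambda>y. f (param d y)) ?O"
    by (rule holo_fun_on_cong[OF open_coord_Int[OF c(3) d c(1)], rotated]) (use d c in auto)
  then show "\<exists>T. open T \<and> y \<in> T \<and> holo_fun_on (\<lambda>x. f (param d x)) T"
    using open_coord_Int[OF c(3) d c(1)] p c by blast
qed

lemma vector_fieldsD:
  assumes "X \<in> vector_fields A V"
  shows "p \<in> V \<Longrightarrow> X p \<in> tangent_space A p" "p \<notin> V \<Longrightarrow> X p = 0"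
    "c \<in> A \<Longrightarrow> holo_map_on (\<lambda>x. X (param c x) c) (coord c ` (fst c \<inter> V))"
  using assms unfolding vector_fields_def by blast+

text \<open>Components in another chart arise by applying the Jacobian at a moving point to the
  components in the good chart, hence the appeal to \<open>holo_map_on_fd_apply\<close>.\<close>

lemma vector_fieldsI_local:
  assumes "\<And>p. p \<in> V \<Longrightarrow> X p \<in> tangent_space A p" "\<And>p. p \<notin> V \<Longrightarrow> X p = 0"
    and "\<And>p. p \<in> V \<Longrightarrow> \<exists>c N. c \<in> A \<and> p \<in> fst c \<and> open_in_mfd A N \<and> p \<in> N \<and> N \<subseteq> V \<and>
      holo_map_on (\<lambda>x. X (param c x) c) (coord c ` (fst c \<inter> N))"
  shows "X \<in> vector_fields A V"
  unfolding vector_fields_def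
proof (intro CollectI conjI ballI allI impI)
  fix d assume d: "d \<in> A"
  show "holo_map_on (\<lambda>x. X (param d x) d) (coord d ` (fst d \<inter> V))"
  proof (rule holo_map_on_local)
    fix y assume "y \<in> coord d ` (fst d \<inter> V)"
    then obtain p where p: "p \<in> fst d" "p \<in> V" "y = coord d p" by auto
    with assms(3) obtain c N where c: "c \<in> A" "p \<in> fst c" "open_in_mfd A N" "p \<in> N" "N \<subseteq> V"
      and h: "holo_map_on (\<lambda>x. X (param c x) c) (coord c ` (fst c \<inter> N))" by blast
    let ?O = "coord d ` (fst d \<inter> fst c \<inter> N)" and ?P = "coord c ` (fst c \<inter> fst d \<inter> N)"
    have "holo_map_on (\<lambda>x. fd (transition c d) x (X (param c x) c)) ?P"
      by (rule holo_map_on_fd_apply[OF holo_map_on_subset[OF transition_holo[OF c(1) d]]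
            holo_map_on_subset[OF h] open_coord_Int[OF c(3,1) d]]) auto
    then have "holo_map_on (\<lambda>y. fd (transition c d) (transition d c y) (X (param c (transition d c y)) c)) ?O"
      by (rule holo_map_on_compose[OF _ holo_map_on_subset[OF transition_holo[OF d c(1)]]])
        (use d c in auto)
    then have "holo_map_on (\<lambda>y. X (param d y) d) ?O"
    proof (rule holo_map_on_cong[OF open_coord_Int[OF c(3) d c(1)], rotated])
      fix x assume "x \<in> ?O"
      then obtain q where q: "q \<in> fst d" "q \<in> fst c" "q \<in> N" "x = coord d q" by auto
      show "fd (transition c d) (transition d c x) (X (param c (transition d c x)) c) = X (param d x) d"
        using tangent_jac[OF assms(1), of q c d] q c d by (auto simp: jac_def)
    qed
    then show "\<exists>T. open T \<and> y \<in> T \<and> holo_map_on (\<lambda>x. X (param d x) d) T"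
      using open_coord_Int[OF c(3) d c(1)] p c by blast
  qed
qed (use assms in auto)

lemma vector_fieldsI_chart:
  assumes "open_in_mfd A V" "c \<in> A" "V \<subseteq> fst c"
    "\<And>p. p \<in> V \<Longrightarrow> X p \<in> tangent_space A p" "\<And>p. p \<notin> V \<Longrightarrow> X p = 0"
    "holo_map_on (\<lambda>x. X (param c x) c) (coord c ` (fst c \<inter> V))"
  shows "X \<in> vector_fields A V"
  by (rule vector_fieldsI_local) (use assms in blast)+

lemma vector_fieldsI:
  assumes "\<And>p. p \<in> V \<Longrightarrow> X p \<in> tangent_space A p" "\<And>p. p \<notin> V \<Longrightarrow> X p = 0"
    "\<And>c. c \<in> A \<Longrightarrow> holo_map_on (\<lambda>x. X (param c x) c) (coord c ` (fst c \<inter> V))"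
  shows "X \<in> vector_fields A V"
  unfolding vector_fields_def by (intro CollectI conjI ballI impI allI; (rule assms; assumption)?)

lemma vector_fields_add:
  assumes "X \<in> vector_fields A V" "Y \<in> vector_fields A V"
  shows "X + Y \<in> vector_fields A V"
  by (rule vector_fieldsI)
    (use vector_fieldsD[OF assms(1)] vector_fieldsD[OF assms(2)] in
      \<open>auto simp: plus_fun_def intro!: tangent_add[unfolded plus_fun_def] holo_map_on_add\<close>)

lemma vector_fields_fscale:
  assumes "f \<in> holo_functions A V" "X \<in> vector_fields A V"
  shows "fscale f X \<in> vector_fields A V"
proof (rule vector_fieldsI)
  fix c assume c: "c \<in> A"
  show "holo_map_on (\<lambda>x. fscale f X (param c x) c) (coord c ` (fst c \<inter> V))"
    using holo_functionsD[OF assms(1) c] vector_fieldsD(3)[OF assms(2) c]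
    by (auto simp: fscale_def tscale_def)
qed (simp_all add: fscale_def tangent_scale vector_fieldsD(1,2)[OF assms(2)])

lemma vector_fields_restrict:
  assumes "X \<in> vector_fields A V" "W \<subseteq> V" "open_in_mfd A W"
  shows "restrict_field W X \<in> vector_fields A W"
proof -
  have "holo_map_on (\<lambda>x. restrict_field W X (param c x) c) (coord c ` (fst c \<inter> W))" if c: "c \<in> A" for c
    by (rule holo_map_on_cong[OF open_coord[OF assms(3) c] _ holo_map_on_subset[OF vector_fieldsD(3)[OF assms(1) c]]])
      (use assms c in \<open>auto simp: restrict_field_def\<close>)
  then show ?thesis
    by (rule vector_fieldsI[rotated 2]) (use vector_fieldsD(1)[OF assms(1)] assms(2) in \<open>auto simp: restrict_field_def\<close>)
qed

lemma holo_functions_component: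
  assumes "X \<in> vector_fields A V" "open_in_mfd A V" "V \<subseteq> fst c" "c \<in> A"
  shows "(\<lambda>p. X p c $ i) \<in> holo_functions A V"
proof (rule holo_functionsI_local)
  fix p assume "p \<in> V"
  then show "\<exists>d N. d \<in> A \<and> p \<in> fst d \<and> open_in_mfd A N \<and> p \<in> N \<and>
      holo_fun_on (\<lambda>x. X (param d x) c $ i) (coord d ` (fst d \<inter> N))"
    using vector_fieldsD(3)[OF assms(1,4)] assms
    by (intro exI[of _ c] exI[of _ V]) (auto simp: holo_map_on_def)
qed

definition const_field :: "('a, 'n) chart \<Rightarrow> 'a set \<Rightarrow> complex^'n \<Rightarrow> ('a, 'n) vfield" where
  "const_field c V v = (\<lambda>p. if p \<in> V then vec_of c p v else 0)"

lemma const_field_vector_field: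
  assumes "open_in_mfd A V" "V \<subseteq> fst c" "c \<in> A"
  shows "const_field c V v \<in> vector_fields A V"
proof (rule vector_fieldsI_chart[OF assms(1,3,2)])
  show "holo_map_on (\<lambda>x. const_field c V v (param c x) c) (coord c ` (fst c \<inter> V))"
    by (rule holo_map_on_cong[OF open_coord[OF assms(1,3)], of "\<lambda>x. v"])
      (use assms in \<open>auto simp: const_field_def\<close>)
qed (use assms in \<open>auto simp: const_field_def\<close>)

lemma const_field_apply [simp]: "p \<in> V \<Longrightarrow> const_field c V v p = vec_of c p v"
  by (simp add: const_field_def)

lemma fd_const_field:
  assumes "open_in_mfd A V" "V \<subseteq> fst c" "c \<in> A" "p \<in> V"
  shows "fd (\<lambda>x. const_field c V v (param c x) c) (coord c p) w = 0"
proof -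
  have "fd (\<lambda>x. const_field c V v (param c x) c) (coord c p) = fd (\<lambda>x. v) (coord c p)"
    by (rule fd_cong[OF open_coord[OF assms(1,3)]]) (use assms in \<open>auto simp: const_field_def\<close>)
  then show ?thesis by simp
qed

text \<open>Chain rule; it frees \<open>field_apply\<close> from the arbitrary chart
  \<open>chart_at A p\<close>.\<close>

lemma field_apply_chart:
  assumes "open_in_mfd A V" "f \<in> holo_functions A V" "X \<in> vector_fields A V" "p \<in> V" "c \<in> A" "p \<in> fst c"
  shows "field_apply A X f p = fd (\<lambda>x. f (param c x)) (coord c p) (X p c)"
proof -
  define d where "d = chart_at A p"
  have d: "d \<in> A" "p \<in> fst d" using chart_at open_mfdD[OF assms(1,4)] by (auto simp: d_def)
  have "fd (\<lambda>x. f (param c x)) (coord c p) (X p c) = fd (\<lambda>x. f (param d (transition c d x))) (coord c p) (X p c)"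
    by (rule fun_cong[OF fd_cong], rule open_coord_Int[OF assms(1,5) d(1)]) (use assms d in auto)
  also have "\<dots> = fd (\<lambda>x. f (param d x)) (coord d p) (jac c d p (X p c))"
    using fd_compose_fun[OF holo_functionsD[OF assms(2) d(1)]
        holo_map_on_subset[OF transition_holo[OF assms(5) d(1)]], of "coord c ` (fst c \<inter> fst d \<inter> V)" "coord c p"]
      assms d by (auto simp: jac_def)
  also have "jac c d p (X p c) = X p d"
    using tangent_jac[OF vector_fieldsD(1)[OF assms(3,4)] assms(5,6) d] by simp
  finally show ?thesis by (simp add: field_apply_def d_def comp_def Let_def)
qed

text \<open>Differentiating components is not a tensorial operation, and the second derivative of
  the transition map is the defect. The same identity yields the tensoriality of the bracket, the
  symbols of a standard connection in a foreign chart, and flatness in sheared coordinates.\<close>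

lemma fd_component_transition:
  assumes V: "open_in_mfd A V" and Y: "Y \<in> vector_fields A V"
    and p: "p \<in> V" "p \<in> fst c" "p \<in> fst d" and c: "c \<in> A" and d: "d \<in> A"
  shows "fd (\<lambda>x. Y (param d x) d) (coord d p) (jac c d p w) =
    fd (\<lambda>x. fd (transition c d) x (Y p c)) (coord c p) w + jac c d p (fd (\<lambda>x. Y (param c x) c) (coord c p) w)"
proof -
  let ?S = "coord c ` (fst c \<inter> fst d \<inter> V)" and ?S' = "coord d ` (fst d \<inter> fst c \<inter> V)"
  have S: "open ?S" "coord c p \<in> ?S" using open_coord_Int[OF V c d] p by auto
  have T: "holo_map_on (transition c d) ?S"
    by (rule holo_map_on_subset[OF transition_holo[OF c d]]) auto
  have Yc: "holo_map_on (\<lambda>x. Y (param c x) c) ?S"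
    by (rule holo_map_on_subset[OF vector_fieldsD(3)[OF Y c]]) auto
  have Yd: "holo_map_on (\<lambda>x. Y (param d x) d) ?S'"
    by (rule holo_map_on_subset[OF vector_fieldsD(3)[OF Y d]]) auto
  have "fd (\<lambda>x. Y (param d x) d) (coord d p) (jac c d p w) =
      fd (\<lambda>x. Y (param d (transition c d x)) d) (coord c p) w"
    using fd_compose_map[OF Yd T S(2), of w] c d p by (auto simp: jac_def)
  also have "\<dots> = fd (\<lambda>x. fd (transition c d) x (Y (param c x) c)) (coord c p) w"
  proof (rule fun_cong[OF fd_cong[OF S]])
    fix x assume "x \<in> ?S"
    then obtain q where q: "q \<in> fst d" "q \<in> fst c" "q \<in> V" "x = coord c q" by auto
    show "Y (param d (transition c d x)) d = fd (transition c d) x (Y (param c x) c)"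
      using tangent_jac[OF vector_fieldsD(1)[OF Y], of q c d] q c d by (auto simp: jac_def)
  qed
  also have "\<dots> = fd (\<lambda>x. fd (transition c d) x (Y p c)) (coord c p) w + jac c d p (fd (\<lambda>x. Y (param c x) c) (coord c p) w)"
    using fd_fd_apply[OF T Yc S, of w] c p by (simp add: jac_def)
  finally show ?thesis .
qed

text \<open>The second derivatives of the transition map cancel by symmetry.\<close>

lemma lie_bracket_tangent:
  assumes V: "open_in_mfd A V" and X: "X \<in> vector_fields A V" and Y: "Y \<in> vector_fields A V" and p: "p \<in> V"
  shows "lie_bracket A V X Y p \<in> tangent_space A p"
proof -
  have "lie_bracket A V X Y p d = jac c d p (lie_bracket A V X Y p c)"
    if c: "c \<in> A" "p \<in> fst c" and d: "d \<in> A" "p \<in> fst d" for c d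
  proof -
    let ?S = "coord c ` (fst c \<inter> fst d)"
    have S: "open ?S" "coord c p \<in> ?S" using chart_open[OF c(1) d(1)] c d by auto
    have Xd: "X p d = jac c d p (X p c)" and Yd: "Y p d = jac c d p (Y p c)"
      using tangent_jac[OF vector_fieldsD(1)[OF X p] c d] tangent_jac[OF vector_fieldsD(1)[OF Y p] c d] by auto
    show ?thesis
      using fd_component_transition[OF V Y p c(2) d(2) c(1) d(1), of "X p c"]
        fd_component_transition[OF V X p c(2) d(2) c(1) d(1), of "Y p c"]
        fd_map_fd_commute[OF transition_holo[OF c(1) d(1)] S, of "X p c" "Y p c"] c d p
        jac_linear(1)[OF c(1) d(1) c(2) d(2)]
      by (simp add: lie_bracket_def Xd Yd)
  qed
  then show ?thesis
    by (rule tangentI) (auto simp: lie_bracket_def)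
qed

end

subsection \<open>Maximal atlases\<close>

lemma maximal_atlas_superset:
  assumes "complex_manifold A" shows "A \<subseteq> maximal_atlas A"
proof
  interpret complex_manifold A by fact
  fix c assume c: "c \<in> A"
  have "open (coord d ` (fst c \<inter> fst d))" "holo_map_on (transition d c) (coord d ` (fst c \<inter> fst d))"
    if "d \<in> A" for d
    using chart_open[OF that c] transition_holo[OF that c] by (simp_all add: Int_commute)
  then show "c \<in> maximal_atlas A"
    unfolding maximal_atlas_def
    using c chart_inj chart_open transition_holo chart_subset by simp
qed

lemma maximal_atlas_carrier:
  assumes "complex_manifold A" shows "carrier_of (maximal_atlas A) = carrier_of A"
  using maximal_atlas_superset[OF assms] by (auto simp: carrier_of_def maximal_atlas_def)

text \<open>Charts of the maximal atlas are known to be compatible only with charts e of A; two of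
  them are compared locally by passing through such an e.\<close>

lemma maximal_atlas_manifold:
  fixes A :: "('a, 'n::finite) chart set"
  assumes "complex_manifold A"
  shows "complex_manifold (maximal_atlas A)"
proof -
  interpret complex_manifold A by fact
  have inj: "inj_on (coord c) (fst c)" if "c \<in> maximal_atlas A" for c
    using that by (simp add: maximal_atlas_def)
  note pc = param_coord_inj[OF inj]
  have M: "open (coord c ` (fst c \<inter> fst e))" "open (coord e ` (fst c \<inter> fst e))"
    "holo_map_on (transition c e) (coord c ` (fst c \<inter> fst e))"
    "holo_map_on (transition e c) (coord e ` (fst c \<inter> fst e))"
    if "c \<in> maximal_atlas A" "e \<in> A" for c e
    using that by (auto simp: maximal_atlas_def)
  \<comment> \<open>The triple overlap is the preimage, under the continuous transition from c to e,
    of an overlap known to be open.\<close>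
  have op: "open (coord c ` (fst c \<inter> fst d \<inter> fst e))"
    if c: "c \<in> maximal_atlas A" and d: "d \<in> maximal_atlas A" and e: "e \<in> A" for c d e
  proof -
    have "coord c ` (fst c \<inter> fst d \<inter> fst e) =
        coord c ` (fst c \<inter> fst e) \<inter> transition c e -` (coord e ` (fst d \<inter> fst e))" (is "?L = ?R")
    proof
      show "?L \<subseteq> ?R" by (auto simp: transition_def pc[OF c])
      show "?R \<subseteq> ?L"
      proof
        fix x assume "x \<in> ?R"
        then obtain p q where p: "p \<in> fst c" "p \<in> fst e" "x = coord c p"
          and q: "q \<in> fst d" "q \<in> fst e" "transition c e x = coord e q" by blast
        then have "coord e p = coord e q" by (auto simp: transition_def pc[OF c])
        then have "p = q" using chart_inj[OF e] p q by (auto simp: inj_on_def)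
        then show "x \<in> ?L" using p q by auto
      qed
    qed
    moreover have "open ?R"
      by (rule continuous_open_preimage[OF holo_map_on_imp_continuous[OF M(3)[OF c e]] M(1)[OF c e] M(2)[OF d e]])
    ultimately show ?thesis by simp
  qed
  have cover: "\<exists>e\<in>A. p \<in> fst e" if "c \<in> maximal_atlas A" "p \<in> fst c" for c p
    using that by (auto simp: maximal_atlas_def carrier_of_def)
  show ?thesis
  proof
    fix c d assume c: "c \<in> maximal_atlas A" and d: "d \<in> maximal_atlas A"
    have "coord c ` (fst c \<inter> fst d) = (\<Union>e\<in>A. coord c ` (fst c \<inter> fst d \<inter> fst e))"
      using cover[OF c] by auto
    then show "open (coord c ` (fst c \<inter> fst d))"
      using op[OF c d] by auto
    show "holo_map_on (transition c d) (coord c ` (fst c \<inter> fst d))"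
    proof (rule holo_map_on_local)
      fix x assume "x \<in> coord c ` (fst c \<inter> fst d)"
      then obtain p where p: "p \<in> fst c" "p \<in> fst d" "x = coord c p" by auto
      obtain e where e: "e \<in> A" "p \<in> fst e" using cover[OF c p(1)] by auto
      let ?T = "coord c ` (fst c \<inter> fst d \<inter> fst e)"
      have "holo_map_on (\<lambda>x. transition e d (transition c e x)) ?T"
        by (rule holo_map_on_compose[OF M(4)[OF d e(1)] holo_map_on_subset[OF M(3)[OF c e(1)]]])
          (auto simp: transition_def pc[OF c])
      then have "holo_map_on (transition c d) ?T"
        by (rule holo_map_on_cong[OF op[OF c d e(1)], rotated])
          (use e in \<open>auto simp: transition_def pc[OF c]\<close>)
      then show "\<exists>T. open T \<and> x \<in> T \<and> holo_map_on (transition c d) T"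
        using op[OF c d e(1)] p e by blast
    qed
  qed (rule inj)
qed

text \<open>Flatness asks for coordinates belonging to the atlas, and the sheared coordinates are in
  general not among the generating charts; they enter through maximality. The biholomorphism may be
  defined on more than the image of the chart.\<close>

lemma maximal_atlas_biholomorphic:
  fixes A :: "('a, 'n::finite) chart set"
  assumes A: "complex_manifold A" and c: "c \<in> maximal_atlas A" and S: "coord c ` fst c \<subseteq> S"
    and h: "holo_map_on \<phi> S" and h': "holo_map_on \<psi> S'"
    and inv: "\<And>x. x \<in> S \<Longrightarrow> \<psi> (\<phi> x) = x" and im: "\<And>x. x \<in> S \<Longrightarrow> \<phi> x \<in> S'"
    and inv': "\<And>x. x \<in> S' \<Longrightarrow> \<phi> (\<psi> x) = x" and im': "\<And>x. x \<in> S' \<Longrightarrow> \<psi> x \<in> S" and "open S'"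
  shows "(fst c, \<phi> \<circ> snd c) \<in> maximal_atlas A"
proof -
  let ?c = "(fst c, \<phi> \<circ> snd c)"
  have inj: "inj_on (coord c) (fst c)" using c by (simp add: maximal_atlas_def)
  have co: "coord ?c p = \<phi> (coord c p)" for p by (simp add: coord_def)
  have inj': "inj_on (coord ?c) (fst ?c)"
  proof (rule inj_onI)
    fix p q assume pq: "p \<in> fst ?c" "q \<in> fst ?c" "coord ?c p = coord ?c q"
    then have "\<psi> (\<phi> (coord c p)) = \<psi> (\<phi> (coord c q))" by (simp add: co)
    then have "coord c p = coord c q" using pq S by (simp add: inv image_subset_iff)
    then show "p = q" using pq inj by (auto simp: inj_on_def)
  qed
  note pc = param_coord_inj[OF inj] and pc' = param_coord_inj[OF inj']
  \<comment> \<open>Images under \<phi> are preimages under \<psi>, so continuity of \<psi> makes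
    them open.\<close>
  have img: "\<phi> ` T = S' \<inter> \<psi> -` T" if "T \<subseteq> S" for T
    using that inv im inv' im' by (auto simp: image_iff) (metis subsetD)
  have op: "open (\<phi> ` T)" if "open T" "T \<subseteq> S" for T
    unfolding img[OF that(2)]
    by (rule continuous_open_preimage[OF holo_map_on_imp_continuous[OF h'] \<open>open S'\<close> that(1)])
  have M: "open (coord c ` (fst c \<inter> fst e))" "open (coord e ` (fst c \<inter> fst e))"
    "holo_map_on (transition c e) (coord c ` (fst c \<inter> fst e))"
    "holo_map_on (transition e c) (coord e ` (fst c \<inter> fst e))" if "e \<in> A" for e
    using that c by (auto simp: maximal_atlas_def)
  show ?thesis
    unfolding maximal_atlas_def
  proof (intro CollectI conjI ballI)
    show "fst ?c \<subseteq> carrier_of A" using c by (simp add: maximal_atlas_def)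
    show "inj_on (coord ?c) (fst ?c)" by (rule inj')
    fix e assume e: "e \<in> A"
    have eq: "coord ?c ` (fst ?c \<inter> fst e) = \<phi> ` (coord c ` (fst c \<inter> fst e))"
      by (simp add: co image_image)
    have sub: "coord c ` (fst c \<inter> fst e) \<subseteq> S" using S by auto
    show o: "open (coord ?c ` (fst ?c \<inter> fst e))"
      unfolding eq by (rule op[OF M(1)[OF e] sub])
    show "open (coord e ` (fst ?c \<inter> fst e))" using M(2)[OF e] by simp
    have "holo_map_on (\<lambda>x. transition c e (\<psi> x)) (coord ?c ` (fst ?c \<inter> fst e))"
      by (rule holo_map_on_compose[OF M(3)[OF e] holo_map_on_subset[OF h']])
        (use sub in \<open>auto simp: co inv im image_subset_iff\<close>)
    then show "holo_map_on (transition ?c e) (coord ?c ` (fst ?c \<inter> fst e))"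
    proof (rule holo_map_on_cong[OF o, rotated])
      fix x assume "x \<in> coord ?c ` (fst ?c \<inter> fst e)"
      then obtain p where p: "p \<in> fst c" "p \<in> fst e" "x = coord ?c p" by auto
      then have "transition ?c e x = coord e p" using pc'[of p] by (simp add: transition_def)
      moreover have "transition c e (\<psi> x) = coord e p"
        using p sub by (simp add: transition_def co inv image_subset_iff pc)
      ultimately show "transition c e (\<psi> x) = transition ?c e x" by simp
    qed
    have pe: "param e (coord e p) = p" if "p \<in> fst e" for p
      using complex_manifold.param_coord[OF A e that] .
    have "holo_map_on (\<lambda>x. \<phi> (transition e c x)) (coord e ` (fst c \<inter> fst e))"
      by (rule holo_map_on_compose[OF h M(4)[OF e]])
        (use sub in \<open>auto simp: transition_def pe image_subset_iff\<close>)
    then show "holo_map_on (transition e ?c) (coord e ` (fst ?c \<inter> fst e))"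
      unfolding fst_conv
      by (rule holo_map_on_cong[OF M(2)[OF e], rotated]) (auto simp: transition_def pe co)
  qed
qed

subsection \<open>Trace-free parts of symmetric bilinear maps\<close>

definition clin :: "(complex^'n \<Rightarrow> complex^'m) \<Rightarrow> bool" where
  "clin E \<longleftrightarrow> (\<forall>v w. E (v + w) = E v + E w) \<and> (\<forall>k v. E (k *s v) = k *s E v)"

definition tr :: "(complex^'n \<Rightarrow> complex^'n) \<Rightarrow> complex" where
  "tr E = (\<Sum>i\<in>UNIV. E (axis i 1) $ i)"

definition symbil :: "(complex^'n \<Rightarrow> complex^'n \<Rightarrow> complex^'n) \<Rightarrow> bool" where
  "symbil S \<longleftrightarrow> (\<forall>v. clin (S v)) \<and> (\<forall>v w. S v w = S w v)"

text \<open>The denominator n + 1 comes from S v w = \<theta>(v) w + \<theta>(w) v: as an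
  endomorphism in w, the first term has trace n \<theta>(v) and the second has trace
  \<theta>(v).\<close>

definition tracefree_part :: "(complex^'n \<Rightarrow> complex^'n \<Rightarrow> complex^'n) \<Rightarrow> complex^'n \<Rightarrow> complex^'n \<Rightarrow> complex^'n" where
  "tracefree_part S v w = S v w - (tr (S v) / of_nat (Suc CARD('n))) *s w - (tr (S w) / of_nat (Suc CARD('n))) *s v"

lemma clin_sum:
  assumes "clin E" shows "E (\<Sum>i\<in>I. f i) = (\<Sum>i\<in>I. E (f i))"
proof -
  have "E 0 = 0" using assms by (metis add_cancel_right_right clin_def)
  then show ?thesis using assms
    by (induction I rule: infinite_finite_induct) (auto simp: clin_def)
qed

lemma clin_expansion: "clin E \<Longrightarrow> E v = (\<Sum>i\<in>UNIV. v $ i *s E (axis i 1))"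
  using clin_sum[of E "\<lambda>i. v $ i *s axis i 1" UNIV] by (simp add: vec_expansion clin_def)

lemma clin_comp: "clin E \<Longrightarrow> clin F \<Longrightarrow> clin (\<lambda>v. E (F v))"
  by (simp add: clin_def)

lemma clin_diff: "clin E \<Longrightarrow> E (v - w) = E v - E w"
  unfolding clin_def by (metis add_diff_cancel diff_add_cancel)

text \<open>F is J E J' with J' inverse to J. Expanding both in the standard basis and exchanging
  the two summations lets J meet J'.\<close>

lemma tr_conj:
  fixes E F :: "complex^'n \<Rightarrow> complex^'n"
  assumes J: "clin J" "clin J'" and inv: "\<And>v. J' (J v) = v" "\<And>v. J (J' v) = v"
    and E: "clin E" and eq: "\<And>v. F (J v) = J (E v)"
  shows "tr F = tr E"
proof -
  have F: "F v = J (E (J' v))" for v using eq[of "J' v"] inv by simp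
  have EJ: "clin (\<lambda>v. E (J' v))" by (rule clin_comp[OF E J(2)])
  have "tr F = (\<Sum>i\<in>UNIV. \<Sum>k\<in>UNIV. E (J' (axis i 1)) $ k * J (axis k 1) $ i)"
    unfolding tr_def F clin_expansion[OF J(1), of "E _"] by (simp add: sum_component)
  also have "\<dots> = (\<Sum>k\<in>UNIV. (\<Sum>i\<in>UNIV. J (axis k 1) $ i *s E (J' (axis i 1))) $ k)"
    by (subst sum.swap) (simp add: sum_component mult.commute)
  also have "\<dots> = tr E"
    unfolding tr_def clin_expansion[OF EJ, symmetric] by (simp add: inv)
  finally show ?thesis .
qed

lemma tr_add: "tr (\<lambda>w. E w + F w) = tr E + tr F"
  by (simp add: tr_def sum.distrib)

lemma tr_diff: "tr (\<lambda>w. E w - F w) = tr E - tr F"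
  by (simp add: tr_def sum_subtractf)

lemma tr_scale: "tr (\<lambda>w. k *s E w) = k * tr E"
  by (simp add: tr_def sum_distrib_left)

lemma tr_id: "tr (\<lambda>w :: complex^'n. w) = of_nat CARD('n)"
  by (simp add: tr_def axis_def)

lemma tr_rank_one:
  assumes "\<And>v w. \<theta> (v + w) = \<theta> v + \<theta> w" "\<And>k v. \<theta> (k *s v) = k * \<theta> v"
  shows "tr (\<lambda>w. \<theta> w *s v) = \<theta> (v :: complex^'n)"
proof -
  \<comment> \<open>The scalar form is viewed as a map into a one-dimensional space, so that
    \<open>clin_expansion\<close> applies.\<close>
  have l: "clin (\<lambda>v. \<theta> v *s (1 :: complex^1))"
    by (simp add: clin_def assms vec_eq_iff algebra_simps)
  have "\<theta> v *s (1 :: complex^1) = (\<Sum>i\<in>UNIV. v $ i *s (\<theta> (axis i 1) *s 1))"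
    using clin_expansion[OF l, of v] .
  then have "(\<theta> v *s (1 :: complex^1)) $ 1 = (\<Sum>i\<in>UNIV. v $ i *s (\<theta> (axis i 1) *s (1 :: complex^1))) $ 1"
    by (rule arg_cong)
  then show ?thesis by (simp add: tr_def sum_component mult.commute)
qed

lemma symbilD:
  assumes "symbil S"
  shows "clin (S v)" "S v w = S w v" "S (u + v) w = S u w + S v w" "S (k *s v) w = k *s S v w"
    "S w (u + v) = S w u + S w v" "S w (k *s v) = k *s S w v"
proof -
  show s: "S v w = S w v" for v w using assms by (simp add: symbil_def)
  show l: "clin (S v)" for v using assms by (simp add: symbil_def)
  show "S w (u + v) = S w u + S w v" "S w (k *s v) = k *s S w v"
    using l by (simp_all add: clin_def)
  show "S (u + v) w = S u w + S v w" "S (k *s v) w = k *s S v w"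
    using l[of w] unfolding s[of _ w] by (simp_all add: clin_def)
qed

lemma symbil_tr_linear:
  assumes "symbil S"
  shows "tr (S (u + v)) = tr (S u) + tr (S v)" "tr (S (k *s v)) = k * tr (S v)"
  unfolding tr_def by (simp_all add: symbilD(3,4)[OF assms] sum.distrib sum_distrib_left)

lemma symbilI:
  assumes "\<And>v w. S v w = S w v" "\<And>u v w. S w (u + v) = S w u + S w v" "\<And>k v w. S w (k *s v) = k *s S w v"
  shows "symbil S"
  using assms by (simp add: symbil_def clin_def)

lemma symbil_diff: "symbil S \<Longrightarrow> symbil T \<Longrightarrow> symbil (\<lambda>v w. S v w - T v w)"
  by (rule symbilI) (simp_all add: symbilD(5,6) vec_eq_iff algebra_simps, metis symbilD(2))

lemma tracefree_part_diff: "tracefree_part (\<lambda>v w. S v w - T v w) v w = tracefree_part S v w - tracefree_part T v w"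
  by (simp add: tracefree_part_def tr_diff vec_eq_iff diff_divide_distrib algebra_simps)

lemma tracefree_part_add: "tracefree_part (\<lambda>v w. S v w + T v w) v w = tracefree_part S v w + tracefree_part T v w"
  by (simp add: tracefree_part_def tr_add vec_eq_iff add_divide_distrib algebra_simps)

lemma tracefree_part_symbil:
  assumes "symbil S" shows "symbil (tracefree_part S)"
  unfolding symbil_def clin_def tracefree_part_def
  by (auto simp: symbilD(5,6)[OF assms] symbil_tr_linear[OF assms] symbilD(2)[OF assms, of _ "_ :: complex^'a"] vec_eq_iff
      add_divide_distrib algebra_simps)

text \<open>The two corrections have traces n / (n + 1) and 1 / (n + 1) times tr (S v).\<close>

lemma tr_tfree:
  assumes "symbil S" shows "tr (tracefree_part S v) = 0"
proof -
  let ?N = "of_nat (Suc CARD('a)) :: complex"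
  have "tr (\<lambda>w. (tr (S w) / ?N) *s v) = tr (S v) / ?N"
    by (rule tr_rank_one) (simp_all add: symbil_tr_linear[OF assms] add_divide_distrib)
  then have "tr (tracefree_part S v) = tr (S v) - tr (S v) / ?N * of_nat CARD('a) - tr (S v) / ?N"
    unfolding tracefree_part_def tr_diff tr_scale tr_id by simp
  also have "\<dots> = tr (S v) - tr (S v) / ?N * ?N" by (simp add: algebra_simps add_divide_distrib)
  also have "\<dots> = 0" by (simp del: of_nat_Suc)
  finally show ?thesis .
qed

lemma tracefree_part_id: "(\<And>v. tr (S v) = 0) \<Longrightarrow> tracefree_part S v w = S v w"
  by (simp add: tracefree_part_def)

lemma tracefree_part_projective:
  assumes "\<And>v w. \<theta> (v + w) = \<theta> v + \<theta> w" "\<And>k v. \<theta> (k *s v) = k * \<theta> v"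
    and "\<And>v w. S v w = \<theta> v *s w + \<theta> w *s (v :: complex^'n)"
  shows "tracefree_part S v w = 0"
proof -
  let ?N = "of_nat (Suc CARD('n)) :: complex"
  have "tr (S v) = ?N * \<theta> v" for v
    unfolding assms(3) tr_add tr_scale tr_id tr_rank_one[of \<theta>, OF assms(1,2)] by (simp add: algebra_simps)
  then show ?thesis by (simp add: tracefree_part_def assms(3) vec_eq_iff del: of_nat_Suc)
qed

text \<open>Converse of \<open>tracefree_part_projective\<close>: the form \<theta> is recovered as
  the trace divided by n + 1.\<close>

lemma tracefree_part_zeroD: "tracefree_part S v w = 0 \<Longrightarrow>
  S v w = (tr (S v) / of_nat (Suc CARD('n))) *s w + (tr (S w) / of_nat (Suc CARD('n))) *s (v :: complex^'n)"
  by (simp add: tracefree_part_def vec_eq_iff del: of_nat_Suc) (metis add.commute diff_add_cancel eq_iff_diff_eq_0)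

lemma tr_natural:
  fixes J J' :: "complex^'n \<Rightarrow> complex^'n"
  assumes J: "clin J" "clin J'" "\<And>v. J' (J v) = v" "\<And>v. J (J' v) = v"
    and S: "clin (S v)" "\<And>w. S' (J v) (J w) = J (S v w)"
  shows "tr (S' (J v)) = tr (S v)"
  by (rule tr_conj[where J = J and J' = J']) (rule assms)+

lemma tracefree_part_natural:
  fixes J J' :: "complex^'n \<Rightarrow> complex^'n"
  assumes J: "clin J" "clin J'" "\<And>v. J' (J v) = v" "\<And>v. J (J' v) = v"
    and S: "\<And>v. clin (S v)" "\<And>v w. S' (J v) (J w) = J (S v w)"
  shows "tracefree_part S' (J v) (J w) = J (tracefree_part S v w)"
proof -
  have t: "tr (S' (J v)) = tr (S v)" for v
    by (rule tr_natural[where J = J and J' = J']) (rule assms)+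
  show ?thesis
    unfolding tracefree_part_def t S(2) clin_diff[OF J(1)] using J(1) by (simp add: clin_def)
qed

subsection \<open>Christoffel and Thomas symbols\<close>

lemma sum_fun_apply: "(\<Sum>i\<in>I. f i) x = (\<Sum>i\<in>I. f i x)"
  by (induction I rule: infinite_finite_induct) auto

context complex_manifold
begin

definition connection_on :: "'a set \<Rightarrow> ('a, 'n) conn \<Rightarrow> bool" where
  "connection_on U D \<longleftrightarrow> open_in_mfd A U \<and> affine_connection A U D \<and> torsionfree A U D"

lemma affine_connectionD:
  assumes "affine_connection A U D" "open_in_mfd A V" "V \<subseteq> U" "X \<in> vector_fields A V" "Y \<in> vector_fields A V"
  shows "D V X Y \<in> vector_fields A V"
    "Z \<in> vector_fields A V \<Longrightarrow> D V (X + Z) Y = D V X Y + D V Z Y"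
    "Z \<in> vector_fields A V \<Longrightarrow> D V X (Y + Z) = D V X Y + D V X Z"
    "f \<in> holo_functions A V \<Longrightarrow> D V (fscale f X) Y = fscale f (D V X Y)"
    "f \<in> holo_functions A V \<Longrightarrow> D V X (fscale f Y) = fscale (field_apply A X f) Y + fscale f (D V X Y)"
    "open_in_mfd A W \<Longrightarrow> W \<subseteq> V \<Longrightarrow> D W (restrict_field W X) (restrict_field W Y) = restrict_field W (D V X Y)"
  using assms(1)[unfolded affine_connection_def, rule_format, OF conjI[OF assms(2,3)] assms(4,5)]
  by simp_all

lemma zero_vector_field: "0 \<in> vector_fields A V"
  by (rule vector_fieldsI) simp_all

lemma sum_vector_fields: "(\<And>i. i \<in> I \<Longrightarrow> F i \<in> vector_fields A V) \<Longrightarrow> (\<Sum>i\<in>I. F i) \<in> vector_fields A V"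
  by (induction I rule: infinite_finite_induct) (simp_all add: zero_vector_field vector_fields_add)

lemma affine_connection_sum:
  assumes D: "affine_connection A U D" "open_in_mfd A V" "V \<subseteq> U" and Y: "Y \<in> vector_fields A V"
    and F: "\<And>i. i \<in> I \<Longrightarrow> F i \<in> vector_fields A V"
  shows "D V (\<Sum>i\<in>I. F i) Y = (\<Sum>i\<in>I. D V (F i) Y)" "D V Y (\<Sum>i\<in>I. F i) = (\<Sum>i\<in>I. D V Y (F i))"
proof -
  have "D V 0 Y = D V 0 Y + D V 0 Y"
    using affine_connectionD(2)[OF D zero_vector_field Y zero_vector_field] by simp
  then have z: "D V 0 Y = 0" by simp
  have "D V Y 0 = D V Y 0 + D V Y 0"
    using affine_connectionD(3)[OF D Y zero_vector_field zero_vector_field] by simp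
  then have z': "D V Y 0 = 0" by simp
  show "D V (\<Sum>i\<in>I. F i) Y = (\<Sum>i\<in>I. D V (F i) Y)"
    using F by (induction I rule: infinite_finite_induct)
      (simp_all add: z affine_connectionD(2)[OF D _ Y] sum_vector_fields)
  show "D V Y (\<Sum>i\<in>I. F i) = (\<Sum>i\<in>I. D V Y (F i))"
    using F by (induction I rule: infinite_finite_induct)
      (simp_all add: z' affine_connectionD(3)[OF D Y] sum_vector_fields)
qed

abbreviation frame :: "('a, 'n) chart \<Rightarrow> 'a set \<Rightarrow> 'n \<Rightarrow> ('a, 'n) vfield" where
  "frame c V i \<equiv> const_field c V (axis i 1)"

text \<open>Extended bilinearly from the values on pairs of coordinate fields, hence bilinear in v
  and w by construction.\<close>

definition christoffel ::
    "'a set \<Rightarrow> ('a, 'n) conn \<Rightarrow> ('a, 'n) chart \<Rightarrow> 'a \<Rightarrow> complex^'n \<Rightarrow> complex^'n \<Rightarrow> complex^'n" where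
  "christoffel U D c p v w = (\<Sum>i\<in>UNIV. \<Sum>j\<in>UNIV.
     (v $ i * w $ j) *s D (U \<inter> fst c) (frame c (U \<inter> fst c) i) (frame c (U \<inter> fst c) j) p c)"

lemma vector_field_frame_expansion:
  assumes "X \<in> vector_fields A V" "open_in_mfd A V" "V \<subseteq> fst c" "c \<in> A"
  shows "X = (\<Sum>i\<in>UNIV. fscale (\<lambda>p. X p c $ i) (frame c V i))"
proof
  fix p
  let ?R = "\<Sum>i\<in>UNIV. fscale (\<lambda>p. X p c $ i) (frame c V i)"
  have R: "?R \<in> vector_fields A V"
    by (rule sum_vector_fields)
      (intro vector_fields_fscale holo_functions_component assms const_field_vector_field)
  show "X p = ?R p"
  proof (cases "p \<in> V")
    case True
    then have p: "p \<in> fst c" using assms by auto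
    show ?thesis
    proof (rule tangent_eqI[OF vector_fieldsD(1)[OF assms(1) True] vector_fieldsD(1)[OF R True] assms(4) p])
      show "X p c = ?R p c"
        using True p assms(4) by (simp add: sum_fun_apply fscale_def vec_expansion)
    qed
  next
    case False
    then show ?thesis
      by (simp only: vector_fieldsD(2)[OF assms(1) False] vector_fieldsD(2)[OF R False])
  qed
qed

lemma restrict_const_field: "W \<subseteq> V \<Longrightarrow> restrict_field W (const_field c V v) = const_field c W v"
  by (auto simp: restrict_field_def const_field_def fun_eq_iff)

text \<open>Both fields are expanded in the coordinate frame. Linearity in the first argument and
  the Leibniz rule in the second leave the derivative of the components of Y and the values of D on
  the frame.\<close>

lemma connection_frame_formula:
  assumes D: "affine_connection A U D" "open_in_mfd A V" "V \<subseteq> U"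
    and X: "X \<in> vector_fields A V" and Y: "Y \<in> vector_fields A V" and c: "V \<subseteq> fst c" "c \<in> A" and p: "p \<in> V"
  shows "D V X Y p c = fd (\<lambda>x. Y (param c x) c) (coord c p) (X p c) +
    (\<Sum>i\<in>UNIV. \<Sum>j\<in>UNIV. (X p c $ i * Y p c $ j) *s D V (frame c V i) (frame c V j) p c)"
proof -
  let ?E = "frame c V" and ?X = "\<lambda>i q. X q c $ i" and ?Y = "\<lambda>j q. Y q c $ j"
  have E: "?E i \<in> vector_fields A V" for i by (rule const_field_vector_field[OF D(2) c])
  have pc: "p \<in> fst c" using c p by auto
  have fX: "?X i \<in> holo_functions A V" for i by (rule holo_functions_component[OF X D(2) c])
  have fY: "?Y i \<in> holo_functions A V" for i by (rule holo_functions_component[OF Y D(2) c])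
  have Yc: "holo_map_on (\<lambda>x. Y (param c x) c) (coord c ` (fst c \<inter> V))"
    by (rule vector_fieldsD(3)[OF Y c(2)])
  have pS: "coord c p \<in> coord c ` (fst c \<inter> V)" using p pc by auto
  have fa: "field_apply A (?E i) (?Y j) p = fd (\<lambda>x. Y (param c x) c) (coord c p) (axis i 1) $ j" for i j
    using field_apply_chart[OF D(2) fY[of j] E[of i] p c(2) pc] p pc c
    by (simp add: holo_map_onD(2)[OF Yc pS])
  have "D V (?E i) Y p c = fd (\<lambda>x. Y (param c x) c) (coord c p) (axis i 1) +
      (\<Sum>j\<in>UNIV. Y p c $ j *s D V (?E i) (?E j) p c)" for i
  proof -
    have "D V (?E i) Y = D V (?E i) (\<Sum>j\<in>UNIV. fscale (?Y j) (?E j))"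
      by (rule arg_cong[OF vector_field_frame_expansion[OF Y D(2) c]])
    also have "\<dots> = (\<Sum>j\<in>UNIV. D V (?E i) (fscale (?Y j) (?E j)))"
      by (rule affine_connection_sum(2)[OF D E]) (rule vector_fields_fscale[OF fY E])
    also have "\<dots> = (\<Sum>j\<in>UNIV. fscale (field_apply A (?E i) (?Y j)) (?E j) + fscale (?Y j) (D V (?E i) (?E j)))"
      by (intro sum.cong refl affine_connectionD(5)[OF D E E fY])
    finally have "D V (?E i) Y p c =
        (\<Sum>j\<in>UNIV. field_apply A (?E i) (?Y j) p *s ?E j p c + Y p c $ j *s D V (?E i) (?E j) p c)"
      by (simp add: sum_fun_apply fscale_def)
    then show ?thesis
      using p pc c by (simp add: fa sum.distrib vec_expansion)
  qed
  note inner = this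
  have "D V X Y = D V (\<Sum>i\<in>UNIV. fscale (?X i) (?E i)) Y"
    by (rule arg_cong[where f = "\<lambda>X. D V X Y", OF vector_field_frame_expansion[OF X D(2) c]])
  also have "\<dots> = (\<Sum>i\<in>UNIV. D V (fscale (?X i) (?E i)) Y)"
    by (rule affine_connection_sum(1)[OF D Y]) (rule vector_fields_fscale[OF fX E])
  also have "\<dots> = (\<Sum>i\<in>UNIV. fscale (?X i) (D V (?E i) Y))"
    by (intro sum.cong refl affine_connectionD(4)[OF D E Y fX])
  finally have "D V X Y p c = (\<Sum>i\<in>UNIV. X p c $ i *s D V (?E i) Y p c)"
    by (simp add: sum_fun_apply fscale_def)
  also have "\<dots> = (\<Sum>i\<in>UNIV. X p c $ i *s fd (\<lambda>x. Y (param c x) c) (coord c p) (axis i 1)) +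
      (\<Sum>i\<in>UNIV. \<Sum>j\<in>UNIV. (X p c $ i * Y p c $ j) *s D V (?E i) (?E j) p c)"
    unfolding inner
    by (simp add: vec_eq_iff sum_component sum.distrib sum_distrib_left distrib_left mult.assoc)
  also have "(\<Sum>i\<in>UNIV. X p c $ i *s fd (\<lambda>x. Y (param c x) c) (coord c p) (axis i 1)) =
      fd (\<lambda>x. Y (param c x) c) (coord c p) (X p c)"
    by (rule holo_map_on_fd_expansion[OF Yc pS, symmetric])
  finally show ?thesis .
qed

text \<open>The symbols are taken on all of \<open>U \<inter> fst c\<close>; the restriction axiom makes them compute \<open>D\<close> on
  every smaller open set.\<close>

lemma christoffel_formula:
  assumes D: "affine_connection A U D" "open_in_mfd A U" and V: "open_in_mfd A V" "V \<subseteq> U"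
    and X: "X \<in> vector_fields A V" and Y: "Y \<in> vector_fields A V"
    and c: "c \<in> A" and p: "p \<in> V" "p \<in> fst c"
  shows "D V X Y p c = fd (\<lambda>x. Y (param c x) c) (coord c p) (X p c) + christoffel U D c p (X p c) (Y p c)"
proof -
  let ?W = "V \<inter> fst c" and ?U = "U \<inter> fst c"
  let ?X = "restrict_field ?W X" and ?Y = "restrict_field ?W Y"
  have W: "open_in_mfd A ?W" by (rule open_mfd_Int[OF V(1) open_mfd_chart[OF c]])
  have U: "open_in_mfd A ?U" by (rule open_mfd_Int[OF D(2) open_mfd_chart[OF c]])
  have "D V X Y p c = D ?W ?X ?Y p c"
    using affine_connectionD(6)[OF D(1) V X Y W] p by (simp add: restrict_field_def)
  also have "\<dots> = fd (\<lambda>x. ?Y (param c x) c) (coord c p) (?X p c) +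
      (\<Sum>i\<in>UNIV. \<Sum>j\<in>UNIV. (?X p c $ i * ?Y p c $ j) *s D ?W (frame c ?W i) (frame c ?W j) p c)"
    by (rule connection_frame_formula[OF D(1) W])
      (use V p c in \<open>auto intro: vector_fields_restrict[OF X _ W] vector_fields_restrict[OF Y _ W]\<close>)
  also have "\<dots> = fd (\<lambda>x. Y (param c x) c) (coord c p) (X p c) + christoffel U D c p (X p c) (Y p c)"
  proof -
    have "D ?W (frame c ?W i) (frame c ?W j) p c = D ?U (frame c ?U i) (frame c ?U j) p c" for i j
    proof -
      have "?W \<subseteq> ?U" using V by auto
      then have "D ?W (frame c ?W i) (frame c ?W j) = restrict_field ?W (D ?U (frame c ?U i) (frame c ?U j))"
        using affine_connectionD(6)[OF D(1) U _ const_field_vector_field[OF U _ c] const_field_vector_field[OF U _ c] W,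
            of "axis i 1" "axis j 1"]
        by (simp add: restrict_const_field)
      then show ?thesis using p by (simp add: restrict_field_def)
    qed
    moreover have "fd (\<lambda>x. ?Y (param c x) c) (coord c p) = fd (\<lambda>x. Y (param c x) c) (coord c p)"
      by (rule fd_cong[OF open_coord[OF W c]]) (use p c in \<open>auto simp: restrict_field_def\<close>)
    moreover have "?X p = X p" "?Y p = Y p" using p by (simp_all add: restrict_field_def)
    ultimately show ?thesis by (simp only: christoffel_def)
  qed
  finally show ?thesis .
qed

lemma connection_const_fields:
  assumes D: "affine_connection A U D" "open_in_mfd A U" and V: "open_in_mfd A V" "V \<subseteq> U" "V \<subseteq> fst c"
    and c: "c \<in> A" and p: "p \<in> V"
  shows "D V (const_field c V v) (const_field c V w) p c = christoffel U D c p v w"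
  using christoffel_formula[OF D V(1,2) const_field_vector_field[OF V(1,3) c] const_field_vector_field[OF V(1,3) c] c p,
      of v w] fd_const_field[OF V(1,3) c p] V p c by auto

lemma christoffel_clin: "clin (christoffel U D c p v)"
  unfolding clin_def christoffel_def
  by (simp add: vec_eq_iff sum_component sum.distrib sum_distrib_left algebra_simps)

text \<open>Fields with constant components commute, so vanishing torsion makes D symmetric on
  them.\<close>

lemma christoffel_symbil:
  assumes D: "connection_on U D" and c: "c \<in> A" "p \<in> U" "p \<in> fst c"
  shows "symbil (christoffel U D c p)"
  unfolding symbil_def
proof (intro conjI allI christoffel_clin)
  fix v w
  let ?V = "U \<inter> fst c" and ?X = "const_field c (U \<inter> fst c) v" and ?Y = "const_field c (U \<inter> fst c) w"
  have D': "open_in_mfd A U" "affine_connection A U D" "torsionfree A U D"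
    using D by (auto simp: connection_on_def)
  have V: "open_in_mfd A ?V" by (rule open_mfd_Int[OF D'(1) open_mfd_chart[OF c(1)]])
  have X: "?X \<in> vector_fields A ?V" "?Y \<in> vector_fields A ?V"
    by (rule const_field_vector_field[OF V]; use c in simp)+
  have p: "p \<in> ?V" using c by simp
  have "D ?V ?X ?Y - D ?V ?Y ?X = lie_bracket A ?V ?X ?Y"
    using D'(3) V X by (simp add: torsionfree_def)
  from fun_cong[OF fun_cong[OF this], of p c]
  have "D ?V ?X ?Y p c - D ?V ?Y ?X p c = lie_bracket A ?V ?X ?Y p c"
    by (simp only: fun_diff_def)
  also have "\<dots> = 0"
    using fd_const_field[OF V _ c(1) p] c by (simp add: lie_bracket_def)
  finally show "christoffel U D c p v w = christoffel U D c p w v"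
    using connection_const_fields[OF D'(2,1) V _ _ c(1) p] by simp
qed

lemma christoffel_holo:
  assumes D: "affine_connection A U D" "open_in_mfd A U" and c: "c \<in> A"
    and S: "S \<subseteq> coord c ` (fst c \<inter> U)" and f: "holo_map_on f S" and g: "holo_map_on g S"
  shows "holo_map_on (\<lambda>x. christoffel U D c (param c x) (f x) (g x)) S"
proof -
  have U: "open_in_mfd A (U \<inter> fst c)" by (rule open_mfd_Int[OF D(2) open_mfd_chart[OF c]])
  have "holo_map_on (\<lambda>x. D (U \<inter> fst c) (frame c (U \<inter> fst c) i) (frame c (U \<inter> fst c) j) (param c x) c) S" for i j
    by (rule holo_map_on_subset[OF vector_fieldsD(3)[OF affine_connectionD(1)[OF D(1) U] c]])
      (use S c const_field_vector_field[OF U _ c] in auto)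
  then show ?thesis
    unfolding christoffel_def using f g
    by (intro holo_map_on_sum holo_map_on_scale holo_fun_on_mult) (auto simp: holo_map_on_def)
qed

lemma jac_clin:
  assumes "c \<in> A" "p \<in> fst c" "d \<in> A" "p \<in> fst d"
  shows "clin (jac c d p)"
  using jac_works(2,3)[OF assms(1,3,2,4)] by (simp add: clin_def)

lemma vec_of_linear:
  assumes "c \<in> A" "p \<in> fst c"
  shows "vec_of c p (v + w) = vec_of c p v + vec_of c p w" "vec_of c p (k *s v) = tscale k (vec_of c p v)"
  using assms by (auto simp: vec_of_def jac_works fun_eq_iff tscale_def)

lemma vec_of_jac:
  assumes "c \<in> A" "p \<in> fst c" "d \<in> A" "p \<in> fst d"
  shows "vec_of d p (jac c d p v) = vec_of c p v"
  using tangent_eq_vec_of[OF vec_of_tangent[OF assms(1,2)] assms(3,4), of v] assms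
  by (simp add: vec_of_apply)

text \<open>In a difference of two connections the derivative terms cancel. What remains is the
  tangent vector D X Y - D' X Y at p, read in two charts.\<close>

lemma christoffel_diff_natural:
  assumes D: "connection_on U D" and D': "connection_on U' D'" and p: "p \<in> U" "p \<in> U'"
    and c: "c \<in> A" "p \<in> fst c" and d: "d \<in> A" "p \<in> fst d"
  shows "christoffel U D d p (jac c d p v) (jac c d p w) - christoffel U' D' d p (jac c d p v) (jac c d p w) =
    jac c d p (christoffel U D c p v w - christoffel U' D' c p v w)"
proof -
  let ?V = "U \<inter> U' \<inter> fst c"
  let ?X = "const_field c ?V v" and ?Y = "const_field c ?V w"
  have o: "open_in_mfd A U" "affine_connection A U D" "open_in_mfd A U'" "affine_connection A U' D'"
    using D D' by (auto simp: connection_on_def)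
  have V: "open_in_mfd A ?V" by (intro open_mfd_Int o open_mfd_chart c)
  have X: "?X \<in> vector_fields A ?V" "?Y \<in> vector_fields A ?V"
    by (rule const_field_vector_field[OF V]; use c in auto)+
  have pV: "p \<in> ?V" using p c by auto
  have VU: "?V \<subseteq> U" "?V \<subseteq> U'" by auto
  have t: "D ?V ?X ?Y p - D' ?V ?X ?Y p \<in> tangent_space A p"
    by (intro tangent_diff vector_fieldsD(1)[OF _ pV] affine_connectionD(1)[OF o(2) V VU(1)]
        affine_connectionD(1)[OF o(4) V VU(2)] X)
  have "(D ?V ?X ?Y p - D' ?V ?X ?Y p) e = christoffel U D e p (jac c e p v) (jac c e p w) -
      christoffel U' D' e p (jac c e p v) (jac c e p w)" if "e \<in> A" "p \<in> fst e" for e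
    using christoffel_formula[OF o(2,1) V VU(1) X that(1) pV that(2)]
      christoffel_formula[OF o(4,3) V VU(2) X that(1) pV that(2)] pV that
    by (simp add: vec_of_apply)
  then show ?thesis
    using tangent_jac[OF t c d] c d by simp
qed

text \<open>Changing \<open>D\<close> by \<open>\<theta>(X) Y + \<theta>(Y) X\<close> changes only the trace part of its Christoffel symbols, so
  the trace-free part characterizes the projective class.\<close>

definition thomas ::
    "'a set \<Rightarrow> ('a, 'n) conn \<Rightarrow> ('a, 'n) chart \<Rightarrow> 'a \<Rightarrow> complex^'n \<Rightarrow> complex^'n \<Rightarrow> complex^'n" where
  "thomas U D c p = tracefree_part (christoffel U D c p)"

lemma thomas_diff_natural:
  assumes "connection_on U D" "connection_on U' D'" "p \<in> U" "p \<in> U'"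
    and c: "c \<in> A" "p \<in> fst c" and d: "d \<in> A" "p \<in> fst d"
  shows "thomas U D d p (jac c d p v) (jac c d p w) - thomas U' D' d p (jac c d p v) (jac c d p w) =
    jac c d p (thomas U D c p v w - thomas U' D' c p v w)"
  unfolding thomas_def tracefree_part_diff[symmetric]
proof (rule tracefree_part_natural[where J = "jac c d p" and J' = "jac d c p"])
  show "clin (\<lambda>w. christoffel U D c p v w - christoffel U' D' c p v w)" for v
    by (rule symbilD(1)[OF symbil_diff[OF christoffel_symbil[OF assms(1) c(1) assms(3) c(2)]
            christoffel_symbil[OF assms(2) c(1) assms(4) c(2)]]])
qed (use c d jac_clin christoffel_diff_natural[OF assms(1-8)] in simp_all)

text \<open>The symbols depend on the chart in an inhomogeneous way, but their difference is a
  tensor, so agreement at a point may be tested in any single chart.\<close>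

lemma thomas_eq_chart:
  assumes "connection_on U D" "connection_on U' D'" "p \<in> U" "p \<in> U'"
    and c: "c \<in> A" "p \<in> fst c" and d: "d \<in> A" "p \<in> fst d"
    and eq: "thomas U D c p = thomas U' D' c p"
  shows "thomas U D d p = thomas U' D' d p"
proof (intro ext)
  fix v w
  have "thomas U D d p (jac c d p (jac d c p v)) (jac c d p (jac d c p w)) -
      thomas U' D' d p (jac c d p (jac d c p v)) (jac c d p (jac d c p w)) = 0"
    unfolding thomas_diff_natural[OF assms(1-8)] eq using c d by (simp add: jac_works(4))
  then show "thomas U D d p v w = thomas U' D' d p v w"
    using c d by simp
qed

lemma fscale_apply [simp]: "fscale f X p = tscale (f p) (X p)"
  by (simp add: fscale_def)

lemma proj_equiv_on_imp_thomas_eq: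
  assumes D: "connection_on U D" and D': "connection_on U' D'" and p: "p \<in> U" "p \<in> U'"
    and c: "c \<in> A" "p \<in> fst c" and eq: "proj_equiv_on A (U \<inter> U') D D'"
  shows "thomas U D c p = thomas U' D' c p"
proof (intro ext)
  fix v w
  obtain \<theta> where \<theta>: "holo_one_form A (U \<inter> U') \<theta>"
    and eq: "\<And>V X Y. open_in_mfd A V \<Longrightarrow> V \<subseteq> U \<inter> U' \<Longrightarrow> X \<in> vector_fields A V \<Longrightarrow> Y \<in> vector_fields A V \<Longrightarrow>
      D V X Y = D' V X Y + fscale (\<lambda>p. \<theta> p (X p)) Y + fscale (\<lambda>p. \<theta> p (Y p)) X"
    using eq by (auto simp: proj_equiv_on_def)
  have lin: "\<theta> p (s + t) = \<theta> p s + \<theta> p t" "\<theta> p (tscale k s) = k * \<theta> p s"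
    if "s \<in> tangent_space A p" "t \<in> tangent_space A p" for s t k
    using \<theta> that p unfolding holo_one_form_def by blast+
  let ?V = "U \<inter> U' \<inter> fst c"
  have o: "open_in_mfd A U" "affine_connection A U D" "open_in_mfd A U'" "affine_connection A U' D'"
    using D D' by (auto simp: connection_on_def)
  have V: "open_in_mfd A ?V" by (intro open_mfd_Int o open_mfd_chart c)
  have X: "const_field c ?V v \<in> vector_fields A ?V" for v
    by (rule const_field_vector_field[OF V]; use c in auto)
  have pV: "p \<in> ?V" using p c by auto
  have VU: "?V \<subseteq> U" "?V \<subseteq> U'" "?V \<subseteq> fst c" by auto
  let ?\<theta> = "\<lambda>v. \<theta> p (vec_of c p v)"
  have "christoffel U D c p v w - christoffel U' D' c p v w = ?\<theta> v *s w + ?\<theta> w *s v" for v w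
  proof -
    have "D ?V (const_field c ?V v) (const_field c ?V w) p c =
       D' ?V (const_field c ?V v) (const_field c ?V w) p c + ?\<theta> v *s w + ?\<theta> w *s v"
      unfolding eq[OF V Int_lower1 X X] using pV c by simp
    then show ?thesis
      using connection_const_fields[OF o(2,1) V VU(1,3) c(1) pV] connection_const_fields[OF o(4,3) V VU(2,3) c(1) pV]
      by (simp add: algebra_simps)
  qed
  then have "tracefree_part (\<lambda>v w. christoffel U D c p v w - christoffel U' D' c p v w) v w = 0"
    by (rule tracefree_part_projective[of ?\<theta>, rotated -1]) (use c in \<open>simp_all add: vec_of_linear lin[OF _ vec_of_tangent]\<close>)
  then show "thomas U D c p v w = thomas U' D' c p v w"
    by (simp add: thomas_def tracefree_part_diff)
qed

text \<open>The one-form is the trace of the difference of the Christoffel symbols divided by n + 1.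
  That difference is a tensor, so its trace does not depend on the chart; the choice
  \<open>chart_at\<close> is harmless, and holomorphy can be checked in any fixed chart.\<close>

lemma thomas_eq_imp_proj_equiv_on:
  assumes D: "connection_on U D" and D': "connection_on U' D'"
    and eq: "\<And>p c. p \<in> U \<inter> U' \<Longrightarrow> c \<in> A \<Longrightarrow> p \<in> fst c \<Longrightarrow> thomas U D c p = thomas U' D' c p"
  shows "proj_equiv_on A (U \<inter> U') D D'"
proof -
  let ?N = "of_nat (Suc CARD('n)) :: complex"
  define S where "S c p = (\<lambda>v w. christoffel U D c p v w - christoffel U' D' c p v w)" for c p
  define \<theta> where "\<theta> p t = tr (S (chart_at A p) p (t (chart_at A p))) / ?N" for p and t :: "('a, 'n) tvec"
  have o: "open_in_mfd A U" "affine_connection A U D" "open_in_mfd A U'" "affine_connection A U' D'"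
    using D D' by (auto simp: connection_on_def)
  have S: "symbil (S c p)" if "p \<in> U \<inter> U'" "c \<in> A" "p \<in> fst c" for c p
    unfolding S_def using that D D' by (auto intro: symbil_diff christoffel_symbil)
  have \<theta>: "\<theta> p t = tr (S c p (t c)) / ?N"
    if p: "p \<in> U \<inter> U'" and c: "c \<in> A" "p \<in> fst c" and t: "t \<in> tangent_space A p" for p c t
  proof -
    have d: "chart_at A p \<in> A" "p \<in> fst (chart_at A p)"
      using chart_at[OF subsetD[OF chart_subset[OF c(1)] c(2)]] by auto
    have "tr (S (chart_at A p) p (jac c (chart_at A p) p (t c))) = tr (S c p (t c))"
    proof (rule tr_natural[where J' = "jac (chart_at A p) c p"])
      show "S (chart_at A p) p (jac c (chart_at A p) p (t c)) (jac c (chart_at A p) p w) =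
          jac c (chart_at A p) p (S c p (t c) w)" for w
        unfolding S_def using christoffel_diff_natural[OF D D' _ _ c d] p by simp
    qed (use c d jac_clin symbilD(1)[OF S[OF p c]] in simp_all)
    then show ?thesis
      using tangent_jac[OF t c d] by (simp add: \<theta>_def)
  qed
  have "holo_one_form A (U \<inter> U') \<theta>"
    unfolding holo_one_form_def
  proof (intro conjI ballI allI impI)
    fix p s t k assume p: "p \<in> U \<inter> U'" and s: "s \<in> tangent_space A p" and t: "t \<in> tangent_space A p"
    then obtain c where c: "c \<in> A" "p \<in> fst c" using chart_around open_mfdD o(1) by blast
    show "\<theta> p (s + t) = \<theta> p s + \<theta> p t" "\<theta> p (tscale k s) = k * \<theta> p s"
      using \<theta>[OF p c] s t tangent_add tangent_scale
      by (simp_all add: symbil_tr_linear[OF S[OF p c]] add_divide_distrib)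
  next
    fix V X assume V: "open_in_mfd A V \<and> V \<subseteq> U \<inter> U' \<and> X \<in> vector_fields A V"
    show "(\<lambda>p. \<theta> p (X p)) \<in> holo_functions A V"
    proof (rule holo_functionsI_local)
      fix p assume p: "p \<in> V"
      then obtain c where c: "c \<in> A" "p \<in> fst c" using chart_around open_mfdD V by blast
      let ?S = "coord c ` (fst c \<inter> V)"
      have X: "holo_map_on (\<lambda>x. X (param c x) c) ?S" using V vector_fieldsD(3) c by blast
      have s: "?S \<subseteq> coord c ` (fst c \<inter> U)" "?S \<subseteq> coord c ` (fst c \<inter> U')" using V by auto
      have "holo_map_on (\<lambda>x. S c (param c x) (X (param c x) c) w) ?S" for w
        unfolding S_def
        by (intro holo_map_on_diff christoffel_holo[OF o(2,1) c(1) s(1) X] christoffel_holo[OF o(4,3) c(1) s(2) X])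
          auto
      then have "holo_fun_on (\<lambda>x. inverse ?N * tr (S c (param c x) (X (param c x) c))) ?S"
        unfolding tr_def holo_map_on_def by (intro holo_fun_on_mult holo_fun_on_sum) auto
      then have "holo_fun_on (\<lambda>x. \<theta> (param c x) (X (param c x))) ?S"
      proof (rule holo_fun_on_cong[rotated -1])
        show "open ?S" using V open_coord c(1) by blast
        fix x assume "x \<in> ?S"
        then obtain q where q: "q \<in> fst c" "q \<in> V" "x = coord c q" by auto
        then have "q \<in> U \<inter> U'" using V by auto
        from \<theta>[OF this c(1) q(1) vector_fieldsD(1)[OF _ q(2)]] V
        show "inverse ?N * tr (S c (param c x) (X (param c x) c)) = \<theta> (param c x) (X (param c x))"
          using q c by (simp add: divide_inverse mult.commute del: of_nat_Suc)
      qed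
      then show "\<exists>c N. c \<in> A \<and> p \<in> fst c \<and> open_in_mfd A N \<and> p \<in> N \<and>
          holo_fun_on (\<lambda>x. \<theta> (param c x) (X (param c x))) (coord c ` (fst c \<inter> N))"
        using c V p by blast
    qed
  qed
  moreover have "D V X Y = D' V X Y + fscale (\<lambda>p. \<theta> p (X p)) Y + fscale (\<lambda>p. \<theta> p (Y p)) X"
    if V: "open_in_mfd A V" "V \<subseteq> U \<inter> U'" and X: "X \<in> vector_fields A V" and Y: "Y \<in> vector_fields A V" for V X Y
  proof
    fix p
    have VU: "V \<subseteq> U" "V \<subseteq> U'" using V by auto
    have DX: "D V X Y \<in> vector_fields A V" "D' V X Y \<in> vector_fields A V"
      using affine_connectionD(1)[OF o(2) V(1) VU(1) X Y] affine_connectionD(1)[OF o(4) V(1) VU(2) X Y] by auto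
    let ?R = "D' V X Y + fscale (\<lambda>p. \<theta> p (X p)) Y + fscale (\<lambda>p. \<theta> p (Y p)) X"
    show "D V X Y p = ?R p"
    proof (cases "p \<in> V")
      case True
      then obtain c where c: "c \<in> A" "p \<in> fst c" using chart_around open_mfdD V by blast
      have p: "p \<in> U \<inter> U'" using True V by auto
      note Xp = vector_fieldsD(1)[OF X True] and Yp = vector_fieldsD(1)[OF Y True]
      show ?thesis
      proof (rule tangent_eqI[OF vector_fieldsD(1)[OF DX(1) True] _ c])
        show "?R p \<in> tangent_space A p"
          using tangent_add[OF tangent_add[OF vector_fieldsD(1)[OF DX(2) True] tangent_scale[OF Yp]] tangent_scale[OF Xp]]
          by simp
        have "tracefree_part (S c p) (X p c) (Y p c) = 0"
          unfolding S_def tracefree_part_diff using eq[OF p c] by (simp add: thomas_def)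
        from tracefree_part_zeroD[OF this]
        have "S c p (X p c) (Y p c) = \<theta> p (X p) *s Y p c + \<theta> p (Y p) *s X p c"
          unfolding \<theta>[OF p c Xp] \<theta>[OF p c Yp] .
        then show "D V X Y p c = ?R p c"
          using christoffel_formula[OF o(2,1) V(1) VU(1) X Y c(1) True c(2)]
            christoffel_formula[OF o(4,3) V(1) VU(2) X Y c(1) True c(2)]
          by (simp add: S_def algebra_simps)
      qed
    next
      case False
      then show ?thesis
        using vector_fieldsD(2)[OF DX(1) False] vector_fieldsD(2)[OF DX(2) False]
          vector_fieldsD(2)[OF X False] vector_fieldsD(2)[OF Y False]
        by (simp add: fun_eq_iff tscale_def)
    qed
  qed
  ultimately show ?thesis unfolding proj_equiv_on_def by blast
qed

end

lemma symbil_expansion: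
  assumes "symbil S"
  shows "S v w = (\<Sum>i\<in>UNIV. \<Sum>j\<in>UNIV. (v $ i * w $ j) *s S (axis i 1) (axis j 1))"
proof -
  have "clin (\<lambda>v. S v w)" for w
    by (simp add: clin_def symbilD(3,4)[OF assms])
  from clin_expansion[OF this]
  have "S v w = (\<Sum>i\<in>UNIV. v $ i *s S (axis i 1) w)" .
  also have "\<dots> = (\<Sum>i\<in>UNIV. v $ i *s (\<Sum>j\<in>UNIV. w $ j *s S (axis i 1) (axis j 1)))"
    by (intro sum.cong refl arg_cong[where f = "\<lambda>t. _ *s t"] clin_expansion symbilD(1)[OF assms])
  also have "\<dots> = (\<Sum>i\<in>UNIV. \<Sum>j\<in>UNIV. (v $ i * w $ j) *s S (axis i 1) (axis j 1))"
    by (simp add: vec_eq_iff sum_component sum_distrib_left mult.assoc)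
  finally show ?thesis .
qed

context complex_manifold
begin

subsection \<open>The standard connection of a chart\<close>

text \<open>The value 0 off V is forced, since members of \<open>vector_fields A V\<close> vanish
  there.\<close>

definition std_conn :: "('a, 'n) chart \<Rightarrow> ('a, 'n) conn" where
  "std_conn c = (\<lambda>V X Y p.
     if p \<in> V then vec_of c p (fd (\<lambda>x. Y (param c x) c) (coord c p) (X p c)) else 0)"

lemma std_conn_apply:
  "c \<in> A \<Longrightarrow> p \<in> V \<Longrightarrow> p \<in> fst c \<Longrightarrow> std_conn c V X Y p c = fd (\<lambda>x. Y (param c x) c) (coord c p) (X p c)"
  by (simp add: std_conn_def)

lemma std_conn_vector_field:
  assumes "c \<in> A" "open_in_mfd A V" "V \<subseteq> fst c" "X \<in> vector_fields A V" "Y \<in> vector_fields A V"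
  shows "std_conn c V X Y \<in> vector_fields A V"
proof (rule vector_fieldsI_chart[OF assms(2,1,3)])
  fix p assume "p \<in> V"
  with assms(3) have "p \<in> V" "p \<in> fst c" by auto
  then show "std_conn c V X Y p \<in> tangent_space A p" using assms(1) by (simp add: std_conn_def)
next
  let ?S = "coord c ` (fst c \<inter> V)"
  have "holo_map_on (\<lambda>x. fd (\<lambda>x. Y (param c x) c) x (X (param c x) c)) ?S"
    by (rule holo_map_on_fd_apply[OF vector_fieldsD(3)[OF assms(5,1)] vector_fieldsD(3)[OF assms(4,1)]
          open_coord[OF assms(2,1)]])
  then show "holo_map_on (\<lambda>x. std_conn c V X Y (param c x) c) ?S"
    by (rule holo_map_on_cong[OF open_coord[OF assms(2,1)], rotated])
      (use assms(1) in \<open>auto simp: std_conn_apply\<close>)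
qed (simp add: std_conn_def)

lemma vector_field_tangent: "X \<in> vector_fields A V \<Longrightarrow> X p \<in> tangent_space A p"
  using vector_fieldsD(1)[of X V p] vector_fieldsD(2)[of X V p] tangent_zero[of p] by metis

lemma affine_connection_std_conn:
  assumes c: "c \<in> A"
  shows "affine_connection A (fst c) (std_conn c)"
  unfolding affine_connection_def
proof (intro allI impI ballI conjI)
  fix V X Y assume V': "open_in_mfd A V \<and> V \<subseteq> fst c"
    and X: "X \<in> vector_fields A V" and Y: "Y \<in> vector_fields A V"
  then have V: "open_in_mfd A V" "V \<subseteq> fst c" by auto
  let ?D = "std_conn c V" and ?S = "coord c ` (fst c \<inter> V)"
  note mem = std_conn_vector_field[OF c V]
  note t = vector_fieldsD(1)[where V = V]
  have comp: "holo_map_on (\<lambda>x. Z (param c x) c) ?S" if "Z \<in> vector_fields A V" for Z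
    by (rule vector_fieldsD(3)[OF that c])
  \<comment> \<open>Fields on V are determined by their components in the chart c; each axiom
    thereby becomes a rule for \<open>fd\<close>.\<close>
  have eqI: "F = G" if "\<And>p. p \<in> V \<Longrightarrow> F p \<in> tangent_space A p" "\<And>p. p \<in> V \<Longrightarrow> G p \<in> tangent_space A p"
    "\<And>p d. p \<notin> V \<Longrightarrow> F p d = 0" "\<And>p d. p \<notin> V \<Longrightarrow> G p d = 0"
    "\<And>p. p \<in> V \<Longrightarrow> p \<in> fst c \<Longrightarrow> coord c p \<in> ?S \<Longrightarrow> F p c = G p c" for F G :: "('a, 'n) vfield"
  proof
    fix p show "F p = G p"
    proof (cases "p \<in> V")
      case True
      then have "p \<in> fst c" using V by auto
      then show ?thesis using tangent_eqI[OF that(1)[OF True] that(2)[OF True] c] that(5)[OF True] True by simp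
    qed (simp add: that(3,4) fun_eq_iff)
  qed
  have off: "Z p d = 0" if "Z \<in> vector_fields A V" "p \<notin> V" for Z p d
    using fun_cong[OF vector_fieldsD(2)[OF that], of d] by simp
  show "?D X Y \<in> vector_fields A V" by (rule mem[OF X Y])
  {
    fix Z assume Z: "Z \<in> vector_fields A V"
    show "?D (X + Z) Y = ?D X Y + ?D Z Y"
      by (rule eqI)
        (simp_all add: mem X Y Z vector_fields_add t tangent_add off std_conn_apply c holo_map_onD(4)[OF comp[OF Y]])
    show "?D X (Y + Z) = ?D X Y + ?D X Z"
      by (rule eqI)
        (simp_all add: mem X Y Z vector_fields_add t tangent_add off std_conn_apply c fd_map_add[OF comp[OF Y] comp[OF Z]])
  next
    fix f assume f: "f \<in> holo_functions A V"
    show "?D (fscale f X) Y = fscale f (?D X Y)"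
      by (rule eqI)
        (simp_all add: mem X Y vector_fields_fscale[OF f] t tangent_scale off std_conn_apply c holo_map_onD(3)[OF comp[OF Y]])
    show "?D X (fscale f Y) = fscale (field_apply A X f) Y + fscale f (?D X Y)"
      by (rule eqI)
        (simp_all add: mem X Y vector_fields_fscale[OF f] t tangent_scale tangent_add off std_conn_apply c
          field_apply_chart[OF V(1) f X _ c] fd_map_scale[OF holo_functionsD[OF f c] comp[OF Y]])
  next
    fix W assume W: "open_in_mfd A W \<and> W \<subseteq> V"
    show "std_conn c W (restrict_field W X) (restrict_field W Y) = restrict_field W (?D X Y)"
    proof
      fix p show "std_conn c W (restrict_field W X) (restrict_field W Y) p = restrict_field W (?D X Y) p"
      proof (cases "p \<in> W")
        case True
        then have p: "p \<in> V" "p \<in> fst c" using W V by auto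
        have "fd (\<lambda>x. restrict_field W Y (param c x) c) (coord c p) = fd (\<lambda>x. Y (param c x) c) (coord c p)"
        proof (rule fd_cong)
          show "open (coord c ` (fst c \<inter> W))" using open_coord W c by blast
        qed (use True p c in \<open>auto simp: restrict_field_def\<close>)
        then show ?thesis using True p by (simp add: std_conn_def restrict_field_def)
      qed (simp add: std_conn_def restrict_field_def)
    qed
  }
qed

lemma torsionfree_std_conn:
  assumes c: "c \<in> A"
  shows "torsionfree A (fst c) (std_conn c)"
  unfolding torsionfree_def
proof (intro allI impI ballI ext)
  fix V X Y p d assume V': "open_in_mfd A V \<and> V \<subseteq> fst c"
    and X: "X \<in> vector_fields A V" and Y: "Y \<in> vector_fields A V"
  then have V: "open_in_mfd A V" "V \<subseteq> fst c" by auto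
  show "(std_conn c V X Y - std_conn c V Y X) p d = lie_bracket A V X Y p d"
  proof (cases "p \<in> V")
    case True
    then have p: "p \<in> fst c" using V by auto
    have "std_conn c V X Y p - std_conn c V Y X p = lie_bracket A V X Y p"
      by (rule tangent_eqI[OF tangent_diff lie_bracket_tangent[OF V(1) X Y True] c p])
        (use std_conn_vector_field[OF c V] X Y True p c in
          \<open>simp_all add: vector_field_tangent[of _ V] std_conn_apply lie_bracket_def\<close>)
    from fun_cong[OF this, of d] show ?thesis by simp
  next
    case False
    then show ?thesis by (simp add: std_conn_def lie_bracket_def)
  qed
qed

lemma connection_on_std_conn: "c \<in> A \<Longrightarrow> connection_on (fst c) (std_conn c)"
  by (simp add: connection_on_def open_mfd_chart affine_connection_std_conn torsionfree_std_conn)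

subsection \<open>Symmetric tensors\<close>

lemma sym_tensorsD:
  assumes "\<Theta> \<in> sym_tensors A" "u \<in> tangent_space A p" "v \<in> tangent_space A p" "w \<in> tangent_space A p"
  shows "\<Theta> p u v \<in> tangent_space A p" "\<Theta> p u v = \<Theta> p v u" "\<Theta> p (u + v) w = \<Theta> p u w + \<Theta> p v w"
    "\<Theta> p (tscale k u) v = tscale k (\<Theta> p u v)" "\<Theta> p w (u + v) = \<Theta> p w u + \<Theta> p w v"
    "\<Theta> p v (tscale k u) = tscale k (\<Theta> p v u)"
proof -
  have *: "\<Theta> p u v \<in> tangent_space A p \<and> \<Theta> p u v = \<Theta> p v u \<and> \<Theta> p (u + v) w = \<Theta> p u w + \<Theta> p v w \<and>
      \<Theta> p (tscale k u) v = tscale k (\<Theta> p u v)"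
    if "u \<in> tangent_space A p" "v \<in> tangent_space A p" "w \<in> tangent_space A p" for u v w k
  proof (cases "p \<in> carrier_of A")
    case True
    have h: "\<forall>p\<in>carrier_of A. \<forall>u\<in>tangent_space A p. \<forall>v\<in>tangent_space A p. \<forall>w\<in>tangent_space A p. \<forall>k.
             \<Theta> p u v \<in> tangent_space A p \<and> \<Theta> p u v = \<Theta> p v u \<and>
             \<Theta> p (u + v) w = \<Theta> p u w + \<Theta> p v w \<and> \<Theta> p (tscale k u) v = tscale k (\<Theta> p u v)"
      using assms(1) unfolding sym_tensors_def by (elim CollectE conjE)
    show ?thesis by (rule h[rule_format, OF True that])
  next
    case False
    have "\<forall>p v w. \<not> (p \<in> carrier_of A \<and> v \<in> tangent_space A p \<and> w \<in> tangent_space A p) \<longrightarrow> \<Theta> p v w = 0"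
      using assms(1) unfolding sym_tensors_def by (elim CollectE conjE)
    then have "\<Theta> p v w = 0" for v w using False by blast
    then show ?thesis by simp
  qed
  note a = assms(2-4)
  show "\<Theta> p u v \<in> tangent_space A p" "\<Theta> p u v = \<Theta> p v u" "\<Theta> p (u + v) w = \<Theta> p u w + \<Theta> p v w"
    "\<Theta> p (tscale k u) v = tscale k (\<Theta> p u v)"
    using *[OF a, of k] by blast+
  show "\<Theta> p w (u + v) = \<Theta> p w u + \<Theta> p w v"
    using *[OF a] *[OF a(3) tangent_add[OF a(1,2)] a(3)] *[OF a(3,1,3)] *[OF a(3,2,3)] by simp
  show "\<Theta> p v (tscale k u) = tscale k (\<Theta> p v u)"
    using *[OF a, of k] *[OF a(2) tangent_scale[OF a(1)] a(3)] *[OF a(2,1,3)] by simp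
qed

lemma sym_tensors_off:
  assumes "\<Theta> \<in> sym_tensors A" "\<not> (p \<in> carrier_of A \<and> v \<in> tangent_space A p \<and> w \<in> tangent_space A p)"
  shows "\<Theta> p v w = 0"
proof -
  have "\<forall>p v w. \<not> (p \<in> carrier_of A \<and> v \<in> tangent_space A p \<and> w \<in> tangent_space A p) \<longrightarrow> \<Theta> p v w = 0"
    using assms(1) unfolding sym_tensors_def by (elim CollectE conjE)
  with assms(2) show ?thesis by blast
qed

lemma sym_tensors_field:
  assumes "\<Theta> \<in> sym_tensors A" "open_in_mfd A V" "X \<in> vector_fields A V" "Y \<in> vector_fields A V"
  shows "(\<lambda>p. \<Theta> p (X p) (Y p)) \<in> vector_fields A V"
proof -
  have "\<forall>V X Y. open_in_mfd A V \<and> X \<in> vector_fields A V \<and> Y \<in> vector_fields A V \<longrightarrow>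
             (\<lambda>p. \<Theta> p (X p) (Y p)) \<in> vector_fields A V"
    using assms(1) unfolding sym_tensors_def by (elim CollectE conjE)
  with assms(2-4) show ?thesis by blast
qed

lemma sym_tensors_zero:
  assumes "\<Theta> \<in> sym_tensors A" shows "\<Theta> p 0 0 = 0"
  using sym_tensorsD(3)[OF assms tangent_zero tangent_zero tangent_zero, of p] by simp

definition comp_in :: "('a, 'n) sym_tensor \<Rightarrow> ('a, 'n) chart \<Rightarrow> 'a \<Rightarrow> complex^'n \<Rightarrow> complex^'n \<Rightarrow> complex^'n" where
  "comp_in \<Theta> c p v w = \<Theta> p (vec_of c p v) (vec_of c p w) c"

lemma comp_in_symbil:
  assumes "\<Theta> \<in> sym_tensors A" "c \<in> A" "p \<in> fst c"
  shows "symbil (comp_in \<Theta> c p)"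
proof (rule symbilI)
  note t = vec_of_tangent[OF assms(2,3)]
  show "comp_in \<Theta> c p v w = comp_in \<Theta> c p w v" for v w
    unfolding comp_in_def sym_tensorsD(2)[OF assms(1) t[of v] t[of w] tangent_zero] ..
  show "comp_in \<Theta> c p w (u + v) = comp_in \<Theta> c p w u + comp_in \<Theta> c p w v" for u v w
    using sym_tensorsD(5)[OF assms(1) t t t] by (simp add: comp_in_def vec_of_linear[OF assms(2,3)])
  show "comp_in \<Theta> c p w (k *s v) = k *s comp_in \<Theta> c p w v" for k v w
    using sym_tensorsD(6)[OF assms(1) t t t] by (simp add: comp_in_def vec_of_linear[OF assms(2,3)])
qed

lemma comp_in_apply:
  assumes "v \<in> tangent_space A p" "w \<in> tangent_space A p" "c \<in> A" "p \<in> fst c"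
  shows "\<Theta> p v w c = comp_in \<Theta> c p (v c) (w c)"
  unfolding comp_in_def tangent_eq_vec_of[OF assms(1,3,4)] tangent_eq_vec_of[OF assms(2,3,4)] ..

lemma comp_in_natural:
  assumes "\<Theta> \<in> sym_tensors A" and c: "c \<in> A" "p \<in> fst c" and d: "d \<in> A" "p \<in> fst d"
  shows "comp_in \<Theta> d p (jac c d p v) (jac c d p w) = jac c d p (comp_in \<Theta> c p v w)"
  unfolding comp_in_def vec_of_jac[OF c d]
  by (rule tangent_jac[OF sym_tensorsD(1)[OF assms(1) _ _ tangent_zero] c d]) (use c in simp_all)

text \<open>The trace is invariant under conjugation by the Jacobian, so any chart may replace the
  one picked by \<open>chart_at\<close>.\<close>

lemma tangent_trace_comp:
  assumes "\<Theta> \<in> sym_tensors A" and c: "c \<in> A" "p \<in> fst c" and t: "t \<in> tangent_space A p"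
  shows "tangent_trace A p (\<Theta> p t) = tr (comp_in \<Theta> c p (t c))"
proof -
  define d where "d = chart_at A p"
  have d: "d \<in> A" "p \<in> fst d"
    using chart_at[OF subsetD[OF chart_subset[OF c(1)] c(2)]] by (auto simp: d_def)
  have "tangent_trace A p (\<Theta> p t) = tr (comp_in \<Theta> d p (t d))"
    unfolding tangent_trace_def Let_def d_def[symmetric] tr_def coord_vector_eq
    by (intro sum.cong refl) (simp add: comp_in_apply[OF t vec_of_tangent[OF d] d] d)
  also have "\<dots> = tr (comp_in \<Theta> d p (jac c d p (t c)))"
    using tangent_jac[OF t c d] by simp
  also have "\<dots> = tr (comp_in \<Theta> c p (t c))"
    by (rule tr_natural[where J' = "jac d c p"])
      (use c d jac_clin comp_in_natural[OF assms(1) c d] symbilD(1)[OF comp_in_symbil[OF assms(1) c]] in simp_all)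
  finally show ?thesis .
qed

text \<open>With a covering subatlas B the trace can be tested in the explicit charts that generate
  the maximal atlas.\<close>

lemma tracefree_iff:
  assumes "\<Theta> \<in> sym_tensors A" "B \<subseteq> A" "carrier_of B = carrier_of A"
  shows "\<Theta> \<in> tracefree_tensors A \<longleftrightarrow> (\<forall>c\<in>B. \<forall>p\<in>fst c. \<forall>v. tr (comp_in \<Theta> c p v) = 0)"
proof
  assume \<Theta>: "\<Theta> \<in> tracefree_tensors A"
  show "\<forall>c\<in>B. \<forall>p\<in>fst c. \<forall>v. tr (comp_in \<Theta> c p v) = 0"
  proof (intro ballI allI)
    fix c p v assume c: "c \<in> B" "p \<in> fst c"
    then have cA: "c \<in> A" using assms(2) by auto
    have "tangent_trace A p (\<Theta> p (vec_of c p v)) = 0"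
      using \<Theta> chart_subset[OF cA] c vec_of_tangent[OF cA c(2)] unfolding tracefree_tensors_def by blast
    then show "tr (comp_in \<Theta> c p v) = 0"
      using tangent_trace_comp[OF assms(1) cA c(2) vec_of_tangent[OF cA c(2), of v]] cA c(2) by simp
  qed
next
  assume R: "\<forall>c\<in>B. \<forall>p\<in>fst c. \<forall>v. tr (comp_in \<Theta> c p v) = 0"
  show "\<Theta> \<in> tracefree_tensors A"
    unfolding tracefree_tensors_def
  proof (intro CollectI conjI ballI assms(1))
    fix p t assume "p \<in> carrier_of A" and t: "t \<in> tangent_space A p"
    then have "p \<in> carrier_of B" using assms(3) by simp
    then obtain c where c: "c \<in> B" "p \<in> fst c" by (auto simp: carrier_of_def)
    then have "c \<in> A" using assms(2) by auto
    then show "tangent_trace A p (\<Theta> p t) = 0"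
      using tangent_trace_comp[OF assms(1) _ c(2) t] R c by simp
  qed
qed

lemma sym_tensor_eqI:
  assumes \<Theta>: "\<Theta> \<in> sym_tensors A" "\<Theta>' \<in> sym_tensors A" and B: "B \<subseteq> A" "carrier_of B = carrier_of A"
    and eq: "\<And>c p. c \<in> B \<Longrightarrow> p \<in> fst c \<Longrightarrow> comp_in \<Theta> c p = comp_in \<Theta>' c p"
  shows "\<Theta> = \<Theta>'"
proof (intro ext)
  fix p v w d
  have "\<Theta> p v w = \<Theta>' p v w"
  proof (cases "p \<in> carrier_of A \<and> v \<in> tangent_space A p \<and> w \<in> tangent_space A p")
    case True
    then have "p \<in> carrier_of B" using B by simp
    then obtain c where c: "c \<in> B" "p \<in> fst c" by (auto simp: carrier_of_def)
    then have cA: "c \<in> A" using B by auto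
    have v: "v \<in> tangent_space A p" and w: "w \<in> tangent_space A p" using True by auto
    show ?thesis
      by (rule tangent_eqI[OF sym_tensorsD(1)[OF \<Theta>(1) v w w] sym_tensorsD(1)[OF \<Theta>(2) v w w] cA c(2)])
        (simp only: comp_in_apply[OF v w cA c(2)] eq[OF c])
  next
    case False
    then show ?thesis using sym_tensors_off[OF \<Theta>(1)] sym_tensors_off[OF \<Theta>(2)] by simp
  qed
  then show "\<Theta> p v w d = \<Theta>' p v w d" by simp
qed

lemma sym_tensorsI:
  assumes "\<And>p u v. p \<in> carrier_of A \<Longrightarrow> u \<in> tangent_space A p \<Longrightarrow> v \<in> tangent_space A p \<Longrightarrow>
      \<Theta> p u v \<in> tangent_space A p \<and> \<Theta> p u v = \<Theta> p v u"
    and "\<And>p u v w. p \<in> carrier_of A \<Longrightarrow> u \<in> tangent_space A p \<Longrightarrow> v \<in> tangent_space A p \<Longrightarrow> w \<in> tangent_space A p \<Longrightarrow>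
      \<Theta> p (u + v) w = \<Theta> p u w + \<Theta> p v w"
    and "\<And>p u v k. p \<in> carrier_of A \<Longrightarrow> u \<in> tangent_space A p \<Longrightarrow> v \<in> tangent_space A p \<Longrightarrow>
      \<Theta> p (tscale k u) v = tscale k (\<Theta> p u v)"
    and "\<And>p v w. \<not> (p \<in> carrier_of A \<and> v \<in> tangent_space A p \<and> w \<in> tangent_space A p) \<Longrightarrow> \<Theta> p v w = 0"
    and "\<And>V X Y. open_in_mfd A V \<Longrightarrow> X \<in> vector_fields A V \<Longrightarrow> Y \<in> vector_fields A V \<Longrightarrow>
      (\<lambda>p. \<Theta> p (X p) (Y p)) \<in> vector_fields A V"
  shows "\<Theta> \<in> sym_tensors A"
  unfolding sym_tensors_def
proof (intro CollectI conjI ballI allI impI)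
  fix p u v w k assume a: "p \<in> carrier_of A" "u \<in> tangent_space A p" "v \<in> tangent_space A p" "w \<in> tangent_space A p"
  show "\<Theta> p u v \<in> tangent_space A p" "\<Theta> p u v = \<Theta> p v u" using assms(1)[OF a(1-3)] by auto
  show "\<Theta> p (u + v) w = \<Theta> p u w + \<Theta> p v w" by (rule assms(2)[OF a])
  show "\<Theta> p (tscale k u) v = tscale k (\<Theta> p u v)" by (rule assms(3)[OF a(1-3)])
qed (use assms(4,5) in auto)

lemma tscale_distrib: "tscale k (s + t) = tscale k s + tscale k t"
  by (simp add: tscale_def fun_eq_iff vector_add_ldistrib)

lemma sym_tensors_add:
  assumes "\<Theta> \<in> sym_tensors A" "\<Theta>' \<in> sym_tensors A"
  shows "\<Theta> + \<Theta>' \<in> sym_tensors A"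
proof (rule sym_tensorsI)
  fix p v w assume "\<not> (p \<in> carrier_of A \<and> v \<in> tangent_space A p \<and> w \<in> tangent_space A p)"
  then show "(\<Theta> + \<Theta>') p v w = 0"
    using sym_tensors_off[OF assms(1)] sym_tensors_off[OF assms(2)] by simp
next
  fix V X Y assume "open_in_mfd A V" "X \<in> vector_fields A V" "Y \<in> vector_fields A V"
  then show "(\<lambda>p. (\<Theta> + \<Theta>') p (X p) (Y p)) \<in> vector_fields A V"
    using vector_fields_add[OF sym_tensors_field[OF assms(1)] sym_tensors_field[OF assms(2)]]
    by (simp add: plus_fun_def)
next
  fix p u v assume a: "u \<in> tangent_space A p" "v \<in> tangent_space A p"
  note s = sym_tensorsD[OF assms(1) a] sym_tensorsD[OF assms(2) a]
  show "(\<Theta> + \<Theta>') p u v \<in> tangent_space A p \<and> (\<Theta> + \<Theta>') p u v = (\<Theta> + \<Theta>') p v u"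
    using s(1,2,7,8)[OF a(1)] tangent_add by simp
  show "(\<Theta> + \<Theta>') p (tscale k u) v = tscale k ((\<Theta> + \<Theta>') p u v)" for k
    using s(4,10)[OF a(1)] by (simp add: tscale_distrib)
  show "(\<Theta> + \<Theta>') p (u + v) w = (\<Theta> + \<Theta>') p u w + (\<Theta> + \<Theta>') p v w" if "w \<in> tangent_space A p" for w
    using s(3,9)[OF that] by (simp add: algebra_simps)
qed

lemma sym_tensors_scale:
  assumes "\<Theta> \<in> sym_tensors A"
  shows "tensor_scale k \<Theta> \<in> sym_tensors A"
proof (rule sym_tensorsI)
  fix p v w assume "\<not> (p \<in> carrier_of A \<and> v \<in> tangent_space A p \<and> w \<in> tangent_space A p)"
  then show "tensor_scale k \<Theta> p v w = 0"
    using sym_tensors_off[OF assms] by (simp add: tensor_scale_def)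
next
  fix V X Y assume "open_in_mfd A V" "X \<in> vector_fields A V" "Y \<in> vector_fields A V"
  then show "(\<lambda>p. tensor_scale k \<Theta> p (X p) (Y p)) \<in> vector_fields A V"
    using vector_fields_fscale[OF _ sym_tensors_field[OF assms], of "\<lambda>_. k"]
    by (simp add: tensor_scale_def fscale_def holo_functions_def comp_def)
next
  fix p u v assume a: "u \<in> tangent_space A p" "v \<in> tangent_space A p"
  note s = sym_tensorsD[OF assms a]
  show "tensor_scale k \<Theta> p u v \<in> tangent_space A p \<and> tensor_scale k \<Theta> p u v = tensor_scale k \<Theta> p v u"
    using s(1,2)[OF a(1)] tangent_scale by (simp add: tensor_scale_def)
  show "tensor_scale k \<Theta> p (tscale l u) v = tscale l (tensor_scale k \<Theta> p u v)" for l
    using s(4)[OF a(1)] by (simp add: tensor_scale_def fun_eq_iff mult.commute)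
  show "tensor_scale k \<Theta> p (u + v) w = tensor_scale k \<Theta> p u w + tensor_scale k \<Theta> p v w" if "w \<in> tangent_space A p" for w
    using s(3)[OF that] by (simp add: tensor_scale_def tscale_distrib)
qed

lemma sym_tensors_0: "0 \<in> sym_tensors A"
proof (rule sym_tensorsI)
  have "(\<lambda>p. (0 :: ('a, 'n) sym_tensor) p (X p) (Y p)) = 0" for X Y :: "('a, 'n) vfield"
    by (simp add: fun_eq_iff)
  then show "(\<lambda>p. (0 :: ('a, 'n) sym_tensor) p (X p) (Y p)) \<in> vector_fields A V" for V X Y
    by (simp only: zero_vector_field)
qed (simp_all add: fun_eq_iff)

lemma comp_in_add: "comp_in (\<Theta> + \<Theta>') c p v w = comp_in \<Theta> c p v w + comp_in \<Theta>' c p v w"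
  by (simp add: comp_in_def)

lemma comp_in_scale: "comp_in (tensor_scale k \<Theta>) c p v w = k *s comp_in \<Theta> c p v w"
  by (simp add: comp_in_def tensor_scale_def)

lemma comp_in_0: "comp_in 0 c p v w = 0"
  by (simp add: comp_in_def)

lemma tracefree_sym: "\<Theta> \<in> tracefree_tensors A \<Longrightarrow> \<Theta> \<in> sym_tensors A"
  by (simp add: tracefree_tensors_def)

lemma tracefree_comp:
  assumes "\<Theta> \<in> tracefree_tensors A" "c \<in> A" "p \<in> fst c"
  shows "tr (comp_in \<Theta> c p v) = 0"
  using tracefree_iff[OF tracefree_sym[OF assms(1)] order_refl refl] assms by simp

lemma tracefree_add:
  assumes "\<Theta> \<in> tracefree_tensors A" "\<Theta>' \<in> tracefree_tensors A"
  shows "\<Theta> + \<Theta>' \<in> tracefree_tensors A"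
proof -
  have "tr (comp_in (\<Theta> + \<Theta>') c p v) = 0" if "c \<in> A" "p \<in> fst c" for c p v
  proof -
    have "comp_in (\<Theta> + \<Theta>') c p v = (\<lambda>w. comp_in \<Theta> c p v w + comp_in \<Theta>' c p v w)"
      by (rule ext) (rule comp_in_add)
    then show ?thesis
      using tracefree_comp[OF assms(1) that] tracefree_comp[OF assms(2) that] by (simp add: tr_add)
  qed
  then show ?thesis
    using tracefree_iff[OF sym_tensors_add[OF tracefree_sym[OF assms(1)] tracefree_sym[OF assms(2)]] order_refl refl]
    by simp
qed

lemma tracefree_0: "0 \<in> tracefree_tensors A"
  using tracefree_iff[OF sym_tensors_0 order_refl refl] by (simp add: tr_def comp_in_0)

definition tensor_of :: "('a, 'n) chart set \<Rightarrow> (('a, 'n) chart \<Rightarrow> 'a \<Rightarrow> complex^'n \<Rightarrow> complex^'n \<Rightarrow> complex^'n) \<Rightarrow>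
    ('a, 'n) sym_tensor" where
  "tensor_of B T p v w =
     (if p \<in> carrier_of A \<and> v \<in> tangent_space A p \<and> w \<in> tangent_space A p
      then let c = (SOME c. c \<in> B \<and> p \<in> fst c) in vec_of c p (T c p (v c) (w c)) else 0)"

text \<open>Gluing of local components. Compatibility on overlaps makes the chosen chart irrelevant,
  and bilinear expansion reduces holomorphy on arbitrary fields to holomorphy on constant arguments
  near each point.\<close>

lemma
  assumes B: "B \<subseteq> A" "carrier_of B = carrier_of A"
    and sym: "\<And>c p. c \<in> B \<Longrightarrow> p \<in> fst c \<Longrightarrow> symbil (T c p)"
    and nat: "\<And>c d p v w. c \<in> B \<Longrightarrow> d \<in> B \<Longrightarrow> p \<in> fst c \<Longrightarrow> p \<in> fst d \<Longrightarrow>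
      T d p (jac c d p v) (jac c d p w) = jac c d p (T c p v w)"
    and holo: "\<And>c p. c \<in> B \<Longrightarrow> p \<in> fst c \<Longrightarrow> \<exists>N. open_in_mfd A N \<and> p \<in> N \<and>
      (\<forall>v w. holo_map_on (\<lambda>x. T c (param c x) v w) (coord c ` (fst c \<inter> N)))"
  shows tensor_of_sym_tensor: "tensor_of B T \<in> sym_tensors A" (is ?thesis1)
    and tensor_of_comp: "c \<in> B \<Longrightarrow> p \<in> fst c \<Longrightarrow> comp_in (tensor_of B T) c p = T c p"
proof -
  let ?\<Theta> = "tensor_of B T"
  have val: "?\<Theta> p v w = vec_of c p (T c p (v c) (w c))"
    if v: "v \<in> tangent_space A p" and w: "w \<in> tangent_space A p" and c: "c \<in> B" "p \<in> fst c" for p v w c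
  proof -
    have cA: "c \<in> A" using c B by auto
    define d where "d = (SOME c. c \<in> B \<and> p \<in> fst c)"
    have d: "d \<in> B" "p \<in> fst d" using someI[of "\<lambda>c. c \<in> B \<and> p \<in> fst c" c] c by (auto simp: d_def)
    have dA: "d \<in> A" using d B by auto
    have "?\<Theta> p v w = vec_of d p (T d p (v d) (w d))"
      using v w chart_subset[OF cA] c by (auto simp: tensor_of_def d_def Let_def)
    also have "T d p (v d) (w d) = jac c d p (T c p (v c) (w c))"
      unfolding tangent_jac[OF v cA c(2) dA d(2)] tangent_jac[OF w cA c(2) dA d(2)] by (rule nat[OF c(1) d(1) c(2) d(2)])
    finally show ?thesis using vec_of_jac[OF cA c(2) dA d(2)] by simp
  qed
  have ex: "\<exists>c. c \<in> B \<and> c \<in> A \<and> p \<in> fst c" if "p \<in> carrier_of A" for p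
  proof -
    have "p \<in> carrier_of B" using that B by simp
    then obtain c where "c \<in> B" "p \<in> fst c" by (auto simp: carrier_of_def)
    then show ?thesis using B by blast
  qed
  show "?\<Theta> \<in> sym_tensors A"
  proof (rule sym_tensorsI)
    fix p u v assume a: "p \<in> carrier_of A" "u \<in> tangent_space A p" "v \<in> tangent_space A p"
    then obtain c where c: "c \<in> B" "p \<in> fst c" "c \<in> A" using ex by blast
    note s = symbilD[OF sym[OF c(1,2)]]
    show "?\<Theta> p u v \<in> tangent_space A p \<and> ?\<Theta> p u v = ?\<Theta> p v u"
      using val[OF a(2,3) c(1,2)] val[OF a(3,2) c(1,2)] s(2)[of "u c" "v c"] c vec_of_tangent[OF c(3,2)] by simp
    show "?\<Theta> p (tscale k u) v = tscale k (?\<Theta> p u v)" for k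
      using val[OF tangent_scale[OF a(2)] a(3) c(1,2)] val[OF a(2,3) c(1,2)] vec_of_linear(2)[OF c(3,2)] s(4) by simp
    show "?\<Theta> p (u + v) w = ?\<Theta> p u w + ?\<Theta> p v w" if w: "w \<in> tangent_space A p" for w
      using val[OF tangent_add[OF a(2,3)] w c(1,2)] val[OF a(2) w c(1,2)] val[OF a(3) w c(1,2)]
        vec_of_linear(1)[OF c(3,2)] s(3) by simp
  next
    fix p v w assume "\<not> (p \<in> carrier_of A \<and> v \<in> tangent_space A p \<and> w \<in> tangent_space A p)"
    then show "?\<Theta> p v w = 0" unfolding tensor_of_def by (rule if_not_P)
  next
    fix V X Y assume V: "open_in_mfd A V" and X: "X \<in> vector_fields A V" and Y: "Y \<in> vector_fields A V"
    note Xt = vector_field_tangent[OF X] and Yt = vector_field_tangent[OF Y]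
    show "(\<lambda>p. ?\<Theta> p (X p) (Y p)) \<in> vector_fields A V"
    proof (rule vector_fieldsI_local)
      fix p assume p: "p \<in> V"
      then obtain c where c: "c \<in> B" "c \<in> A" "p \<in> fst c" using ex open_mfdD V by blast
      show "?\<Theta> p (X p) (Y p) \<in> tangent_space A p"
        unfolding val[OF Xt Yt c(1,3)] by (rule vec_of_tangent[OF c(2,3)])
      obtain N where N: "open_in_mfd A N" "p \<in> N"
        and h: "\<And>v w. holo_map_on (\<lambda>x. T c (param c x) v w) (coord c ` (fst c \<inter> N))"
        using holo[OF c(1,3)] by blast
      let ?N = "N \<inter> V"
      have o: "open_in_mfd A ?N" by (rule open_mfd_Int[OF N(1) V])
      let ?S = "coord c ` (fst c \<inter> ?N)"
      let ?F = "\<lambda>x. \<Sum>i\<in>UNIV. \<Sum>j\<in>UNIV. (X (param c x) c $ i * Y (param c x) c $ j) *s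
          T c (param c x) (axis i 1) (axis j 1)"
      have "holo_map_on (\<lambda>x. X (param c x) c) ?S" "holo_map_on (\<lambda>x. Y (param c x) c) ?S"
        by (rule holo_map_on_subset[OF vector_fieldsD(3)[OF X c(2)]], blast,
            rule holo_map_on_subset[OF vector_fieldsD(3)[OF Y c(2)]], blast)
      moreover have "holo_map_on (\<lambda>x. T c (param c x) v w) ?S" for v w
        by (rule holo_map_on_subset[OF h]) blast
      ultimately have "holo_map_on ?F ?S"
        by (intro holo_map_on_sum holo_map_on_scale holo_fun_on_mult) (auto simp: holo_map_on_def)
      then have "holo_map_on (\<lambda>x. ?\<Theta> (param c x) (X (param c x)) (Y (param c x)) c) ?S"
      proof (rule holo_map_on_cong[OF open_coord[OF o c(2)], rotated])
        fix x assume "x \<in> ?S"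
        then obtain q where q: "q \<in> fst c" "x = coord c q" by auto
        show "?F x = ?\<Theta> (param c x) (X (param c x)) (Y (param c x)) c"
          using val[OF Xt Yt c(1) q(1)] symbil_expansion[OF sym[OF c(1) q(1)], of "X q c" "Y q c"] q c by simp
      qed
      then show "\<exists>c N. c \<in> A \<and> p \<in> fst c \<and> open_in_mfd A N \<and> p \<in> N \<and> N \<subseteq> V \<and>
          holo_map_on (\<lambda>x. ?\<Theta> (param c x) (X (param c x)) (Y (param c x)) c) (coord c ` (fst c \<inter> N))"
        using c o p N by (intro exI[of _ c] exI[of _ ?N]) auto
    next
      fix p assume p: "p \<notin> V"
      show "?\<Theta> p (X p) (Y p) = 0"
      proof (cases "p \<in> carrier_of A")
        case True
        then obtain c where c: "c \<in> B" "p \<in> fst c" "c \<in> A" using ex by blast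
        \<comment> \<open>Here p may well lie in the carrier, so the value 0 comes from bilinearity
          and not from the default case of \<open>tensor_of\<close>.\<close>
        have "T c p (0 *s 0) 0 = 0 *s T c p 0 0" by (rule symbilD(4)[OF sym[OF c(1,2)]])
        then have "T c p 0 0 = 0" by simp
        then show ?thesis
          using val[OF Xt Yt c(1,2)] vector_fieldsD(2)[OF X p] vector_fieldsD(2)[OF Y p]
            vec_of_linear(2)[OF c(3,2), of 0 0] by (simp add: tscale_def zero_fun_def)
      qed (simp add: tensor_of_def)
    qed
  qed
  show "comp_in ?\<Theta> c p = T c p" if c: "c \<in> B" "p \<in> fst c" for c p
  proof (intro ext)
    fix v w
    have cA: "c \<in> A" using c B by auto
    show "comp_in ?\<Theta> c p v w = T c p v w"
      unfolding comp_in_def val[OF vec_of_tangent[OF cA c(2)] vec_of_tangent[OF cA c(2)] c] using cA c(2) by simp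
  qed
qed

end

context complex_manifold
begin

subsection \<open>Translating connections by tensors\<close>

definition add_tensor :: "('a, 'n) sym_tensor \<Rightarrow> ('a, 'n) conn \<Rightarrow> ('a, 'n) conn" where
  "add_tensor \<Theta> D = (\<lambda>V X Y p. D V X Y p + \<Theta> p (X p) (Y p))"

lemma add_tensor_eq: "add_tensor \<Theta> D V X Y = D V X Y + (\<lambda>p. \<Theta> p (X p) (Y p))"
  by (simp add: add_tensor_def fun_eq_iff)

lemma affine_connection_add_tensor:
  assumes D: "affine_connection A U D" and \<Theta>: "\<Theta> \<in> sym_tensors A"
  shows "affine_connection A U (add_tensor \<Theta> D)"
  unfolding affine_connection_def
proof (intro allI impI ballI conjI)
  fix V X Y assume V': "open_in_mfd A V \<and> V \<subseteq> U"
    and X: "X \<in> vector_fields A V" and Y: "Y \<in> vector_fields A V"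
  then have V: "open_in_mfd A V" "V \<subseteq> U" by auto
  note a = affine_connectionD[OF D V X Y]
  note Xt = vector_field_tangent[OF X] and Yt = vector_field_tangent[OF Y]
  note \<Theta>z = sym_tensors_zero[OF \<Theta>]
  show "add_tensor \<Theta> D V X Y \<in> vector_fields A V"
    unfolding add_tensor_eq by (rule vector_fields_add[OF a(1) sym_tensors_field[OF \<Theta> V(1) X Y]])
  {
    fix Z assume Z: "Z \<in> vector_fields A V"
    note Zt = vector_field_tangent[OF Z]
    show "add_tensor \<Theta> D V (X + Z) Y = add_tensor \<Theta> D V X Y + add_tensor \<Theta> D V Z Y"
      unfolding add_tensor_eq a(2)[OF Z]
      by (simp add: fun_eq_iff sym_tensorsD(3)[OF \<Theta> Xt Zt Yt])
    show "add_tensor \<Theta> D V X (Y + Z) = add_tensor \<Theta> D V X Y + add_tensor \<Theta> D V X Z"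
      unfolding add_tensor_eq a(3)[OF Z]
      by (simp add: fun_eq_iff sym_tensorsD(5)[OF \<Theta> Yt Zt Xt])
  next
    fix f assume f: "f \<in> holo_functions A V"
    show "add_tensor \<Theta> D V (fscale f X) Y = fscale f (add_tensor \<Theta> D V X Y)"
      unfolding add_tensor_eq a(4)[OF f]
      by (simp add: fun_eq_iff sym_tensorsD(4)[OF \<Theta> Xt Yt tangent_zero] vector_add_ldistrib)
    show "add_tensor \<Theta> D V X (fscale f Y) = fscale (field_apply A X f) Y + fscale f (add_tensor \<Theta> D V X Y)"
      unfolding add_tensor_eq a(5)[OF f]
      by (simp add: fun_eq_iff sym_tensorsD(6)[OF \<Theta> Yt Xt tangent_zero] vector_add_ldistrib)
  next
    fix W assume W: "open_in_mfd A W \<and> W \<subseteq> V"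
    then have W: "open_in_mfd A W" "W \<subseteq> V" by auto
    show "add_tensor \<Theta> D W (restrict_field W X) (restrict_field W Y) = restrict_field W (add_tensor \<Theta> D V X Y)"
      unfolding add_tensor_eq a(6)[OF W]
      by (simp add: fun_eq_iff restrict_field_def \<Theta>z)
  }
qed

lemma connection_on_add_tensor:
  assumes D: "connection_on U D" and \<Theta>: "\<Theta> \<in> sym_tensors A"
  shows "connection_on U (add_tensor \<Theta> D)"
proof -
  have "torsionfree A U (add_tensor \<Theta> D)"
    unfolding torsionfree_def
  proof (intro allI impI ballI)
    fix V X Y assume V: "open_in_mfd A V \<and> V \<subseteq> U"
      and X: "X \<in> vector_fields A V" and Y: "Y \<in> vector_fields A V"
    have "D V X Y - D V Y X = lie_bracket A V X Y"
      using D V X Y by (simp add: connection_on_def torsionfree_def)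
    moreover have "add_tensor \<Theta> D V X Y - add_tensor \<Theta> D V Y X = D V X Y - D V Y X"
      unfolding add_tensor_eq
      using sym_tensorsD(2)[OF \<Theta> vector_field_tangent[OF X] vector_field_tangent[OF Y] tangent_zero]
      by (simp add: fun_eq_iff)
    ultimately show "add_tensor \<Theta> D V X Y - add_tensor \<Theta> D V Y X = lie_bracket A V X Y"
      by simp
  qed
  then show ?thesis
    using D affine_connection_add_tensor[OF _ \<Theta>] by (simp add: connection_on_def)
qed

lemma christoffel_add_tensor:
  assumes D: "connection_on U D" and \<Theta>: "\<Theta> \<in> sym_tensors A" and p: "p \<in> U" "c \<in> A" "p \<in> fst c"
  shows "christoffel U (add_tensor \<Theta> D) c p v w = christoffel U D c p v w + comp_in \<Theta> c p v w"
proof -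
  let ?V = "U \<inter> fst c"
  have o: "open_in_mfd A U" "affine_connection A U D" "affine_connection A U (add_tensor \<Theta> D)"
    using D connection_on_add_tensor[OF D \<Theta>] by (auto simp: connection_on_def)
  have V: "open_in_mfd A ?V" "?V \<subseteq> U" "?V \<subseteq> fst c" "p \<in> ?V"
    using open_mfd_Int[OF o(1) open_mfd_chart[OF p(2)]] p by auto
  show ?thesis
    using connection_const_fields[OF o(2,1) V(1-3) p(2) V(4), of v w]
      connection_const_fields[OF o(3,1) V(1-3) p(2) V(4), of v w] V(4)
    by (simp add: add_tensor_def comp_in_def)
qed

text \<open>Taking trace-free parts is additive and fixes trace-free maps; translation thereby
  becomes addition of components.\<close>

lemma thomas_add_tensor:
  assumes D: "connection_on U D" and \<Theta>: "\<Theta> \<in> tracefree_tensors A" and p: "p \<in> U" "c \<in> A" "p \<in> fst c"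
  shows "thomas U (add_tensor \<Theta> D) c p v w = thomas U D c p v w + comp_in \<Theta> c p v w"
proof -
  have "christoffel U (add_tensor \<Theta> D) c p = (\<lambda>v w. christoffel U D c p v w + comp_in \<Theta> c p v w)"
    using christoffel_add_tensor[OF D tracefree_sym[OF \<Theta>] p] by blast
  then show ?thesis
    unfolding thomas_def using tracefree_part_id[of "comp_in \<Theta> c p", OF tracefree_comp[OF \<Theta> p(2,3)]]
    by (simp add: tracefree_part_add)
qed

lemma translate_eq: "translate \<Theta> P = (\<lambda>(U, D). (U, add_tensor \<Theta> D)) ` P"
  by (simp add: translate_def add_tensor_def)

subsection \<open>Projective classes\<close>

text \<open>Trades the existence of a one-form on each overlap for a pointwise equality.\<close>

lemma projective_connectionI:
  assumes "\<Union> (fst ` P) = carrier_of A" "\<And>U D. (U, D) \<in> P \<Longrightarrow> connection_on U D"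
    and "\<And>U D U' D' p c. (U, D) \<in> P \<Longrightarrow> (U', D') \<in> P \<Longrightarrow> p \<in> U \<Longrightarrow> p \<in> U' \<Longrightarrow> c \<in> A \<Longrightarrow> p \<in> fst c \<Longrightarrow>
      thomas U D c p = thomas U' D' c p"
  shows "projective_connection A P"
  unfolding projective_connection_def
proof (intro conjI assms(1) ballI, clarify)
  fix U D assume "(U, D) \<in> P"
  from assms(2)[OF this] show "open_in_mfd A U \<and> affine_connection A U D \<and> torsionfree A U D"
    by (simp add: connection_on_def)
next
  fix x assume x: "x \<in> P"
  have "proj_equiv_on A (fst x \<inter> fst y) (snd x) (snd y)" if y: "y \<in> P" for y
    by (rule thomas_eq_imp_proj_equiv_on) (use x y assms(2,3) in \<open>auto simp: surjective_pairing[symmetric]\<close>)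
  then show "case x of (U, D) \<Rightarrow> \<forall>(U', D')\<in>P. proj_equiv_on A (U \<inter> U') D D'"
    by (auto simp: case_prod_beta)
qed

lemma projective_connectionD:
  assumes "projective_connection A P"
  shows "\<Union> (fst ` P) = carrier_of A" "(U, D) \<in> P \<Longrightarrow> connection_on U D"
    "(U, D) \<in> P \<Longrightarrow> (U', D') \<in> P \<Longrightarrow> p \<in> U \<Longrightarrow> p \<in> U' \<Longrightarrow> c \<in> A \<Longrightarrow> p \<in> fst c \<Longrightarrow>
      thomas U D c p = thomas U' D' c p"
proof -
  show "\<Union> (fst ` P) = carrier_of A" using assms by (simp add: projective_connection_def)
  have conn: "connection_on U D" if "(U, D) \<in> P" for U D
    using assms that unfolding projective_connection_def connection_on_def by blast
  then show "(U, D) \<in> P \<Longrightarrow> connection_on U D" .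
  assume a: "(U, D) \<in> P" "(U', D') \<in> P" "p \<in> U" "p \<in> U'" "c \<in> A" "p \<in> fst c"
  then have "proj_equiv_on A (U \<inter> U') D D'"
    using assms unfolding projective_connection_def by blast
  then show "thomas U D c p = thomas U' D' c p"
    by (rule proj_equiv_on_imp_thomas_eq[OF conn[OF a(1)] conn[OF a(2)] a(3-6)])
qed

text \<open>Around each point any member of the projective connection may be used, since all of them
  have the same symbol there.\<close>

definition thomas_at :: "('a, 'n) pconn \<Rightarrow> ('a, 'n) chart \<Rightarrow> 'a \<Rightarrow> complex^'n \<Rightarrow> complex^'n \<Rightarrow> complex^'n" where
  "thomas_at P c p = (let x = (SOME x. x \<in> P \<and> p \<in> fst x) in thomas (fst x) (snd x) c p)"

lemma projective_connection_cover:
  assumes "projective_connection A P" "p \<in> carrier_of A"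
  obtains U D where "(U, D) \<in> P" "p \<in> U"
proof -
  have "p \<in> \<Union> (fst ` P)" using projective_connectionD(1)[OF assms(1)] assms(2) by simp
  then show ?thesis using that by auto
qed

lemma thomas_at_eq:
  assumes P: "projective_connection A P" and U: "(U, D) \<in> P" "p \<in> U" and c: "c \<in> A" "p \<in> fst c"
  shows "thomas_at P c p = thomas U D c p"
proof -
  define x where "x = (SOME x. x \<in> P \<and> p \<in> fst x)"
  have x: "x \<in> P" "p \<in> fst x"
    using someI[of "\<lambda>x. x \<in> P \<and> p \<in> fst x" "(U, D)"] U by (auto simp: x_def)
  have "thomas (fst x) (snd x) c p = thomas U D c p"
    by (rule projective_connectionD(3)[OF P _ U(1) x(2) U(2) c]) (use x in simp)
  then show ?thesis by (simp add: thomas_at_def x_def Let_def)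
qed

text \<open>A complete invariant: transitivity of projective equivalence, not evident from one-forms
  on a union, becomes transitivity of equality.\<close>

lemma proj_equiv_iff:
  "(P, Q) \<in> proj_equiv A \<longleftrightarrow> projective_connection A P \<and> projective_connection A Q \<and>
    (\<forall>c\<in>A. \<forall>p\<in>fst c. thomas_at P c p = thomas_at Q c p)" (is "?L \<longleftrightarrow> ?R")
proof
  assume L: ?L
  then have PQ: "projective_connection A P" "projective_connection A Q" "projective_connection A (P \<union> Q)"
    by (auto simp: proj_equiv_def)
  have "thomas_at P c p = thomas_at Q c p" if c: "c \<in> A" "p \<in> fst c" for c p
  proof -
    have p: "p \<in> carrier_of A" using chart_subset[OF c(1)] c(2) by auto
    obtain U D where U: "(U, D) \<in> P" "p \<in> U" using projective_connection_cover[OF PQ(1) p] .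
    obtain U' D' where U': "(U', D') \<in> Q" "p \<in> U'" using projective_connection_cover[OF PQ(2) p] .
    show ?thesis
      unfolding thomas_at_eq[OF PQ(1) U c] thomas_at_eq[OF PQ(2) U' c]
      by (rule projective_connectionD(3)[OF PQ(3) _ _ U(2) U'(2) c]) (use U U' in auto)
  qed
  then show ?R using PQ by simp
next
  assume R: ?R
  then have P: "projective_connection A P" and Q: "projective_connection A Q" by auto
  have "projective_connection A (P \<union> Q)"
  proof (rule projective_connectionI)
    show "\<Union> (fst ` (P \<union> Q)) = carrier_of A"
      using projective_connectionD(1)[OF P] projective_connectionD(1)[OF Q] by (simp add: image_Un)
    show "connection_on U D" if "(U, D) \<in> P \<union> Q" for U D
      using that projective_connectionD(2)[OF P] projective_connectionD(2)[OF Q] by blast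
    have *: "thomas U D c p = thomas_at P c p" if "(U, D) \<in> P \<union> Q" "p \<in> U" "c \<in> A" "p \<in> fst c" for U D p c
      using that(1)
    proof
      assume "(U, D) \<in> P"
      then show ?thesis using thomas_at_eq[OF P _ that(2-4)] by simp
    next
      assume "(U, D) \<in> Q"
      then show ?thesis using thomas_at_eq[OF Q _ that(2-4)] R that by simp
    qed
    show "thomas U D c p = thomas U' D' c p"
      if "(U, D) \<in> P \<union> Q" "(U', D') \<in> P \<union> Q" "p \<in> U" "p \<in> U'" "c \<in> A" "p \<in> fst c" for U D U' D' p c
      using *[OF that(1,3,5,6)] *[OF that(2,4,5,6)] by simp
  qed
  then show ?L using P Q by (simp add: proj_equiv_def)
qed

lemma equiv_proj_equiv: "equiv {P. projective_connection A P} (proj_equiv A)"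
proof (rule equivI)
  show "proj_equiv A \<subseteq> {P. projective_connection A P} \<times> {P. projective_connection A P}"
    by (auto simp: proj_equiv_def)
  show "refl_on {P. projective_connection A P} (proj_equiv A)"
    by (rule refl_onI) (simp add: proj_equiv_iff)
  show "sym (proj_equiv A)" by (rule symI) (simp add: proj_equiv_iff)
  show "trans (proj_equiv A)" by (rule transI) (simp add: proj_equiv_iff)
qed

lemma projective_connection_translate:
  assumes P: "projective_connection A P" and \<Theta>: "\<Theta> \<in> tracefree_tensors A"
  shows "projective_connection A (translate \<Theta> P)"
proof (rule projective_connectionI)
  have "fst ` translate \<Theta> P = fst ` P" by (force simp: translate_eq)
  then show "\<Union> (fst ` translate \<Theta> P) = carrier_of A"
    using projective_connectionD(1)[OF P] by simp
  show "connection_on U D" if "(U, D) \<in> translate \<Theta> P" for U D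
    using that connection_on_add_tensor[OF projective_connectionD(2)[OF P] tracefree_sym[OF \<Theta>]]
    by (auto simp: translate_eq)
  show "thomas U D c p = thomas U' D' c p"
    if UD: "(U, D) \<in> translate \<Theta> P" "(U', D') \<in> translate \<Theta> P" and p: "p \<in> U" "p \<in> U'"
      and c: "c \<in> A" "p \<in> fst c" for U D U' D' p c
  proof -
    obtain E where E1: "(U, E) \<in> P" "D = add_tensor \<Theta> E"
      using UD(1) by (auto simp: translate_eq)
    obtain E' where E2: "(U', E') \<in> P" "D' = add_tensor \<Theta> E'"
      using UD(2) by (auto simp: translate_eq)
    note E = E1 E2
    show ?thesis
    proof (intro ext)
      fix v w show "thomas U D c p v w = thomas U' D' c p v w"
        unfolding E(2,4) thomas_add_tensor[OF projective_connectionD(2)[OF P E(1)] \<Theta> p(1) c]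
          thomas_add_tensor[OF projective_connectionD(2)[OF P E(3)] \<Theta> p(2) c]
        using projective_connectionD(3)[OF P E(1,3) p c] by simp
    qed
  qed
qed

lemma thomas_at_translate:
  assumes P: "projective_connection A P" and \<Theta>: "\<Theta> \<in> tracefree_tensors A" and c: "c \<in> A" "p \<in> fst c"
  shows "thomas_at (translate \<Theta> P) c p v w = thomas_at P c p v w + comp_in \<Theta> c p v w"
proof -
  have p: "p \<in> carrier_of A" using chart_subset[OF c(1)] c(2) by auto
  obtain U D where U: "(U, D) \<in> P" "p \<in> U" using projective_connection_cover[OF P p] .
  have U': "(U, add_tensor \<Theta> D) \<in> translate \<Theta> P" using U by (auto simp: translate_eq)
  show ?thesis
    unfolding thomas_at_eq[OF projective_connection_translate[OF P \<Theta>] U' U(2) c] thomas_at_eq[OF P U c]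
    by (rule thomas_add_tensor[OF projective_connectionD(2)[OF P U(1)] \<Theta> U(2) c])
qed

text \<open>The tensor in question is the difference of the Thomas symbols, which is a tensor although the
  symbols themselves are not.\<close>

lemma projective_difference_tensor:
  assumes P: "projective_connection A P" and Q: "projective_connection A Q"
  shows "\<exists>\<Theta>\<in>tracefree_tensors A. (translate \<Theta> P, Q) \<in> proj_equiv A"
proof -
  define T where "T c p = (\<lambda>v w. thomas_at Q c p v w - thomas_at P c p v w)" for c p
  define \<Theta> where "\<Theta> = tensor_of A T"
  \<comment> \<open>One pair of connections computes T in all charts and at all nearby points;
    naturality needs the former, holomorphy the latter.\<close>
  have local: "\<exists>U D U' D'. (U, D) \<in> P \<and> (U', D') \<in> Q \<and> p \<in> U \<and> p \<in> U' \<and> connection_on U D \<and> connection_on U' D' \<and>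
      (\<forall>d q. d \<in> A \<and> q \<in> fst d \<and> q \<in> U \<and> q \<in> U' \<longrightarrow>
        T d q = tracefree_part (\<lambda>v w. christoffel U' D' d q v w - christoffel U D d q v w))"
    if c: "c \<in> A" "p \<in> fst c" for c p
  proof -
    have p: "p \<in> carrier_of A" using chart_subset[OF c(1)] c(2) by auto
    obtain U D where U: "(U, D) \<in> P" "p \<in> U" using projective_connection_cover[OF P p] .
    obtain U' D' where U': "(U', D') \<in> Q" "p \<in> U'" using projective_connection_cover[OF Q p] .
    have "T d q = tracefree_part (\<lambda>v w. christoffel U' D' d q v w - christoffel U D d q v w)"
      if "d \<in> A" "q \<in> fst d" "q \<in> U" "q \<in> U'" for d q
      unfolding T_def thomas_at_eq[OF P U(1) that(3,1,2)] thomas_at_eq[OF Q U'(1) that(4,1,2)] thomas_def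
      by (simp add: tracefree_part_diff fun_eq_iff)
    then show ?thesis
      using U U' projective_connectionD(2)[OF P U(1)] projective_connectionD(2)[OF Q U'(1)] by blast
  qed
  have sym: "symbil (T c p)" and tr0: "tr (T c p v) = 0" if c: "c \<in> A" "p \<in> fst c" for c p v
  proof -
    obtain U D U' D' where U: "p \<in> U" "p \<in> U'" "connection_on U D" "connection_on U' D'"
      and T: "T c p = tracefree_part (\<lambda>v w. christoffel U' D' c p v w - christoffel U D c p v w)"
      using local[OF c] c by blast
    have s: "symbil (\<lambda>v w. christoffel U' D' c p v w - christoffel U D c p v w)"
      by (rule symbil_diff[OF christoffel_symbil[OF U(4) c(1) U(2) c(2)] christoffel_symbil[OF U(3) c(1) U(1) c(2)]])
    show "symbil (T c p)" unfolding T by (rule tracefree_part_symbil[OF s])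
    show "tr (T c p v) = 0" unfolding T by (rule tr_tfree[OF s])
  qed
  have nat: "T d p (jac c d p v) (jac c d p w) = jac c d p (T c p v w)"
    if c: "c \<in> A" "p \<in> fst c" and d: "d \<in> A" "p \<in> fst d" for c d p v w
  proof -
    obtain U D U' D' where U: "p \<in> U" "p \<in> U'" "connection_on U D" "connection_on U' D'"
      and T: "\<And>d. d \<in> A \<Longrightarrow> p \<in> fst d \<Longrightarrow> T d p = tracefree_part (\<lambda>v w. christoffel U' D' d p v w - christoffel U D d p v w)"
      using local[OF c] by blast
    show ?thesis
      unfolding T[OF c] T[OF d] tracefree_part_diff
      using thomas_diff_natural[OF U(4,3,2,1) c d] by (simp add: thomas_def)
  qed
  have holo: "\<exists>N. open_in_mfd A N \<and> p \<in> N \<and> (\<forall>v w. holo_map_on (\<lambda>x. T c (param c x) v w) (coord c ` (fst c \<inter> N)))"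
    if c: "c \<in> A" "p \<in> fst c" for c p
  proof -
    obtain U D U' D' where U: "p \<in> U" "p \<in> U'" "connection_on U D" "connection_on U' D'"
      and T: "\<And>q. q \<in> fst c \<Longrightarrow> q \<in> U \<Longrightarrow> q \<in> U' \<Longrightarrow>
        T c q = tracefree_part (\<lambda>v w. christoffel U' D' c q v w - christoffel U D c q v w)"
      using local[OF c] c by blast
    have o: "open_in_mfd A U" "affine_connection A U D" "open_in_mfd A U'" "affine_connection A U' D'"
      using U by (auto simp: connection_on_def)
    let ?N = "U \<inter> U'"
    let ?S = "coord c ` (fst c \<inter> ?N)"
    have N: "open_in_mfd A ?N" by (rule open_mfd_Int[OF o(1,3)])
    have "holo_map_on (\<lambda>x. T c (param c x) v w) ?S" for v w
    proof -
      have C: "holo_map_on (\<lambda>x. christoffel U' D' c (param c x) v w - christoffel U D c (param c x) v w) ?S" for v w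
        by (intro holo_map_on_diff christoffel_holo[OF o(2,1) c(1)] christoffel_holo[OF o(4,3) c(1)]) auto
      have t: "holo_fun_on (\<lambda>x. tr (\<lambda>w. christoffel U' D' c (param c x) v w - christoffel U D c (param c x) v w) / k) ?S" for v k
        unfolding tr_def divide_inverse using C[of v]
        by (intro holo_fun_on_mult holo_fun_on_sum holo_fun_on_const) (auto simp: holo_map_on_def)
      have "holo_map_on (\<lambda>x. tracefree_part (\<lambda>v w. christoffel U' D' c (param c x) v w - christoffel U D c (param c x) v w) v w) ?S"
        unfolding tracefree_part_def by (intro holo_map_on_diff holo_map_on_scale C t holo_map_on_const)
      then show ?thesis
      proof (rule holo_map_on_cong[OF open_coord[OF N c(1)], rotated])
        fix x assume "x \<in> ?S"
        then obtain q where q: "q \<in> fst c" "q \<in> U" "q \<in> U'" "x = coord c q" by auto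
        show "tracefree_part (\<lambda>v w. christoffel U' D' c (param c x) v w - christoffel U D c (param c x) v w) v w = T c (param c x) v w"
          using T[OF q(1-3)] q c by simp
      qed
    qed
    then show ?thesis using N U by blast
  qed
  have ts: "\<Theta> \<in> sym_tensors A"
    unfolding \<Theta>_def by (rule tensor_of_sym_tensor[OF order_refl refl]; (rule sym nat holo; assumption))
  have tc: "comp_in \<Theta> c p = T c p" if "c \<in> A" "p \<in> fst c" for c p
    unfolding \<Theta>_def by (rule tensor_of_comp[OF order_refl refl _ _ _ that]; (rule sym nat holo; assumption))
  have \<Theta>: "\<Theta> \<in> tracefree_tensors A"
    using tracefree_iff[OF ts order_refl refl] tc tr0 by simp
  moreover have "thomas_at (translate \<Theta> P) c p = thomas_at Q c p" if c: "c \<in> A" "p \<in> fst c" for c p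
    using thomas_at_translate[OF P \<Theta> c] tc[OF c] by (simp add: T_def fun_eq_iff)
  ultimately show ?thesis
    using projective_connection_translate[OF P \<Theta>] Q by (auto simp: proj_equiv_iff)
qed

text \<open>\<open>translate_class\<close> is a union over all members of a class. Their translates
  are equivalent to each other because \<open>thomas_at\<close> is shifted by the same amount, so
  the union collapses to one class.\<close>

lemma translate_class_eq:
  assumes P: "projective_connection A P" and \<Theta>: "\<Theta> \<in> tracefree_tensors A"
  shows "translate_class A \<Theta> (proj_equiv A `` {P}) = proj_equiv A `` {translate \<Theta> P}"
proof -
  have "(translate \<Theta> P, translate \<Theta> P') \<in> proj_equiv A" if "(P, P') \<in> proj_equiv A" for P'
  proof -
    have P': "projective_connection A P'" "\<And>c p. c \<in> A \<Longrightarrow> p \<in> fst c \<Longrightarrow> thomas_at P c p = thomas_at P' c p"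
      using that by (simp_all add: proj_equiv_iff)
    have "thomas_at (translate \<Theta> P) c p = thomas_at (translate \<Theta> P') c p" if c: "c \<in> A" "p \<in> fst c" for c p
      by (intro ext) (simp add: thomas_at_translate[OF P \<Theta> c] thomas_at_translate[OF P'(1) \<Theta> c] P'(2)[OF c])
    then show ?thesis
      using projective_connection_translate[OF P \<Theta>] projective_connection_translate[OF P'(1) \<Theta>]
      by (simp add: proj_equiv_iff)
  qed
  then have eq: "proj_equiv A `` {translate \<Theta> P'} = proj_equiv A `` {translate \<Theta> P}" if "(P, P') \<in> proj_equiv A" for P'
    using equiv_class_eq[OF equiv_proj_equiv] that by blast
  have PP: "(P, P) \<in> proj_equiv A" using P by (simp add: proj_equiv_iff)
  have "translate_class A \<Theta> (proj_equiv A `` {P}) = (\<Union>P'\<in>proj_equiv A `` {P}. proj_equiv A `` {translate \<Theta> P'})"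
    by (auto simp: translate_class_def)
  also have "\<dots> = (\<Union>P'\<in>proj_equiv A `` {P}. proj_equiv A `` {translate \<Theta> P})"
    by (intro SUP_cong refl eq) simp
  also have "\<dots> = proj_equiv A `` {translate \<Theta> P}" using PP by blast
  finally show ?thesis .
qed

text \<open>Seen through \<open>thomas_at\<close>, the action is addition of tensor components: the
  action laws and freeness are immediate, and transitivity is
  \<open>projective_difference_tensor\<close>. The connection P0 serves as a base point.\<close>

theorem projective_classes_affine_space:
  assumes P0: "projective_connection A P0"
  shows "affine_space_over (tracefree_tensors A) (translate_class A) (projective_classes A)"
proof -
  let ?R = "proj_equiv A"
  have cls: "\<exists>P. projective_connection A P \<and> s = ?R `` {P}" if "s \<in> projective_classes A" for s
    using that by (auto simp: projective_classes_def elim!: quotientE)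
  have in_cls: "?R `` {P} \<in> projective_classes A" if "projective_connection A P" for P
    using that by (simp add: projective_classes_def quotientI)
  have eq_iff: "?R `` {P} = ?R `` {Q} \<longleftrightarrow> (P, Q) \<in> ?R" if "projective_connection A P" "projective_connection A Q" for P Q
    using eq_equiv_class_iff[OF equiv_proj_equiv] that by simp
  show ?thesis
    unfolding affine_space_over_def
  proof (intro conjI ballI)
    show "projective_classes A \<noteq> {}" using in_cls[OF P0] by blast
  next
    fix \<Theta> s assume \<Theta>: "\<Theta> \<in> tracefree_tensors A" and "s \<in> projective_classes A"
    then obtain P where P: "projective_connection A P" "s = ?R `` {P}" using cls by blast
    show "translate_class A \<Theta> s \<in> projective_classes A"
      unfolding P(2) translate_class_eq[OF P(1) \<Theta>] by (rule in_cls[OF projective_connection_translate[OF P(1) \<Theta>]])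
  next
    fix s assume "s \<in> projective_classes A"
    then obtain P where P: "projective_connection A P" "s = ?R `` {P}" using cls by blast
    show "translate_class A 0 s = s"
      unfolding P(2) translate_class_eq[OF P(1) tracefree_0] by (simp add: translate_def)
  next
    fix \<Theta> \<Theta>' s assume \<Theta>: "\<Theta> \<in> tracefree_tensors A" and \<Theta>': "\<Theta>' \<in> tracefree_tensors A" and "s \<in> projective_classes A"
    then obtain P where P: "projective_connection A P" "s = ?R `` {P}" using cls by blast
    note P' = projective_connection_translate[OF P(1) \<Theta>']
    have "(translate (\<Theta> + \<Theta>') P, translate \<Theta> (translate \<Theta>' P)) \<in> ?R"
      unfolding proj_equiv_iff
    proof (intro conjI ballI ext)
      fix c p v w assume c: "c \<in> A" "p \<in> fst c"
      show "thomas_at (translate (\<Theta> + \<Theta>') P) c p v w = thomas_at (translate \<Theta> (translate \<Theta>' P)) c p v w"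
        unfolding thomas_at_translate[OF P(1) tracefree_add[OF \<Theta> \<Theta>'] c] thomas_at_translate[OF P' \<Theta> c]
          thomas_at_translate[OF P(1) \<Theta>' c] comp_in_add by (simp add: algebra_simps)
    qed (rule projective_connection_translate[OF P(1) tracefree_add[OF \<Theta> \<Theta>']] projective_connection_translate[OF P' \<Theta>])+
    then show "translate_class A (\<Theta> + \<Theta>') s = translate_class A \<Theta> (translate_class A \<Theta>' s)"
      unfolding P(2) translate_class_eq[OF P(1) tracefree_add[OF \<Theta> \<Theta>']] translate_class_eq[OF P(1) \<Theta>']
        translate_class_eq[OF P' \<Theta>] by (rule equiv_class_eq[OF equiv_proj_equiv])
  next
    fix s t assume "s \<in> projective_classes A" "t \<in> projective_classes A"
    then obtain P Q where P: "projective_connection A P" "s = ?R `` {P}" and Q: "projective_connection A Q" "t = ?R `` {Q}"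
      using cls by blast
    obtain \<Theta> where \<Theta>: "\<Theta> \<in> tracefree_tensors A" "(translate \<Theta> P, Q) \<in> ?R"
      using projective_difference_tensor[OF P(1) Q(1)] by blast
    show "\<exists>!v. v \<in> tracefree_tensors A \<and> translate_class A v s = t"
    proof (rule ex1I[of _ \<Theta>])
      show "\<Theta> \<in> tracefree_tensors A \<and> translate_class A \<Theta> s = t"
        unfolding P(2) Q(2) translate_class_eq[OF P(1) \<Theta>(1)] using \<Theta> equiv_class_eq[OF equiv_proj_equiv] by blast
      fix \<Theta>' assume "\<Theta>' \<in> tracefree_tensors A \<and> translate_class A \<Theta>' s = t"
      then have \<Theta>': "\<Theta>' \<in> tracefree_tensors A" "translate_class A \<Theta>' s = t" by auto
      have "?R `` {translate \<Theta>' P} = ?R `` {Q}"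
        using \<Theta>'(2) unfolding P(2) Q(2) translate_class_eq[OF P(1) \<Theta>'(1)] .
      then have "(translate \<Theta>' P, Q) \<in> ?R"
        using eq_iff[OF projective_connection_translate[OF P(1) \<Theta>'(1)] Q(1)] by blast
      with \<Theta>(2) have th: "thomas_at (translate \<Theta>' P) c p = thomas_at (translate \<Theta> P) c p" if "c \<in> A" "p \<in> fst c" for c p
        using that by (simp add: proj_equiv_iff)
      show "\<Theta>' = \<Theta>"
      proof (rule sym_tensor_eqI[OF tracefree_sym[OF \<Theta>'(1)] tracefree_sym[OF \<Theta>(1)] order_refl refl], intro ext)
        fix c p v w assume c: "c \<in> A" "p \<in> fst c"
        show "comp_in \<Theta>' c p v w = comp_in \<Theta> c p v w"
          using thomas_at_translate[OF P(1) \<Theta>'(1) c, of v w] thomas_at_translate[OF P(1) \<Theta>(1) c, of v w] th[OF c]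
          by simp
      qed
    qed
  qed
qed

end

subsection \<open>The lattice\<close>

lemma mat2_eq_iff: "(X :: 'a^2^2) = Y \<longleftrightarrow>
    X $ 1 $ 1 = Y $ 1 $ 1 \<and> X $ 1 $ 2 = Y $ 1 $ 2 \<and> X $ 2 $ 1 = Y $ 2 $ 1 \<and> X $ 2 $ 2 = Y $ 2 $ 2"
  by (auto simp: vec_eq_iff forall_2)

lemma mat2_mult: "(X ** Y) $ r $ s = X $ r $ 1 * Y $ 1 $ s + X $ r $ 2 * Y $ 2 $ s"
  for X Y :: mat2
  by (simp add: matrix_matrix_mult_def sum_2)

lemma mat2_one [simp]: "(mat k :: mat2) $ 1 $ 1 = k" "(mat k :: mat2) $ 1 $ 2 = 0"
    "(mat k :: mat2) $ 2 $ 1 = 0" "(mat k :: mat2) $ 2 $ 2 = k"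
  by (simp_all add: mat_def)

lemmas mat2_simps = mat2_eq_iff mat2_mult mat2_one algebra_simps

lemma mat2_bilinear:
  fixes X Y Z :: mat2
  shows "(X + Y) ** Z = X ** Z + Y ** Z" "X ** (Y + Z) = X ** Y + X ** Z"
    "(k *\<^sub>R X) ** Y = k *\<^sub>R (X ** Y)" "X ** (k *\<^sub>R Y) = k *\<^sub>R (X ** Y)"
    "(- X) ** Y = - (X ** Y)" "X ** (- Y) = - (X ** Y)"
    "mat k ** X = k *\<^sub>R X" "X ** mat k = k *\<^sub>R X"
  by (simp_all add: mat2_simps)

lemma linear_mat2_mult: "linear (\<lambda>X :: mat2. X ** Y)" "linear (\<lambda>X :: mat2. Y ** X)"
  by (auto intro!: linearI simp: mat2_bilinear)

lemma mat2_double_zero: "X + X = 0 \<Longrightarrow> X = 0" for X :: mat2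
  by (simp add: mat2_eq_iff)

text \<open>With X = x i + y, the element j anticommutes with i, so X j + j X = 2 y j.\<close>

lemma quaternion_independent_aux:
  fixes i j :: mat2 and a b x y :: real
  assumes i: "i ** i = a *\<^sub>R mat 1" and j: "j ** j = b *\<^sub>R mat 1" and ij: "i ** j = - (j ** i)"
    and ab: "a \<noteq> 0" "b \<noteq> 0" and eq: "x *\<^sub>R i + y *\<^sub>R mat 1 = 0"
  shows "x = 0 \<and> y = 0"
proof -
  have nz: "j \<noteq> 0" "i \<noteq> 0" using i j ab by (auto simp: mat2_simps)
  define X where "X = x *\<^sub>R i + y *\<^sub>R mat 1"
  have "X = 0" using eq by (simp add: X_def)
  then have "X ** j + j ** X = 0" by (simp add: mat2_simps)
  moreover have "X ** j = - (x *\<^sub>R (j ** i)) + y *\<^sub>R j" "j ** X = x *\<^sub>R (j ** i) + y *\<^sub>R j"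
    by (simp_all add: X_def mat2_bilinear ij)
  ultimately have "y *\<^sub>R j + y *\<^sub>R j = 0" by simp
  then have "y *\<^sub>R j = 0" by (rule mat2_double_zero)
  then have "y = 0" using nz by simp
  then show ?thesis using eq nz by simp
qed

text \<open>Left and right multiplication by i agree on the span of 1 and i and are opposite on the
  span of j and ij; adding and subtracting i X and X i separates the two halves of X.\<close>

lemma quaternion_independent:
  fixes i j :: mat2 and a b :: real
  assumes i: "i ** i = a *\<^sub>R mat 1" and j: "j ** j = b *\<^sub>R mat 1" and ij: "i ** j = - (j ** i)"
    and ab: "a \<noteq> 0" "b \<noteq> 0"
    and eq: "x *\<^sub>R mat 1 + y *\<^sub>R i + z *\<^sub>R j + w *\<^sub>R (i ** j) = 0"
  shows "x = 0 \<and> y = 0 \<and> z = 0 \<and> w = 0"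
proof -
  have iij: "i ** (i ** j) = a *\<^sub>R j" by (simp add: matrix_mul_assoc i mat2_bilinear)
  have ji: "j ** i = - (i ** j)" using ij by simp
  have iji: "(i ** j) ** i = - (a *\<^sub>R j)"
    unfolding matrix_mul_assoc[symmetric] ji by (simp add: mat2_bilinear iij)
  have ijj: "(i ** j) ** j = b *\<^sub>R i"
    unfolding matrix_mul_assoc[symmetric] j by (simp add: mat2_bilinear)
  define X where "X = x *\<^sub>R mat 1 + y *\<^sub>R i + z *\<^sub>R j + w *\<^sub>R (i ** j)"
  have X0: "X = 0" using eq by (simp add: X_def)
  let ?P = "x *\<^sub>R i + (y * a) *\<^sub>R mat 1" and ?Q = "z *\<^sub>R (i ** j) + (w * a) *\<^sub>R j"
  have "i ** X = ?P + ?Q" "X ** i = ?P - ?Q"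
    by (simp_all add: X_def mat2_bilinear i iij iji ji)
  moreover have "i ** X = 0" "X ** i = 0" unfolding X0 by (simp_all add: mat2_simps)
  ultimately have PQ: "?P + ?Q = 0" "?P - ?Q = 0" by simp_all
  have "?P + ?P = (?P + ?Q) + (?P - ?Q)" by simp
  then have P: "?P = 0" unfolding PQ using mat2_double_zero by simp
  then have Q: "?Q = 0" using PQ(1) by simp
  have xy: "x = 0 \<and> y * a = 0" by (rule quaternion_independent_aux[OF i j ij ab P])
  \<comment> \<open>Right multiplication by j moves the second half into the span of i and 1, where
    the two-term case applies again.\<close>
  have "?Q ** j = (z * b) *\<^sub>R i + (w * a * b) *\<^sub>R mat 1"
    by (simp add: mat2_bilinear ijj j)
  then have "(z * b) *\<^sub>R i + (w * a * b) *\<^sub>R mat 1 = 0" unfolding Q by (simp add: mat2_simps)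
  from quaternion_independent_aux[OF i j ij ab this] show ?thesis using xy ab by simp
qed

definition comb :: "(4 \<Rightarrow> mat2) \<Rightarrow> real^4 \<Rightarrow> mat2" where
  "comb e c = (\<Sum>r\<in>UNIV. c $ r *\<^sub>R e r)"

lemma linear_comb: "linear (comb e)"
  by (rule linearI) (simp_all add: comb_def algebra_simps sum.distrib scaleR_sum_right)

lemma comb_mult: "comb e c ** g = (\<Sum>r\<in>UNIV. c $ r *\<^sub>R (e r ** g))" for g :: mat2
  by (simp add: comb_def mat2_bilinear sum_4)

text \<open>A rational basis of B is a real basis of the matrix algebra: 1, i, j, ij are independent
  over the reals, hence span all matrices, and they are combinations of e.\<close>

lemma quaternion_lattice_spans:
  assumes B: "quaternion_division_algebra B"
    and e: "B = {\<Sum>r\<in>UNIV. of_rat (q r) *\<^sub>R e r | q :: 4 \<Rightarrow> rat. True}"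
  shows "surj (comb e)"
proof -
  obtain a b :: rat and i j :: mat2 where ab: "a \<noteq> 0" "b \<noteq> 0"
    and i': "i ** i = mat (of_rat a)" and j': "j ** j = mat (of_rat b)" and ij: "i ** j = - (j ** i)"
    and B': "B = {mat (of_rat x) + of_rat y *\<^sub>R i + of_rat z *\<^sub>R j + of_rat w *\<^sub>R (i ** j) |
             x y z w :: rat. True}"
    using B unfolding quaternion_division_algebra_def by blast
  have i: "i ** i = of_rat a *\<^sub>R mat 1" and j: "j ** j = of_rat b *\<^sub>R mat 1"
    unfolding i' j' by (simp_all add: mat2_eq_iff)
  have inB: "mat (of_rat x) + of_rat y *\<^sub>R i + of_rat z *\<^sub>R j + of_rat w *\<^sub>R (i ** j) \<in> B" for x y z w
    unfolding B' by blast
  have BR: "B \<subseteq> range (comb e)"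
  proof
    fix X assume "X \<in> B"
    then obtain q :: "4 \<Rightarrow> rat" where "X = (\<Sum>r\<in>UNIV. of_rat (q r) *\<^sub>R e r)" using e by blast
    then have "X = comb e (\<chi> r. of_rat (q r))" by (simp add: comb_def)
    then show "X \<in> range (comb e)" by blast
  qed
  have sub: "subspace (range (comb e))"
    by (rule linear_subspace_image[OF linear_comb subspace_UNIV])
  have m: "mat 1 \<in> range (comb e)" "i \<in> range (comb e)" "j \<in> range (comb e)" "i ** j \<in> range (comb e)"
    using inB[of 1 0 0 0] inB[of 0 1 0 0] inB[of 0 0 1 0] inB[of 0 0 0 1] BR by (auto simp: mat2_bilinear)
  define f :: "4 \<Rightarrow> mat2" where "f r = (if r = 1 then mat 1 else if r = 2 then i else if r = 3 then j else i ** j)" for r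
  have f: "comb f c = c $ 1 *\<^sub>R mat 1 + c $ 2 *\<^sub>R i + c $ 3 *\<^sub>R j + c $ 4 *\<^sub>R (i ** j)" for c
    by (simp add: comb_def f_def sum_4)
  have "inj (comb f)"
    unfolding linear_injective_0[OF linear_comb]
  proof (intro allI impI)
    fix c assume "comb f c = 0"
    from quaternion_independent[OF i j ij _ _ this[unfolded f]] ab
    show "c = 0" by (simp add: vec_eq_iff forall_4)
  qed
  \<comment> \<open>Source and target both have real dimension four.\<close>
  then have "surj (comb f)"
    using linear_injective_imp_surjective[OF linear_comb] by simp
  moreover have "comb f c \<in> range (comb e)" for c
    unfolding f by (intro subspace_add[OF sub] subspace_scale[OF sub] m)
  ultimately show ?thesis by (metis UNIV_eq_I surjE)
qed

lemma linear_lattice_coords: "linear (lattice_coords \<alpha>)"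
  unfolding lattice_coords_def by (rule linear_mat2_mult)

lemma surj_lattice_coords:
  assumes "\<alpha> \<noteq> 0" shows "surj (lattice_coords \<alpha>)"
proof (rule surjI)
  fix X :: mat2
  show "lattice_coords \<alpha> (X ** vector [vector [1, 0], vector [0, 1 / \<alpha>]]) = X"
    using assms by (simp add: lattice_coords_def mat2_simps vector_2)
qed

lemma kuga_lattice_basis:
  assumes "kuga_shimura B \<Lambda> \<alpha> \<Gamma>"
  shows "\<exists>e. lattice_coords \<alpha> ` \<Lambda> = {comb e (\<chi> r. of_int (k r)) | k. True} \<and> surj (comb e)"
proof -
  have B: "quaternion_division_algebra B" and \<Lambda>: "lattice_in B \<Lambda>" and \<alpha>: "\<alpha> \<noteq> 0"
    using assms unfolding kuga_shimura_def by blast+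
  obtain e :: "4 \<Rightarrow> mat2" where e: "B = {\<Sum>r\<in>UNIV. of_rat (q r) *\<^sub>R e r | q :: 4 \<Rightarrow> rat. True}"
    "\<Lambda> = {\<Sum>r\<in>UNIV. of_int (k r) *\<^sub>R e r | k :: 4 \<Rightarrow> int. True}"
    using \<Lambda> unfolding lattice_in_def by blast
  let ?E = "\<lambda>r. lattice_coords \<alpha> (e r)"
  have comb: "comb ?E c = lattice_coords \<alpha> (comb e c)" for c
    by (simp add: comb_def linear_sum[OF linear_lattice_coords] linear_scale[OF linear_lattice_coords])
  have "surj (comb ?E)"
    using quaternion_lattice_spans[OF B e(1)] surj_lattice_coords[OF \<alpha>]
    by (metis (no_types, lifting) comb surj_def)
  moreover have "lattice_coords \<alpha> ` \<Lambda> = {comb ?E (\<chi> r. of_int (k r)) | k. True}"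
    unfolding comb e(2) by (auto simp: comb_def)
  ultimately show ?thesis by blast
qed

subsection \<open>The discrete group\<close>

definition mpow :: "mat2 \<Rightarrow> nat \<Rightarrow> mat2" where
  "mpow g n = ((\<lambda>X. X ** g) ^^ n) (mat 1)"

lemma mpow_simps [simp]: "mpow g 0 = mat 1" "mpow g (Suc n) = mpow g n ** g"
  by (simp_all add: mpow_def)

lemma mpow_add: "mpow g (m + n) = mpow g m ** mpow g n"
  by (induction n) (simp_all add: matrix_mul_assoc)

text \<open>Elementary form of the arithmetic data: L is a full lattice in the real 2 x 2 matrices,
  and \<Gamma> is a torsionfree group of matrices of determinant one preserving L from the right.
  The group laws are spelled out in matrix terms.\<close>

locale kuga_group =
  fixes L :: "mat2 set" and e :: "4 \<Rightarrow> mat2" and \<Gamma> :: "mat2 set"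
  assumes L_eq: "L = {comb e (\<chi> r. of_int (k r)) | k. True}"
    and basis: "surj (comb e)"
    and one: "mat 1 \<in> \<Gamma>" and mult: "g \<in> \<Gamma> \<Longrightarrow> h \<in> \<Gamma> \<Longrightarrow> g ** h \<in> \<Gamma>"
    and inverse: "g \<in> \<Gamma> \<Longrightarrow> \<exists>h\<in>\<Gamma>. h ** g = mat 1 \<and> g ** h = mat 1"
    and det1: "g \<in> \<Gamma> \<Longrightarrow> det g = 1"
    and stable: "g \<in> \<Gamma> \<Longrightarrow> X \<in> L \<Longrightarrow> X ** g \<in> L"
    and torsion: "g \<in> \<Gamma> \<Longrightarrow> n > 0 \<Longrightarrow> mpow g n = mat 1 \<Longrightarrow> g = mat 1"

lemma kuga_shimura_group:
  assumes "kuga_shimura B \<Lambda> \<alpha> \<Gamma>"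
  shows "\<exists>e. kuga_group (lattice_coords \<alpha> ` \<Lambda>) e \<Gamma>"
proof -
  define L where "L = lattice_coords \<alpha> ` \<Lambda>"
  obtain e where e: "L = {comb e (\<chi> r. of_int (k r)) | k. True}" "surj (comb e)"
    using kuga_lattice_basis[OF assms] unfolding L_def by blast
  let ?G = "lattice_stabilizer L"
  have sg: "subgroup \<Gamma> ?G" and tor: "\<And>g n. g \<in> \<Gamma> \<Longrightarrow> n > (0::nat) \<Longrightarrow> g [^]\<^bsub>?G\<^esub> n = \<one>\<^bsub>?G\<^esub> \<Longrightarrow> g = \<one>\<^bsub>?G\<^esub>"
    using assms unfolding kuga_shimura_def Let_def L_def by blast+
  have car: "det g = 1" "(\<lambda>X. X ** g) ` L = L" if "g \<in> \<Gamma>" for g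
    using subgroup.subset[OF sg] that by (auto simp: lattice_stabilizer_def)
  have one: "mat 1 \<in> \<Gamma>" using subgroup.one_closed[OF sg] by (simp add: lattice_stabilizer_def)
  have mult: "g ** h \<in> \<Gamma>" if "g \<in> \<Gamma>" "h \<in> \<Gamma>" for g h
    using subgroup.m_closed[OF sg that] by (simp add: lattice_stabilizer_def)
  have inv: "\<exists>h\<in>\<Gamma>. h ** g = mat 1 \<and> g ** h = mat 1" if g: "g \<in> \<Gamma>" for g
  proof -
    \<comment> \<open>The adjugate is the inverse in determinant one. That it preserves L is needed
      to recognize it as the inverse inside the stabilizer, where inverses are definite
      descriptions.\<close>
    define h :: mat2 where "h = vector [vector [g $ 2 $ 2, - g $ 1 $ 2], vector [- g $ 2 $ 1, g $ 1 $ 1]]"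
    have d: "g $ 1 $ 1 * g $ 2 $ 2 - g $ 1 $ 2 * g $ 2 $ 1 = 1" using car(1)[OF g] by (simp add: det_2)
    have hg: "h ** g = mat 1" "g ** h = mat 1"
      using d by (simp_all add: h_def mat2_simps vector_2)
    have "det h = 1" using d by (simp add: h_def det_2 vector_2 algebra_simps)
    moreover have "(\<lambda>X. X ** h) ` L = L"
    proof -
      have "(\<lambda>X. X ** h) ` L = (\<lambda>X. X ** h) ` ((\<lambda>X. X ** g) ` L)" using car(2)[OF g] by simp
      also have "\<dots> = L" by (simp add: image_image matrix_mul_assoc[symmetric] hg)
      finally show ?thesis .
    qed
    ultimately have hG: "h \<in> carrier ?G" by (simp add: lattice_stabilizer_def)
    have "inv\<^bsub>?G\<^esub> g = h"
      unfolding m_inv_def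
    proof (rule the_equality)
      show "h \<in> carrier ?G \<and> g \<otimes>\<^bsub>?G\<^esub> h = \<one>\<^bsub>?G\<^esub> \<and> h \<otimes>\<^bsub>?G\<^esub> g = \<one>\<^bsub>?G\<^esub>"
        using hG hg by (simp add: lattice_stabilizer_def)
      fix y assume "y \<in> carrier ?G \<and> g \<otimes>\<^bsub>?G\<^esub> y = \<one>\<^bsub>?G\<^esub> \<and> y \<otimes>\<^bsub>?G\<^esub> g = \<one>\<^bsub>?G\<^esub>"
      then have y: "g ** y = mat 1" by (simp add: lattice_stabilizer_def)
      have "y = (h ** g) ** y" by (simp add: hg)
      also have "\<dots> = h ** (g ** y)" by (simp add: matrix_mul_assoc)
      finally show "y = h" by (simp add: y)
    qed
    then have "h \<in> \<Gamma>" using subgroup.m_inv_closed[OF sg g] by simp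
    then show ?thesis using hg by blast
  qed
  have pow: "g [^]\<^bsub>?G\<^esub> n = mpow g n" for g and n :: nat
    by (induction n) (simp_all add: nat_pow_def lattice_stabilizer_def)
  have "kuga_group L e \<Gamma>"
  proof
    show "X ** g \<in> L" if "g \<in> \<Gamma>" "X \<in> L" for g X using car(2)[OF that(1)] that(2) by blast
    show "g = mat 1" if "g \<in> \<Gamma>" "n > 0" "mpow g n = mat 1" for g n
      using tor[OF that(1,2)] that(3) pow by (simp add: lattice_stabilizer_def)
  qed (use e one mult inv car in auto)
  then show ?thesis unfolding L_def by blast
qed

section \<open>Moebius transformations of the upper half plane\<close>

lemma aut_factor_nonzero:
  assumes "det g = 1" "\<tau> \<in> upper_half_plane"
  shows "aut_factor g \<tau> \<noteq> 0"
proof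
  assume "aut_factor g \<tau> = 0"
  then have "g $ 2 $ 1 * Im \<tau> = 0" "g $ 2 $ 1 * Re \<tau> + g $ 2 $ 2 = 0"
    by (auto simp: aut_factor_def complex_eq_iff)
  then show False using assms by (auto simp: upper_half_plane_def det_2)
qed

lemma Im_moebius:
  assumes "det g = 1" "\<tau> \<in> upper_half_plane"
  shows "Im (moebius g \<tau>) = Im \<tau> / (cmod (aut_factor g \<tau>))\<^sup>2"
proof -
  have d: "g $ 1 $ 1 * g $ 2 $ 2 = 1 + g $ 1 $ 2 * g $ 2 $ 1" using assms(1) by (simp add: det_2)
  have c: "(cmod (aut_factor g \<tau>))\<^sup>2 = (g $ 2 $ 1 * Re \<tau> + g $ 2 $ 2)\<^sup>2 + (g $ 2 $ 1 * Im \<tau>)\<^sup>2"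
    by (simp add: cmod_power2 aut_factor_def)
  have "Im (moebius g \<tau>) = (g $ 1 $ 1 * g $ 2 $ 2 * Im \<tau> - g $ 1 $ 2 * g $ 2 $ 1 * Im \<tau>) / (cmod (aut_factor g \<tau>))\<^sup>2"
    unfolding c by (simp add: moebius_def Im_divide aut_factor_def algebra_simps)
  then show ?thesis unfolding d by (simp add: algebra_simps)
qed

lemma moebius_upper_half_plane:
  assumes "det g = 1" "\<tau> \<in> upper_half_plane"
  shows "moebius g \<tau> \<in> upper_half_plane"
  using Im_moebius[OF assms] aut_factor_nonzero[OF assms] assms(2) by (simp add: upper_half_plane_def)

lemma aut_factor_mult:
  assumes "det h = 1" "\<tau> \<in> upper_half_plane"
  shows "aut_factor (g ** h) \<tau> = aut_factor g (moebius h \<tau>) * aut_factor h \<tau>"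
  using aut_factor_nonzero[OF assms]
  by (simp add: aut_factor_def[of "g ** h"] aut_factor_def[of g] moebius_def mat2_mult field_simps)
    (simp add: aut_factor_def algebra_simps)

lemma moebius_mult:
  assumes "det g = 1" "det h = 1" "\<tau> \<in> upper_half_plane"
  shows "moebius (g ** h) \<tau> = moebius g (moebius h \<tau>)"
proof -
  note nz = aut_factor_nonzero[OF assms(2,3)] aut_factor_nonzero[OF assms(1) moebius_upper_half_plane[OF assms(2,3)]]
  have "(of_real ((g ** h) $ 1 $ 1) * \<tau> + of_real ((g ** h) $ 1 $ 2)) =
      (of_real (g $ 1 $ 1) * moebius h \<tau> + of_real (g $ 1 $ 2)) * aut_factor h \<tau>"
    using nz(1) by (simp add: moebius_def[of h] mat2_mult field_simps) (simp add: aut_factor_def algebra_simps)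
  then show ?thesis
    using nz by (simp add: moebius_def[of "g ** h"] moebius_def[of g] aut_factor_mult[OF assms(2,3)])
qed

lemma moebius_one [simp]: "moebius (mat 1) \<tau> = \<tau>" "aut_factor (mat 1) \<tau> = 1"
  by (simp_all add: moebius_def aut_factor_def)

lemma open_upper_half_plane: "open upper_half_plane"
  unfolding upper_half_plane_def by (rule open_halfspace_Im_gt)

lemma holomorphic_moebius:
  assumes "det g = 1"
  shows "moebius g holomorphic_on upper_half_plane"
proof -
  have "aut_factor g holomorphic_on upper_half_plane"
    unfolding aut_factor_def by (intro holomorphic_intros)
  then show ?thesis
    unfolding moebius_def using aut_factor_nonzero[OF assms] by (intro holomorphic_intros) auto
qed

text \<open>Properness of the action. Comparing imaginary parts bounds the automorphy factor j and
  with it the bottom row of g; then the product of j with the image point bounds the top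
  row.\<close>

lemma moebius_bounded:
  assumes \<tau>: "\<tau>0 \<in> upper_half_plane"
  shows "\<exists>R. \<forall>g \<tau>. det g = 1 \<longrightarrow> dist \<tau>0 \<tau> < Im \<tau>0 / 2 \<longrightarrow> dist \<tau>0 (moebius g \<tau>) < Im \<tau>0 / 2 \<longrightarrow> norm g \<le> R"
proof -
  define y where "y = Im \<tau>0"
  define M where "M = cmod \<tau>0 + y / 2"
  have y: "y > 0" using \<tau> by (simp add: y_def upper_half_plane_def)
  then have M: "M \<ge> 0" by (simp add: M_def)
  \<comment> \<open>Sum of the bounds for the four entries, from \<open>lin\<close> with t = 2 M for
    the top row and t = 2 for the bottom row.\<close>
  define R where "R = 4 * M / y + (2 * M + 4 * M * M / y) + 4 / y + (2 + 4 * M / y)"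
  have "norm g \<le> R" if g: "det g = 1" and d: "dist \<tau>0 \<tau> < y / 2" "dist \<tau>0 (moebius g \<tau>) < y / 2" for g \<tau>
  proof -
    have near: "Im s > y / 2 \<and> Im s < 2 * y \<and> cmod s \<le> M" if "dist \<tau>0 s < y / 2" for s
    proof -
      have "\<bar>Im \<tau>0 - Im s\<bar> < y / 2"
        using abs_Im_le_cmod[of "\<tau>0 - s"] that by (simp add: dist_norm)
      moreover have "cmod s \<le> cmod \<tau>0 + cmod (\<tau>0 - s)"
        using norm_triangle_ineq4[of \<tau>0 "\<tau>0 - s"] by simp
      moreover have "cmod (\<tau>0 - s) < y / 2" using that by (simp add: dist_norm)
      ultimately show ?thesis unfolding y_def[symmetric] M_def by linarith
    qed
    note n = near[OF d(1)] near[OF d(2)]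
    then have H: "\<tau> \<in> upper_half_plane" using y by (auto simp: upper_half_plane_def)
    let ?j = "aut_factor g \<tau>"
    have "Im (moebius g \<tau>) * (cmod ?j)\<^sup>2 = Im \<tau>"
      using Im_moebius[OF g H] aut_factor_nonzero[OF g H] by (simp add: field_simps)
    moreover have "y / 2 * (cmod ?j)\<^sup>2 \<le> Im (moebius g \<tau>) * (cmod ?j)\<^sup>2"
      using n by (intro mult_right_mono) auto
    ultimately have "y * (cmod ?j)\<^sup>2 \<le> Im \<tau> * 2" by (simp add: field_simps)
    \<comment> \<open>In the disc of radius y / 2 imaginary parts lie between y / 2 and 2 y, so
      their quotient is at most 4.\<close>
    then have "y * (cmod ?j)\<^sup>2 \<le> y * 4" using n by linarith
    then have "(cmod ?j)\<^sup>2 \<le> 2\<^sup>2" using y by simp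
    then have j: "cmod ?j \<le> 2" by (rule power2_le_imp_le) simp
    \<comment> \<open>The imaginary part of p \<tau> + q controls p because \<tau> stays away from
      the real axis; then q is controlled by the triangle inequality.\<close>
    have lin: "\<bar>p\<bar> \<le> 2 * t / y \<and> \<bar>q\<bar> \<le> t + 2 * t / y * M"
      if "cmod (of_real p * \<tau> + of_real q) \<le> t" for p q t :: real
    proof -
      have t: "t \<ge> 0" using that norm_ge_zero order_trans by blast
      have "\<bar>p\<bar> * Im \<tau> \<le> t"
        using abs_Im_le_cmod[of "of_real p * \<tau> + of_real q"] that n y by (simp add: abs_mult)
      moreover have "\<bar>p\<bar> * (y / 2) \<le> \<bar>p\<bar> * Im \<tau>" using n by (intro mult_left_mono) auto
      ultimately have p: "\<bar>p\<bar> \<le> 2 * t / y" using y by (simp add: field_simps)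
      have "\<bar>q\<bar> = cmod (of_real p * \<tau> + of_real q - of_real p * \<tau>)" by simp
      also have "\<dots> \<le> t + \<bar>p\<bar> * cmod \<tau>"
        using norm_triangle_ineq4[of "of_real p * \<tau> + of_real q" "of_real p * \<tau>"] that by (simp add: norm_mult)
      also have "\<dots> \<le> t + 2 * t / y * M" using p n t y by (intro add_left_mono mult_mono) auto
      finally show ?thesis using p by simp
    qed
    have cd: "\<bar>g $ 2 $ 1\<bar> \<le> 2 * 2 / y" "\<bar>g $ 2 $ 2\<bar> \<le> 2 + 2 * 2 / y * M"
      using lin[of "g $ 2 $ 1" "g $ 2 $ 2" 2] j by (auto simp: aut_factor_def)
    have "of_real (g $ 1 $ 1) * \<tau> + of_real (g $ 1 $ 2) = moebius g \<tau> * ?j"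
      using aut_factor_nonzero[OF g H] by (simp add: moebius_def)
    then have "cmod (of_real (g $ 1 $ 1) * \<tau> + of_real (g $ 1 $ 2)) \<le> M * 2"
      using n j M by (auto simp: norm_mult intro!: mult_mono)
    from lin[OF this] have ab: "\<bar>g $ 1 $ 1\<bar> \<le> 2 * (M * 2) / y" "\<bar>g $ 1 $ 2\<bar> \<le> M * 2 + 2 * (M * 2) / y * M" by auto
    have "norm g \<le> norm (g $ 1) + norm (g $ 2)"
      unfolding norm_vec_def[of g] using L2_set_le_sum[of UNIV "\<lambda>i. norm (g $ i)"] by (simp add: sum_2)
    also have "norm (g $ 1) \<le> \<bar>g $ 1 $ 1\<bar> + \<bar>g $ 1 $ 2\<bar>"
      using norm_le_l1_cart[of "g $ 1"] by (simp add: sum_2)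
    also have "norm (g $ 2) \<le> \<bar>g $ 2 $ 1\<bar> + \<bar>g $ 2 $ 2\<bar>"
      using norm_le_l1_cart[of "g $ 2"] by (simp add: sum_2)
    finally have "norm g \<le> \<bar>g $ 1 $ 1\<bar> + \<bar>g $ 1 $ 2\<bar> + (\<bar>g $ 2 $ 1\<bar> + \<bar>g $ 2 $ 2\<bar>)" by simp
    then show ?thesis using ab cd by (simp add: R_def mult_ac)
  qed
  then show ?thesis by (auto simp: y_def)
qed

section \<open>Discreteness of the lattice and proper discontinuity of the group\<close>

context kuga_group
begin

lemma coords_exist: "\<exists>C K. linear C \<and> (\<forall>X. comb e (C X) = X) \<and> (\<forall>c. C (comb e c) = c) \<and> K > 0 \<and> (\<forall>X. norm (C X) \<le> K * norm X)"
proof -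
  obtain C where C: "linear C" "\<forall>c. C (comb e c) = c" "\<forall>X. comb e (C X) = X"
    using linear_surjective_isomorphism[OF linear_comb basis] by auto
  obtain K where "K > 0" "\<forall>X. norm (C X) \<le> K * norm X"
    using linear_bounded_pos[OF C(1)] by auto
  then show ?thesis using C by blast
qed

text \<open>In coordinates with respect to e, lattice points of bounded norm are bounded integer
  vectors.\<close>

lemma finite_lattice_ball: "finite {X \<in> L. norm X \<le> R}"
proof -
  obtain C K where C: "\<forall>c. C (comb e c) = c" and K: "K > 0" "\<forall>X. norm (C X) \<le> K * norm X"
    using coords_exist by blast
  define N where "N = \<lceil>K * R\<rceil>"
  let ?F = "{k :: 4 \<Rightarrow> int. range k \<subseteq> {-N..N}}"
  have "{X \<in> L. norm X \<le> R} \<subseteq> (\<lambda>k. comb e (\<chi> r. of_int (k r))) ` ?F"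
  proof
    fix X assume X: "X \<in> {X \<in> L. norm X \<le> R}"
    then obtain k where k: "X = comb e (\<chi> r. of_int (k r))" using L_eq by auto
    have "k r \<in> {-N..N}" for r
    proof -
      have "\<bar>real_of_int (k r)\<bar> \<le> norm (C X)"
        using component_le_norm_cart[of "C X" r] C k by simp
      also have "\<dots> \<le> K * norm X" using K(2) by blast
      also have "\<dots> \<le> K * R" using X K(1) by (intro mult_left_mono) auto
      finally have "\<bar>real_of_int (k r)\<bar> \<le> of_int N" unfolding N_def by linarith
      then show ?thesis by auto
    qed
    then show "X \<in> (\<lambda>k. comb e (\<chi> r. of_int (k r))) ` ?F" using k by auto
  qed
  moreover have "finite ?F"
  proof -
    have "?F = PiE UNIV (\<lambda>_. {-N..N})" by (auto simp: PiE_def)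
    then show ?thesis by (simp add: finite_PiE)
  qed
  ultimately show ?thesis by (meson finite_imageI finite_subset)
qed

lemma comb_in_L: "comb e (\<chi> r. of_int (k r)) \<in> L"
  unfolding L_eq by blast

lemma basis_in_L: "e r \<in> L"
proof -
  have "comb e (\<chi> s. of_int (if s = r then 1 else 0)) = (\<Sum>s\<in>UNIV. if s = r then e s else 0)"
    unfolding comb_def by (intro sum.cong) auto
  then show ?thesis using comb_in_L[of "\<lambda>s. if s = r then 1 else 0"] by simp
qed

text \<open>Discreteness of \<Gamma>: g is determined by the images of the basis e, and these are
  lattice points in a bounded ball.\<close>

lemma finite_bounded: "finite {g \<in> \<Gamma>. norm g \<le> R}"
proof -
  have "\<exists>M. \<forall>g :: mat2. norm (e r ** g) \<le> M * norm g" for r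
    using linear_bounded[OF linear_mat2_mult(2)[of "e r"]] by blast
  then obtain M where M: "\<And>r (g :: mat2). norm (e r ** g) \<le> M r * norm g" by metis
  define S where "S r = {X \<in> L. norm X \<le> \<bar>M r\<bar> * \<bar>R\<bar>}" for r
  let ?f = "\<lambda>g r. e r ** g"
  have "?f ` {g \<in> \<Gamma>. norm g \<le> R} \<subseteq> PiE UNIV S"
  proof
    fix h assume "h \<in> ?f ` {g \<in> \<Gamma>. norm g \<le> R}"
    then obtain g where g: "g \<in> \<Gamma>" "norm g \<le> R" "h = ?f g" by auto
    have "h r \<in> S r" for r
    proof -
      have "norm (e r ** g) \<le> M r * norm g" by (rule M)
      also have "\<dots> \<le> \<bar>M r\<bar> * \<bar>R\<bar>" using g by (intro mult_mono) auto
      finally show ?thesis using g stable[OF g(1) basis_in_L] by (simp add: S_def)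
    qed
    then show "h \<in> PiE UNIV S" by auto
  qed
  moreover have "finite (PiE UNIV S)"
    by (rule finite_PiE) (auto simp: S_def finite_lattice_ball)
  ultimately have "finite (?f ` {g \<in> \<Gamma>. norm g \<le> R})" by (rule finite_subset)
  moreover have "inj_on ?f {g \<in> \<Gamma>. norm g \<le> R}"
  proof (rule inj_onI)
    fix g h :: mat2 assume "?f g = ?f h"
    then have eq: "e r ** g = e r ** h" for r by meson
    have "comb e c ** g = comb e c ** h" for c
      unfolding comb_mult eq ..
    moreover obtain c where "comb e c = mat 1" using basis by (metis surjD)
    ultimately show "g = h" by (metis matrix_mul_lid)
  qed
  ultimately show ?thesis by (rule finite_imageD)
qed

lemma zero_in_L: "0 \<in> L"
  using comb_in_L[of "\<lambda>r. 0"] by (simp add: comb_def)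

lemma add_in_L: assumes "X \<in> L" "Y \<in> L" shows "X + Y \<in> L"
proof -
  obtain k l where "X = comb e (\<chi> r. of_int (k r))" "Y = comb e (\<chi> r. of_int (l r))"
    using assms L_eq by auto
  then have "X + Y = comb e (\<chi> r. of_int (k r + l r))"
    by (simp add: comb_def sum.distrib algebra_simps)
  then show ?thesis using comb_in_L[of "\<lambda>r. k r + l r"] by simp
qed

lemma minus_in_L: assumes "X \<in> L" shows "- X \<in> L"
proof -
  obtain k where "X = comb e (\<chi> r. of_int (k r))" using assms L_eq by auto
  then have "- X = comb e (\<chi> r. of_int (- k r))"
    by (simp add: comb_def sum_negf)
  then show ?thesis using comb_in_L[of "\<lambda>r. - k r"] by simp
qed

lemma lattice_discrete: "\<exists>\<eta>>0. \<forall>X\<in>L. norm X < \<eta> \<longrightarrow> X = 0"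
proof -
  obtain C K where C: "\<forall>X. comb e (C X) = X" "\<forall>c. C (comb e c) = c" and K: "K > 0" "\<forall>X. norm (C X) \<le> K * norm X"
    using coords_exist by blast
  have "X = 0" if X: "X \<in> L" "norm X < 1 / K" for X
  proof -
    obtain k where k: "X = comb e (\<chi> r. of_int (k r))" using X L_eq by auto
    have "k r = 0" for r
    proof -
      have "\<bar>real_of_int (k r)\<bar> \<le> norm (C X)"
        using component_le_norm_cart[of "C X" r] C k by simp
      also have "\<dots> \<le> K * norm X" using K(2) by blast
      also have "\<dots> < 1" using X K(1) by (simp add: field_simps)
      finally show ?thesis by linarith
    qed
    then show ?thesis using k by (simp add: comb_def)
  qed
  then show ?thesis using K(1) by (intro exI[of _ "1 / K"]) auto
qed

lemma mpow_in: "g \<in> \<Gamma> \<Longrightarrow> mpow g n \<in> \<Gamma>"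
  by (induction n) (auto intro: one mult)

text \<open>All powers of g fix \<tau> as well, so they are bounded in norm and hence finite in
  number; g has finite order, which torsion-freeness forbids unless g is the identity.\<close>

lemma stabilizer_trivial:
  assumes "g \<in> \<Gamma>" "\<tau> \<in> upper_half_plane" "moebius g \<tau> = \<tau>"
  shows "g = mat 1"
proof -
  obtain R where R': "\<forall>g \<tau>'. det g = 1 \<longrightarrow> dist \<tau> \<tau>' < Im \<tau> / 2 \<longrightarrow>
      dist \<tau> (moebius g \<tau>') < Im \<tau> / 2 \<longrightarrow> norm g \<le> R"
    using moebius_bounded[OF assms(2)] by blast
  have R: "norm g \<le> R" if "det g = 1" "moebius g \<tau> = \<tau>" for g
    using R'[rule_format, of g \<tau>] that assms(2) by (simp add: upper_half_plane_def)
  have fix_pow: "moebius (mpow g n) \<tau> = \<tau>" for n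
    by (induction n) (simp_all add: moebius_mult det1 mpow_in assms)
  have "range (mpow g) \<subseteq> {g \<in> \<Gamma>. norm g \<le> R}"
    using R mpow_in[OF assms(1)] det1 fix_pow by blast
  then have "finite (range (mpow g))" using finite_bounded finite_subset by blast
  then have "\<not> inj (mpow g)" using finite_imageD by blast
  then obtain m n where mn: "m < n" "mpow g m = mpow g n"
    unfolding inj_def by (metis linorder_neqE_nat)
  obtain h where h: "h ** mpow g m = mat 1" using inverse[OF mpow_in[OF assms(1)]] by blast
  have "mpow g n = mpow g m ** mpow g (n - m)" using mn(1) mpow_add[of g m "n - m"] by simp
  then have "h ** mpow g m = (h ** mpow g m) ** mpow g (n - m)" using mn(2) by (metis matrix_mul_assoc)
  then have "mpow g (n - m) = mat 1" using h by simp
  then show ?thesis using torsion[OF assms(1), of "n - m"] mn(1) by simp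
qed

text \<open>Only finitely many elements can return a point of a small disc to that disc. Each one
  except the identity moves \<tau>0 and is avoided by shrinking the neighbourhood.\<close>

lemma discontinuous:
  assumes \<tau>: "\<tau>0 \<in> upper_half_plane"
  shows "\<exists>N. open N \<and> \<tau>0 \<in> N \<and> N \<subseteq> upper_half_plane \<and> (\<forall>g\<in>\<Gamma>. \<forall>\<tau>\<in>N. moebius g \<tau> \<in> N \<longrightarrow> g = mat 1)"
proof -
  obtain R where R: "\<And>g \<tau>. det g = 1 \<Longrightarrow> dist \<tau>0 \<tau> < Im \<tau>0 / 2 \<Longrightarrow> dist \<tau>0 (moebius g \<tau>) < Im \<tau>0 / 2 \<Longrightarrow> norm g \<le> R"
    using moebius_bounded[OF \<tau>] by blast
  define F where "F = {g \<in> \<Gamma>. norm g \<le> R} - {mat 1}"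
  have F: "finite F" using finite_bounded by (simp add: F_def)
  have "\<exists>N. open N \<and> \<tau>0 \<in> N \<and> (\<forall>\<tau>\<in>N. \<tau> \<in> upper_half_plane \<longrightarrow> moebius g \<tau> \<notin> N)" if g: "g \<in> F" for g
  proof -
    have g': "g \<in> \<Gamma>" "g \<noteq> mat 1" using g by (auto simp: F_def)
    then have ne: "moebius g \<tau>0 \<noteq> \<tau>0" using stabilizer_trivial \<tau> by blast
    then obtain U V where UV: "open U" "open V" "moebius g \<tau>0 \<in> U" "\<tau>0 \<in> V" "U \<inter> V = {}"
      using hausdorff by metis
    have cont: "continuous_on upper_half_plane (moebius g)"
      by (rule holomorphic_on_imp_continuous_on[OF holomorphic_moebius[OF det1[OF g'(1)]]])
    have "open (upper_half_plane \<inter> moebius g -` U)"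
      by (rule continuous_open_preimage[OF cont open_upper_half_plane UV(1)])
    then show ?thesis
      using UV \<tau> by (intro exI[of _ "V \<inter> (upper_half_plane \<inter> moebius g -` U)"]) auto
  qed
  then obtain N where N: "\<And>g. g \<in> F \<Longrightarrow> open (N g) \<and> \<tau>0 \<in> N g \<and> (\<forall>\<tau>\<in>N g. \<tau> \<in> upper_half_plane \<longrightarrow> moebius g \<tau> \<notin> N g)"
    by metis
  define N0 where "N0 = ball \<tau>0 (Im \<tau>0 / 2) \<inter> upper_half_plane \<inter> (\<Inter>g\<in>F. N g)"
  have "open N0" unfolding N0_def using F N open_upper_half_plane by (intro open_Int open_INT) auto
  moreover have "\<tau>0 \<in> N0" using \<tau> N by (auto simp: N0_def upper_half_plane_def)
  moreover have "g = mat 1" if "g \<in> \<Gamma>" "\<tau> \<in> N0" "moebius g \<tau> \<in> N0" for g \<tau>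
  proof (rule ccontr)
    assume "g \<noteq> mat 1"
    then have "g \<in> F" using R[OF det1[OF that(1)], of \<tau>] that by (auto simp: F_def N0_def)
    then show False using N that by (auto simp: N0_def)
  qed
  ultimately show ?thesis by (intro exI[of _ N0]) (auto simp: N0_def)
qed

end

text \<open>The connection differentiates components in d. On fields constant in c, these components
  vary only through the Jacobian, which leaves the second derivative of the transition map, carried
  back to c.\<close>

lemma (in complex_manifold) christoffel_std_conn_transition:
  assumes c: "c \<in> A" "p \<in> fst c" and d: "d \<in> A" "p \<in> fst d"
  shows "christoffel (fst d) (std_conn d) c p v w =
    jac d c p (fd (\<lambda>x. fd (transition c d) x w) (coord c p) v)"
proof -
  let ?V = "fst d \<inter> fst c" and ?X = "const_field c (fst d \<inter> fst c) v" and ?Y = "const_field c (fst d \<inter> fst c) w"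
  have o: "open_in_mfd A (fst d)" "open_in_mfd A (fst c)" using open_mfd_chart c d by auto
  have V: "open_in_mfd A ?V" by (rule open_mfd_Int[OF o])
  have sub: "?V \<subseteq> fst d" "?V \<subseteq> fst c" by auto
  have p: "p \<in> ?V" using c d by simp
  have XY: "?X \<in> vector_fields A ?V" "?Y \<in> vector_fields A ?V"
    by (rule const_field_vector_field[OF V sub(2) c(1)])+
  have t: "std_conn d ?V ?X ?Y p \<in> tangent_space A p"
    by (rule vector_fieldsD(1)[OF std_conn_vector_field[OF d(1) V sub(1) XY] p])
  have "christoffel (fst d) (std_conn d) c p v w = std_conn d ?V ?X ?Y p c"
    by (rule connection_const_fields[symmetric, OF affine_connection_std_conn[OF d(1)] o(1) V sub c(1) p])
  also have "\<dots> = jac d c p (std_conn d ?V ?X ?Y p d)"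
    by (rule tangent_jac[OF t d c])
  also have "std_conn d ?V ?X ?Y p d = fd (\<lambda>x. ?Y (param d x) d) (coord d p) (jac c d p v)"
    using p d c by (simp add: std_conn_apply vec_of_apply)
  also have "\<dots> = fd (\<lambda>x. fd (transition c d) x (?Y p c)) (coord c p) v + jac c d p (fd (\<lambda>x. ?Y (param c x) c) (coord c p) v)"
    by (rule fd_component_transition[OF V XY(2) p c(2) d(2) c(1) d(1)])
  also have "\<dots> = fd (\<lambda>x. fd (transition c d) x w) (coord c p) v"
    using fd_const_field[OF V sub(2) c(1) p] p c jac_works(4)[OF c(1) d(1) c(2) d(2)] by simp
  finally show ?thesis .
qed

subsection \<open>The action on \<open>\<H> \<times> \<complex>\<^sup>2\<close>\<close>

lemma vec3_eq_iff: "(x :: 'a^3) = y \<longleftrightarrow> x $ 1 = y $ 1 \<and> x $ 2 = y $ 2 \<and> x $ 3 = y $ 3"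
  by (auto simp: vec_eq_iff forall_3)

text \<open>Takes the matrix already multiplied into the form
  \<open>lattice_coords \<alpha> l\<close>, so that \<alpha> no longer occurs.\<close>

definition act :: "mat2 \<Rightarrow> mat2 \<Rightarrow> complex^3 \<Rightarrow> complex^3" where
  "act g l x = vector
     [moebius g (x $ 1),
      (x $ 2 + of_real (l $ 1 $ 1) * x $ 1 + of_real (l $ 1 $ 2)) / aut_factor g (x $ 1),
      (x $ 3 + of_real (l $ 2 $ 1) * x $ 1 + of_real (l $ 2 $ 2)) / aut_factor g (x $ 1)]"

lemma act_nth [simp]:
  "act g l x $ 1 = moebius g (x $ 1)"
  "act g l x $ 2 = (x $ 2 + of_real (l $ 1 $ 1) * x $ 1 + of_real (l $ 1 $ 2)) / aut_factor g (x $ 1)"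
  "act g l x $ 3 = (x $ 3 + of_real (l $ 2 $ 1) * x $ 1 + of_real (l $ 2 $ 2)) / aut_factor g (x $ 1)"
  by (simp_all add: act_def vector_3)

lemma kuga_action_eq: "kuga_action \<alpha> g l = act g (lattice_coords \<alpha> l)"
  by (simp add: kuga_action_def act_def Let_def fun_eq_iff)

lemma kuga_cover_iff: "x \<in> kuga_cover \<longleftrightarrow> x $ 1 \<in> upper_half_plane"
  by (simp add: kuga_cover_def)

lemma open_kuga_cover: "open kuga_cover"
proof -
  have "kuga_cover = (\<lambda>x. x $ 1) -` upper_half_plane" by (auto simp: kuga_cover_iff)
  then show ?thesis
    using open_vimage[OF open_upper_half_plane, of "\<lambda>x :: complex^3. x $ 1"] by (simp add: continuous_on_component)
qed

lemma act_cover: "det g = 1 \<Longrightarrow> x \<in> kuga_cover \<Longrightarrow> act g l x \<in> kuga_cover"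
  by (simp add: kuga_cover_iff moebius_upper_half_plane)

lemma act_one: "act (mat 1) 0 x = x"
  by (simp add: vec3_eq_iff)

text \<open>The semidirect product law, resting on l (h\<tau>, 1) = (l h) (\<tau>, 1) / j(h, \<tau>)
  for column vectors.\<close>

lemma act_act:
  assumes "det g = 1" "det h = 1" "x \<in> kuga_cover"
  shows "act g l (act h m x) = act (g ** h) (m + l ** h) x"
proof -
  have x: "x $ 1 \<in> upper_half_plane" using assms by (simp add: kuga_cover_iff)
  let ?j = "aut_factor h (x $ 1)" and ?k = "aut_factor g (moebius h (x $ 1))"
  have nz: "?j \<noteq> 0" "?k \<noteq> 0"
    using aut_factor_nonzero[OF assms(2) x] aut_factor_nonzero[OF assms(1) moebius_upper_half_plane[OF assms(2) x]] by auto
  have *: "((z + of_real (m $ r $ 1) * x $ 1 + of_real (m $ r $ 2)) / ?j + of_real (l $ r $ 1) * moebius h (x $ 1) + of_real (l $ r $ 2)) / ?k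
     = (z + of_real ((m + l ** h) $ r $ 1) * x $ 1 + of_real ((m + l ** h) $ r $ 2)) / aut_factor (g ** h) (x $ 1)" for z r
  proof -
    have "of_real (l $ r $ 1) * moebius h (x $ 1) + of_real (l $ r $ 2) =
        (of_real ((l ** h) $ r $ 1) * x $ 1 + of_real ((l ** h) $ r $ 2)) / ?j"
      using nz(1) by (simp add: moebius_def mat2_mult field_simps) (simp add: aut_factor_def algebra_simps)
    then have "(z + of_real (m $ r $ 1) * x $ 1 + of_real (m $ r $ 2)) / ?j + of_real (l $ r $ 1) * moebius h (x $ 1) + of_real (l $ r $ 2)
      = (z + of_real ((m + l ** h) $ r $ 1) * x $ 1 + of_real ((m + l ** h) $ r $ 2)) / ?j"
      by (simp add: add.assoc add_divide_distrib algebra_simps)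
    then show ?thesis unfolding aut_factor_mult[OF assms(2) x] by (simp add: mult.commute)
  qed
  show ?thesis
    by (simp only: vec3_eq_iff act_nth * moebius_mult[OF assms(1,2) x] simp_thms)
qed

text \<open>Quotient rule for an affine map divided by c \<tau> + d: the subtracted term is the
  derivative of the denominator times the quotient itself.\<close>

definition dact :: "mat2 \<Rightarrow> mat2 \<Rightarrow> complex^3 \<Rightarrow> complex^3 \<Rightarrow> complex^3" where
  "dact g l x v = (1 / aut_factor g (x $ 1)) *s
     (vector [of_real (g $ 1 $ 1) * v $ 1, v $ 2 + of_real (l $ 1 $ 1) * v $ 1, v $ 3 + of_real (l $ 2 $ 1) * v $ 1]
      - (of_real (g $ 2 $ 1) * v $ 1) *s act g l x)"

text \<open>Covers all components of the action: \<epsilon> = 0 gives the Moebius transformation and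
  \<epsilon> = 1 the two fibre components.\<close>

lemma has_derivative_projective_component:
  fixes x :: "complex^'n"
  assumes "\<gamma> * x $ i + \<delta> \<noteq> 0"
  shows "((\<lambda>x. (\<epsilon> * x $ k + \<alpha> * x $ i + \<beta>) / (\<gamma> * x $ i + \<delta>)) has_derivative
    (\<lambda>v. (1 / (\<gamma> * x $ i + \<delta>)) * (\<epsilon> * v $ k + \<alpha> * v $ i - \<gamma> * v $ i * ((\<epsilon> * x $ k + \<alpha> * x $ i + \<beta>) / (\<gamma> * x $ i + \<delta>))))) (at x)"
proof -
  have n: "((\<lambda>x :: complex^'n. x $ j) has_derivative (\<lambda>v. v $ j)) (at x)" for j
    by (rule bounded_linear.has_derivative[OF bounded_linear_vec_nth has_derivative_ident])
  show ?thesis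
    by (rule derivative_eq_intros n refl | rule assms)+ (use assms in \<open>simp add: fun_eq_iff field_simps\<close>)
qed

lemma has_derivative_act:
  assumes "det g = 1" "x \<in> kuga_cover"
  shows "(act g l has_derivative dact g l x) (at x)"
proof (rule fd_vec)
  fix i :: 3
  have nz: "of_real (g $ 2 $ 1) * x $ 1 + of_real (g $ 2 $ 2) \<noteq> (0 :: complex)"
    using aut_factor_nonzero[OF assms(1), of "x $ 1"] assms(2) by (simp add: kuga_cover_iff aut_factor_def)
  note d = has_derivative_projective_component[OF nz, unfolded aut_factor_def[symmetric]]
  consider "i = 1" | "i = 2" | "i = 3" using exhaust_3 by blast
  then show "((\<lambda>x. act g l x $ i) has_derivative (\<lambda>v. dact g l x v $ i)) (at x)"
  proof cases
    case 1
    show ?thesis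
      using d[of 0 1 "of_real (g $ 1 $ 1)" "of_real (g $ 1 $ 2)"]
      by (simp add: 1 dact_def vector_3 moebius_def diff_divide_distrib)
  next
    case 2
    show ?thesis
      using d[of 1 2 "of_real (l $ 1 $ 1)" "of_real (l $ 1 $ 2)"]
      by (simp add: 2 dact_def vector_3 diff_divide_distrib)
  next
    case 3
    show ?thesis
      using d[of 1 3 "of_real (l $ 2 $ 1)" "of_real (l $ 2 $ 2)"]
      by (simp add: 3 dact_def vector_3 diff_divide_distrib)
  qed
qed

lemma dact_clin: "clin (dact g l x)"
  by (simp add: clin_def dact_def vec3_eq_iff vector_3 algebra_simps)

lemma holo_act: "det g = 1 \<Longrightarrow> holo_map_on (act g l) kuga_cover"
  unfolding holo_map_on_def
proof (intro allI holo_fun_onI)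
  fix i x assume g: "det g = 1" and x: "x \<in> kuga_cover"
  show "((\<lambda>x. act g l x $ i) has_derivative (\<lambda>v. dact g l x v $ i)) (at x)"
    using bounded_linear.has_derivative[OF bounded_linear_vec_nth has_derivative_act[OF g x]] .
  show "dact g l x (k *s v) $ i = k * dact g l x v $ i" for k v
    using dact_clin[of g l x] by (simp add: clin_def)
qed

text \<open>Determinant one gives a - c (g \<tau>) = 1 / j. Thus d\<tau> scales by the square of 1 /
  j and vertical vectors by 1 / j; these exponents produce the weight of the modular forms.\<close>

lemma dact_nth:
  assumes "det g = 1" "x \<in> kuga_cover"
  shows "dact g l x v $ 1 = v $ 1 / (aut_factor g (x $ 1))\<^sup>2"
    "v $ 1 = 0 \<Longrightarrow> dact g l x v = (1 / aut_factor g (x $ 1)) *s v"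
proof -
  let ?j = "aut_factor g (x $ 1)"
  have nz: "?j \<noteq> 0" using aut_factor_nonzero[OF assms(1)] assms(2) by (simp add: kuga_cover_iff)
  have d: "complex_of_real (g $ 1 $ 1) * of_real (g $ 2 $ 2) - of_real (g $ 1 $ 2) * of_real (g $ 2 $ 1) = 1"
    using assms(1) by (simp add: det_2 flip: of_real_mult of_real_diff)
  have "of_real (g $ 1 $ 1) - of_real (g $ 2 $ 1) * moebius g (x $ 1) = 1 / ?j"
    using nz d by (simp add: moebius_def field_simps) (simp add: aut_factor_def algebra_simps)
  then have "dact g l x v $ 1 = (1 / ?j) * (v $ 1 * (1 / ?j))"
    by (simp add: dact_def vector_3 algebra_simps flip: right_diff_distrib)
  then show "dact g l x v $ 1 = v $ 1 / ?j\<^sup>2" by (simp add: power2_eq_square)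
  show "dact g l x v = (1 / ?j) *s v" if "v $ 1 = 0"
    using that by (simp add: dact_def vec3_eq_iff vector_3)
qed

text \<open>With \<open>j = c \<tau> + d\<close> the map \<open>j \<cdot> act\<close> is affine, so differentiating it twice expresses the second
  derivative of \<open>act\<close> through its first derivative: \<open>act\<close> is a projective transformation.\<close>

lemma fd_dact:
  assumes "det g = 1" "x \<in> kuga_cover"
  shows "fd (\<lambda>y. dact g l y w) x v =
    (- of_real (g $ 2 $ 1) * v $ 1 / aut_factor g (x $ 1)) *s dact g l x w +
    (- of_real (g $ 2 $ 1) * w $ 1 / aut_factor g (x $ 1)) *s dact g l x v"
proof -
  let ?j = "\<lambda>y :: complex^3. aut_factor g (y $ 1)"
  let ?u = "vector [of_real (g $ 1 $ 1) * w $ 1, w $ 2 + of_real (l $ 1 $ 1) * w $ 1, w $ 3 + of_real (l $ 2 $ 1) * w $ 1] :: complex^3"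
  let ?c = "of_real (g $ 2 $ 1) :: complex"
  let ?G = "\<lambda>y. ?u - (?c * w $ 1) *s act g l y"
  have nz: "?j y \<noteq> 0" if "y \<in> kuga_cover" for y
    using aut_factor_nonzero[OF assms(1)] that by (simp add: kuga_cover_iff)
  have dj: "((\<lambda>y. 1 / ?j y) has_derivative (\<lambda>v. - ?c * v $ 1 / (?j y)\<^sup>2)) (at y)" if "y \<in> kuga_cover" for y
  proof -
    have n: "((\<lambda>x :: complex^3. x $ 1) has_derivative (\<lambda>v. v $ 1)) (at y)"
      by (rule bounded_linear.has_derivative[OF bounded_linear_vec_nth has_derivative_ident])
    have "(?j has_derivative (\<lambda>v. ?c * v $ 1)) (at y)"
      unfolding aut_factor_def by (rule derivative_eq_intros n refl)+ simp
    from has_derivative_divide[OF has_derivative_const[of 1] this nz[OF that]]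
    show ?thesis by (simp add: power2_eq_square divide_inverse mult_ac)
  qed
  have hj: "holo_fun_on (\<lambda>y. 1 / ?j y) kuga_cover"
    by (rule holo_fun_onI[OF dj]) (simp_all add: mult_ac)
  have hG: "holo_map_on ?G kuga_cover"
    by (intro holo_map_on_diff holo_map_on_scale holo_map_on_const holo_fun_on_const holo_act[OF assms(1)])
  have fG: "fd ?G x v = - (?c * w $ 1) *s dact g l x v"
  proof -
    have "((\<lambda>y. (?c * w $ 1) *s act g l y) has_derivative (\<lambda>v. (?c * w $ 1) *s dact g l x v)) (at x)"
      by (rule fd_vec, simp, rule has_derivative_mult_right,
          rule bounded_linear.has_derivative[OF bounded_linear_vec_nth has_derivative_act[OF assms]])
    from has_derivative_diff[OF has_derivative_const[of ?u] this]
    have "(?G has_derivative (\<lambda>v. 0 - (?c * w $ 1) *s dact g l x v)) (at x)" .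
    from fun_cong[OF fd_eqI[OF this], of v] show ?thesis by (simp add: vec_eq_iff)
  qed
  have "fd (\<lambda>y. dact g l y w) x v = fd (\<lambda>y. (1 / ?j y) *s ?G y) x v"
    by (simp only: dact_def)
  also have "\<dots> = fd (\<lambda>y. 1 / ?j y) x v *s ?G x + (1 / ?j x) *s fd ?G x v"
    by (rule fd_map_scale[OF hj hG assms(2)])
  also have "fd (\<lambda>y. 1 / ?j y) x v = - ?c * v $ 1 / (?j x)\<^sup>2"
    using fun_cong[OF fd_eqI[OF dj[OF assms(2)]], of v] .
  also have "(- ?c * v $ 1 / (?j x)\<^sup>2) *s ?G x = (- ?c * v $ 1 / ?j x) *s dact g l x w"
    by (simp add: dact_def power2_eq_square vector_smult_assoc)
  finally show ?thesis unfolding fG by (simp add: vector_smult_assoc mult_ac)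
qed

subsection \<open>The threefold\<close>

context kuga_group
begin

definition orb :: "complex^3 \<Rightarrow> (complex^3) set" where
  "orb x = {act g l x | g l. g \<in> \<Gamma> \<and> l \<in> L}"

lemma orb_self: "x \<in> orb x"
  unfolding orb_def by (intro CollectI exI conjI) (rule act_one[symmetric], rule one, rule zero_in_L)

lemma act_inverse:
  assumes "g \<in> \<Gamma>" "l \<in> L"
  shows "\<exists>h\<in>\<Gamma>. \<exists>m\<in>L. \<forall>x\<in>kuga_cover. act h m (act g l x) = x"
proof -
  obtain h where h: "h \<in> \<Gamma>" "h ** g = mat 1" "g ** h = mat 1" using inverse[OF assms(1)] by blast
  have "l + (- (l ** h)) ** g = 0"
    by (simp add: mat2_bilinear matrix_mul_assoc[symmetric] h)
  then have "act h (- (l ** h)) (act g l x) = x" if "x \<in> kuga_cover" for x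
    using act_act[OF det1[OF h(1)] det1[OF assms(1)] that] h by (simp add: act_one)
  then show ?thesis using h minus_in_L[OF stable[OF h(1) assms(2)]] by blast
qed

lemma orb_act:
  assumes "g \<in> \<Gamma>" "l \<in> L" "x \<in> kuga_cover"
  shows "orb (act g l x) = orb x"
proof -
  have sub: "orb (act g l x) \<subseteq> orb x" if "g \<in> \<Gamma>" "l \<in> L" "x \<in> kuga_cover" for g l x
  proof
    fix y assume "y \<in> orb (act g l x)"
    then obtain h m where h: "h \<in> \<Gamma>" "m \<in> L" "y = act h m (act g l x)" by (auto simp: orb_def)
    then have "y = act (h ** g) (l + m ** g) x"
      using act_act[OF det1[OF h(1)] det1[OF that(1)] that(3)] by simp
    moreover have "h ** g \<in> \<Gamma>" "l + m ** g \<in> L"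
      using mult[OF h(1) that(1)] add_in_L[OF that(2) stable[OF that(1) h(2)]] by auto
    ultimately show "y \<in> orb x" by (auto simp: orb_def)
  qed
  obtain h m where h: "h \<in> \<Gamma>" "m \<in> L" "act h m (act g l x) = x"
    using act_inverse[OF assms(1,2)] assms(3) by blast
  show ?thesis
    using sub[OF assms] sub[OF h(1,2) act_cover[OF det1[OF assms(1)] assms(3)], of l] h(3) by auto
qed

lemma orb_eqD:
  assumes "orb x = orb y"
  shows "\<exists>g\<in>\<Gamma>. \<exists>l\<in>L. y = act g l x"
proof -
  have "y \<in> orb x" using orb_self[of y] assms by simp
  then show ?thesis by (auto simp: orb_def)
qed

definition chart_dom :: "(complex^3) set \<Rightarrow> bool" where
  "chart_dom W \<longleftrightarrow> open W \<and> W \<subseteq> kuga_cover \<and> inj_on orb W"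

text \<open>On a region with Im \<tau> bounded below and \<tau> bounded, the displacement controls
  the matrix uniformly: imaginary parts bound the first column of l, and then the second
  follows.\<close>

lemma small_fibre_displacement:
  assumes y: "Im \<tau> > y" "y > 0" "cmod \<tau> \<le> M" and "\<eta> > 0"
  shows "\<exists>\<delta>>0. \<forall>\<tau> (l :: mat2). Im \<tau> > y \<longrightarrow> cmod \<tau> \<le> M \<longrightarrow>
    (\<forall>r. cmod (of_real (l $ r $ 1) * \<tau> + of_real (l $ r $ 2)) \<le> \<delta>) \<longrightarrow> norm l < \<eta>"
proof -
  have M: "M \<ge> 0" using y(3) norm_ge_zero order_trans by blast
  \<comment> \<open>Displacements of size d force the norm of l to be at most d Q; the choice d =
    \<eta> / (2 Q) keeps it at \<eta> / 2.\<close>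
  define Q where "Q = 2 * (1 / y + (1 + M / y))"
  have Q: "Q > 0" using y M by (auto simp: Q_def intro!: add_pos_nonneg)
  have "norm l < \<eta>" if t: "Im \<tau> > y" "cmod \<tau> \<le> M"
    and b: "\<And>r. cmod (of_real (l $ r $ 1) * \<tau> + of_real (l $ r $ 2)) \<le> \<eta> / (2 * Q)" for \<tau> and l :: mat2
  proof -
    define d where "d = \<eta> / (2 * Q)"
    note b = b[folded d_def]
    have d: "d > 0" "d * Q = \<eta> / 2" using Q \<open>\<eta> > 0\<close> by (simp_all add: d_def)
    have row: "norm (l $ r) \<le> d / y + (d + d / y * M)" for r
    proof -
      have "\<bar>l $ r $ 1\<bar> * Im \<tau> \<le> d"
        using abs_Im_le_cmod[of "of_real (l $ r $ 1) * \<tau> + of_real (l $ r $ 2)"] b[of r] t y by (simp add: abs_mult)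
      moreover have "\<bar>l $ r $ 1\<bar> * y \<le> \<bar>l $ r $ 1\<bar> * Im \<tau>" using t by (intro mult_left_mono) auto
      ultimately have "\<bar>l $ r $ 1\<bar> * y \<le> d" by linarith
      then have p: "\<bar>l $ r $ 1\<bar> \<le> d / y" using y by (subst pos_le_divide_eq) auto
      have "\<bar>l $ r $ 2\<bar> = cmod (of_real (l $ r $ 1) * \<tau> + of_real (l $ r $ 2) - of_real (l $ r $ 1) * \<tau>)" by simp
      also have "\<dots> \<le> d + \<bar>l $ r $ 1\<bar> * cmod \<tau>"
        using norm_triangle_ineq4[of "of_real (l $ r $ 1) * \<tau> + of_real (l $ r $ 2)" "of_real (l $ r $ 1) * \<tau>"] b[of r]
        by (simp add: norm_mult)
      also have "\<dots> \<le> d + d / y * M" using p t y d by (intro add_left_mono mult_mono) auto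
      finally show ?thesis using p norm_le_l1_cart[of "l $ r"] by (simp add: sum_2)
    qed
    have "norm l \<le> norm (l $ 1) + norm (l $ 2)"
      unfolding norm_vec_def[of l] using L2_set_le_sum[of UNIV "\<lambda>i. norm (l $ i)"] by (simp add: sum_2)
    also have "\<dots> \<le> 2 * (d / y + (d + d / y * M))" unfolding mult_2 by (rule add_mono[OF row row])
    also have "\<dots> = d * Q" by (simp add: Q_def algebra_simps)
    also have "\<dots> < \<eta>" using d \<open>\<eta> > 0\<close> by simp
    finally show ?thesis .
  qed
  then show ?thesis using Q \<open>\<eta> > 0\<close> by (intro exI[of _ "\<eta> / (2 * Q)"]) auto
qed

text \<open>Proper discontinuity on the base leaves only lattice translations, and a translation
  between nearby points is too short to be nonzero. The clause on first coordinates alone later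
  identifies the fibres inside a chart with the slices of constant \<tau>.\<close>

lemma chart_dom_neighbourhood:
  assumes x: "x \<in> kuga_cover"
  shows "\<exists>W. chart_dom W \<and> x \<in> W \<and> (\<forall>g\<in>\<Gamma>. \<forall>y\<in>W. moebius g (y $ 1) \<in> (\<lambda>y. y $ 1) ` W \<longrightarrow> g = mat 1)"
proof -
  define \<tau>0 where "\<tau>0 = x $ 1"
  have \<tau>0: "\<tau>0 \<in> upper_half_plane" using x by (simp add: kuga_cover_iff \<tau>0_def)
  then have pos: "Im \<tau>0 > 0" by (simp add: upper_half_plane_def)
  obtain N where N: "open N" "\<tau>0 \<in> N" "N \<subseteq> upper_half_plane"
    "\<And>g \<tau>. g \<in> \<Gamma> \<Longrightarrow> \<tau> \<in> N \<Longrightarrow> moebius g \<tau> \<in> N \<Longrightarrow> g = mat 1"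
    using discontinuous[OF \<tau>0] by blast
  obtain \<eta> where \<eta>: "\<eta> > 0" "\<And>X. X \<in> L \<Longrightarrow> norm X < \<eta> \<Longrightarrow> X = 0" using lattice_discrete by blast
  define M where "M = cmod \<tau>0 + 1"
  obtain \<delta> where \<delta>: "\<delta> > 0" "\<And>\<tau> (l :: mat2). Im \<tau> > Im \<tau>0 / 2 \<Longrightarrow> cmod \<tau> \<le> M \<Longrightarrow>
    (\<And>r. cmod (of_real (l $ r $ 1) * \<tau> + of_real (l $ r $ 2)) \<le> \<delta>) \<Longrightarrow> norm l < \<eta>"
    using small_fibre_displacement[of "Im \<tau>0 / 2" \<tau>0 M \<eta>] pos \<eta>(1) by (auto simp: M_def)
  \<comment> \<open>\<delta> / 2 bounds the displacement between two points of the ball by \<delta>,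
    Im \<tau>0 / 2 keeps away from the real axis, and 1 matches the bound M.\<close>
  define \<epsilon> where "\<epsilon> = min (\<delta> / 2) (min (Im \<tau>0 / 2) 1)"
  have \<epsilon>: "\<epsilon> > 0" using \<delta> pos by (simp add: \<epsilon>_def)
  define W where "W = ball x \<epsilon> \<inter> (\<lambda>y. y $ 1) -` N"
  have "open ((\<lambda>y :: complex^3. y $ 1) -` N)"
    using open_vimage[OF N(1), of "\<lambda>y :: complex^3. y $ 1"] by (simp add: continuous_on_component)
  then have oW: "open W" unfolding W_def by (intro open_Int) auto
  have xW: "x \<in> W" using \<epsilon> N(2) by (simp add: W_def \<tau>0_def)
  have WX: "W \<subseteq> kuga_cover" using N(3) by (auto simp: W_def kuga_cover_iff)
  have WN: "y $ 1 \<in> N" if "y \<in> W" for y using that by (simp add: W_def)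
  have near: "cmod (y $ i - x $ i) < \<epsilon>" if "y \<in> W" for y i
    using that Finite_Cartesian_Product.norm_nth_le[of "y - x" i] by (simp add: W_def dist_norm norm_minus_commute)
  have inj: "inj_on orb W"
  proof (rule inj_onI)
    fix y z assume yz: "y \<in> W" "z \<in> W" "orb y = orb z"
    obtain g l where g: "g \<in> \<Gamma>" "l \<in> L" "z = act g l y" using orb_eqD[OF yz(3)] by blast
    have g1: "g = mat 1" using N(4)[OF g(1) WN[OF yz(1)]] WN[OF yz(2)] g(3) by simp
    have "norm l < \<eta>"
    proof (rule \<delta>(2))
      have c: "cmod (y $ 1 - \<tau>0) < \<epsilon>" using near[OF yz(1), of 1] by (simp add: \<tau>0_def)
      then have "\<bar>Im (y $ 1) - Im \<tau>0\<bar> < Im \<tau>0 / 2"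
        using abs_Im_le_cmod[of "y $ 1 - \<tau>0"] by (simp add: \<epsilon>_def)
      then show "Im (y $ 1) > Im \<tau>0 / 2" unfolding abs_less_iff by linarith
      show "cmod (y $ 1) \<le> M"
        using c norm_triangle_ineq2[of "y $ 1" \<tau>0] by (simp add: M_def \<epsilon>_def)
      fix r :: 2
      have diff: "cmod (z $ i - y $ i) \<le> \<delta>" for i
      proof -
        have "cmod (z $ i - y $ i) \<le> cmod (z $ i - x $ i) + cmod (y $ i - x $ i)"
          using norm_triangle_ineq4[of "z $ i - x $ i" "y $ i - x $ i"] by simp
        then show ?thesis using near[OF yz(1), of i] near[OF yz(2), of i] by (simp add: \<epsilon>_def)
      qed
      have "of_real (l $ 1 $ 1) * y $ 1 + of_real (l $ 1 $ 2) = z $ 2 - y $ 2"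
        "of_real (l $ 2 $ 1) * y $ 1 + of_real (l $ 2 $ 2) = z $ 3 - y $ 3"
        by (simp_all add: g(3) g1)
      then show "cmod (of_real (l $ r $ 1) * y $ 1 + of_real (l $ r $ 2)) \<le> \<delta>"
        using diff exhaust_2[of r] by auto
    qed
    then have "l = 0" using \<eta>(2)[OF g(2)] by simp
    then show "y = z" using g(3) g1 act_one by simp
  qed
  have "g = mat 1" if h: "g \<in> \<Gamma>" "y \<in> W" "moebius g (y $ 1) \<in> (\<lambda>y. y $ 1) ` W" for g y
  proof -
    obtain z where "z \<in> W" "moebius g (y $ 1) = z $ 1" using h(3) by auto
    then show ?thesis using N(4)[OF h(1) WN[OF h(2)]] WN[of z] by simp
  qed
  then show ?thesis
    using oW WX inj xW by (intro exI[of _ W]) (simp add: chart_dom_def)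
qed

definition chart_of :: "(complex^3) set \<Rightarrow> ((complex^3) set, 3) chart" where
  "chart_of W = (orb ` W, inv_into W orb)"

lemma fst_chart_of [simp]: "fst (chart_of W) = orb ` W"
  by (simp add: chart_of_def)

lemma coord_chart_of [simp]: "chart_dom W \<Longrightarrow> x \<in> W \<Longrightarrow> coord (chart_of W) (orb x) = x"
  by (simp add: coord_def chart_of_def chart_dom_def)

lemma chart_of_inj: "inj_on (coord (chart_of W)) (orb ` W)"
  by (simp add: coord_def chart_of_def inj_on_inv_into)

lemma param_chart_of [simp]: "chart_dom W \<Longrightarrow> x \<in> W \<Longrightarrow> param (chart_of W) x = orb x"
  using param_coord_inj[of "chart_of W" "orb x"] chart_of_inj[of W] by simp

lemma coord_image_chart_of: "chart_dom W \<Longrightarrow> coord (chart_of W) ` (orb ` W \<inter> S) = {x \<in> W. orb x \<in> S}"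
  by (auto simp: image_iff) (metis IntI coord_chart_of imageI)+

text \<open>Only a local statement is possible, as different components of an overlap may be related
  by different group elements.\<close>

lemma chart_of_transition_local:
  assumes W: "chart_dom W" "x \<in> W" and W': "chart_dom W'" "act g l x \<in> W'" and g: "g \<in> \<Gamma>" "l \<in> L"
  shows "\<exists>U. open U \<and> x \<in> U \<and> U \<subseteq> W \<and>
    (\<forall>y\<in>U. orb y \<in> orb ` W' \<and> transition (chart_of W) (chart_of W') y = act g l y)"
proof -
  let ?U = "W \<inter> (kuga_cover \<inter> act g l -` W')"
  have "open (kuga_cover \<inter> act g l -` W')"
    by (rule continuous_open_preimage[OF holo_map_on_imp_continuous[OF holo_act[OF det1[OF g(1)]]] open_kuga_cover])
      (use W' in \<open>simp add: chart_dom_def\<close>)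
  then have "open ?U" using W by (auto simp: chart_dom_def intro: open_Int)
  moreover have "x \<in> ?U" using W W' by (auto simp: chart_dom_def)
  moreover have "orb y \<in> orb ` W' \<and> transition (chart_of W) (chart_of W') y = act g l y" if y: "y \<in> ?U" for y
  proof -
    have e: "orb (act g l y) = orb y" by (rule orb_act[OF g]) (use y in simp)
    then have "coord (chart_of W') (orb y) = act g l y"
      using coord_chart_of[OF W'(1), of "act g l y"] y by simp
    then show ?thesis using y W(1) e by (auto simp: transition_def intro: rev_image_eqI)
  qed
  ultimately show ?thesis by blast
qed

definition atlas0 :: "((complex^3) set, 3) chart set" where
  "atlas0 = chart_of ` Collect chart_dom"

lemma complex_manifold_atlas0: "complex_manifold atlas0"
proof
  fix c d assume "c \<in> atlas0" "d \<in> atlas0"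
  then obtain W W' where W: "chart_dom W" "c = chart_of W" and W': "chart_dom W'" "d = chart_of W'"
    by (auto simp: atlas0_def)
  have img: "coord c ` (fst c \<inter> fst d) = {x \<in> W. orb x \<in> orb ` W'}"
    using coord_image_chart_of[OF W(1)] by (simp add: W W')
  have loc: "\<exists>U. open U \<and> x \<in> U \<and> U \<subseteq> {x \<in> W. orb x \<in> orb ` W'} \<and> holo_map_on (transition c d) U"
    if x: "x \<in> W" "orb x \<in> orb ` W'" for x
  proof -
    obtain y where y: "y \<in> W'" "orb x = orb y" using x by auto
    obtain g l where g: "g \<in> \<Gamma>" "l \<in> L" "y = act g l x" using orb_eqD[OF y(2)] by blast
    obtain U where U: "open U" "x \<in> U" "U \<subseteq> W" "\<And>y. y \<in> U \<Longrightarrow> orb y \<in> orb ` W'"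
      "\<And>y. y \<in> U \<Longrightarrow> transition c d y = act g l y"
      using chart_of_transition_local[OF W(1) x(1) W'(1), of g l] g y W W' by blast
    have "U \<subseteq> kuga_cover" using U(3) W(1) by (auto simp: chart_dom_def)
    then have "holo_map_on (transition c d) U"
      by (intro holo_map_on_cong[OF U(1) _ holo_map_on_subset[OF holo_act[OF det1[OF g(1)]]]]) (simp add: U(5))
    then show ?thesis using U by blast
  qed
  show "open (coord c ` (fst c \<inter> fst d))"
    unfolding img by (subst open_subopen) (use loc in blast)
  show "holo_map_on (transition c d) (coord c ` (fst c \<inter> fst d))"
    unfolding img by (rule holo_map_on_local) (use loc in blast)
qed (auto simp: atlas0_def chart_of_inj)

definition manifold :: "((complex^3) set, 3) chart set" where
  "manifold = maximal_atlas atlas0"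

sublocale complex_manifold manifold
  unfolding manifold_def by (rule maximal_atlas_manifold[OF complex_manifold_atlas0])

lemma atlas0_subset: "atlas0 \<subseteq> manifold"
  unfolding manifold_def by (rule maximal_atlas_superset[OF complex_manifold_atlas0])

lemma chart_of_in [simp]: "chart_dom W \<Longrightarrow> chart_of W \<in> manifold"
  using atlas0_subset by (auto simp: atlas0_def)

lemma carrier_atlas0: "carrier_of atlas0 = carrier_of manifold"
  unfolding manifold_def by (rule maximal_atlas_carrier[OF complex_manifold_atlas0, symmetric])

lemma jac_chart_of:
  assumes W: "chart_dom W" "x \<in> W" and W': "chart_dom W'" "act g l x \<in> W'" and g: "g \<in> \<Gamma>" "l \<in> L"
  shows "jac (chart_of W) (chart_of W') (orb x) = dact g l x"
    "fd (\<lambda>y. fd (transition (chart_of W) (chart_of W')) y w) x v = fd (\<lambda>y. dact g l y w) x v"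
proof -
  obtain U where U: "open U" "x \<in> U" "U \<subseteq> W"
    "\<And>y. y \<in> U \<Longrightarrow> transition (chart_of W) (chart_of W') y = act g l y"
    using chart_of_transition_local[OF assms] by blast
  have UX: "U \<subseteq> kuga_cover" using U W by (auto simp: chart_dom_def)
  have d: "fd (transition (chart_of W) (chart_of W')) y = dact g l y" if y: "y \<in> U" for y
  proof -
    have "fd (transition (chart_of W) (chart_of W')) y = fd (act g l) y"
      by (rule fd_cong[OF U(1) y U(4)])
    also have "\<dots> = dact g l y"
      by (rule fd_eqI[OF has_derivative_act[OF det1[OF g(1)]]]) (use UX y in auto)
    finally show ?thesis .
  qed
  show "jac (chart_of W) (chart_of W') (orb x) = dact g l x"
    using d[OF U(2)] W by (simp add: jac_def)
  show "fd (\<lambda>y. fd (transition (chart_of W) (chart_of W')) y w) x v = fd (\<lambda>y. dact g l y w) x v"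
    by (rule fun_cong[OF fd_cong[OF U(1,2)]]) (simp add: d)
qed

text \<open>The origin of the affine space: all other projective connections are measured against
  it.\<close>

definition std_pconn :: "((complex^3) set, 3) pconn" where
  "std_pconn = {(orb ` W, std_conn (chart_of W)) | W. chart_dom W}"

text \<open>By \<open>fd_dact\<close> the second derivative of a transition, pulled back by its
  Jacobian, is \<theta>(v) w + \<theta>(w) v, and such a term has no trace-free part.\<close>

lemma thomas_std_pconn:
  assumes W: "chart_dom W" "x \<in> W" and W': "chart_dom W'" "orb x \<in> orb ` W'"
  shows "thomas (orb ` W') (std_conn (chart_of W')) (chart_of W) (orb x) v w = 0"
proof -
  let ?c = "chart_of W" and ?d = "chart_of W'" and ?p = "orb x"
  obtain y where y: "y \<in> W'" "orb x = orb y" using W' by auto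
  obtain g l where g: "g \<in> \<Gamma>" "l \<in> L" "y = act g l x" using orb_eqD[OF y(2)] by blast
  have gx: "act g l x \<in> W'" using g y by simp
  have xX: "x \<in> kuga_cover" using W by (auto simp: chart_dom_def)
  let ?\<theta> = "\<lambda>v :: complex^3. - of_real (g $ 2 $ 1) * v $ 1 / aut_factor g (x $ 1)"
  have c: "?c \<in> manifold" "?p \<in> fst ?c" and d: "?d \<in> manifold" "?p \<in> fst ?d" using W W' by auto
  have J: "jac ?d ?c ?p (dact g l x v) = v" for v
    using jac_inv[OF c d, of v] jac_chart_of(1)[OF W W'(1) gx g(1,2)] by simp
  have "christoffel (orb ` W') (std_conn ?d) ?c ?p v w = ?\<theta> v *s w + ?\<theta> w *s v" for v w
  proof -
    have "christoffel (fst ?d) (std_conn ?d) ?c ?p v w = jac ?d ?c ?p (fd (\<lambda>y. dact g l y w) x v)"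
      unfolding christoffel_std_conn_transition[OF c d] coord_chart_of[OF W]
        jac_chart_of(2)[OF W W'(1) gx g(1,2)] ..
    also have "\<dots> = ?\<theta> v *s w + ?\<theta> w *s v"
      unfolding fd_dact[OF det1[OF g(1)] xX] jac_works(3)[OF d(1) c(1) d(2) c(2)]
        jac_works(2)[OF d(1) c(1) d(2) c(2)] J ..
    finally show ?thesis by simp
  qed
  then show ?thesis
    unfolding thomas_def by (rule tracefree_part_projective[of ?\<theta>, rotated -1]) (simp_all add: algebra_simps add_divide_distrib diff_divide_distrib)
qed

lemma projective_connection_std_pconn: "projective_connection manifold std_pconn"
proof (rule projective_connectionI)
  have "\<Union> (fst ` std_pconn) = carrier_of atlas0"
    by (auto simp: std_pconn_def carrier_of_def atlas0_def)
  then show "\<Union> (fst ` std_pconn) = carrier_of manifold" by (simp add: carrier_atlas0)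
  show "connection_on U D" if "(U, D) \<in> std_pconn" for U D
    using that connection_on_std_conn[OF chart_of_in] by (auto simp: std_pconn_def)
  fix U D U' D' p c
  assume "(U, D) \<in> std_pconn" "(U', D') \<in> std_pconn" and p: "p \<in> U" "p \<in> U'" and c: "c \<in> manifold" "p \<in> fst c"
  then obtain W W' where W: "chart_dom W" "U = orb ` W" "D = std_conn (chart_of W)"
    and W': "chart_dom W'" "U' = orb ` W'" "D' = std_conn (chart_of W')" by (auto simp: std_pconn_def)
  obtain x where x: "x \<in> W" "p = orb x" using p(1) W by auto
  have "thomas U D (chart_of W) p = thomas U' D' (chart_of W) p"
    unfolding W W' x using thomas_std_pconn[OF W(1) x(1) W(1)] thomas_std_pconn[OF W(1) x(1) W'(1)] p x W' by (simp add: fun_eq_iff)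
  then show "thomas U D c p = thomas U' D' c p"
    using thomas_eq_chart[OF _ _ p chart_of_in[OF W(1)] _ c] connection_on_std_conn[OF chart_of_in[OF W(1)]]
      connection_on_std_conn[OF chart_of_in[OF W'(1)]] x W W' by auto
qed

lemma thomas_at_std_pconn:
  assumes "chart_dom W" "x \<in> W"
  shows "thomas_at std_pconn (chart_of W) (orb x) v w = 0"
proof -
  have "(orb ` W, std_conn (chart_of W)) \<in> std_pconn" using assms by (auto simp: std_pconn_def)
  from thomas_at_eq[OF projective_connection_std_pconn this _ chart_of_in[OF assms(1)]]
  show ?thesis using thomas_std_pconn[OF assms assms(1)] assms by simp
qed

end

subsection \<open>Tensors from modular forms\<close>

definition modular_pair :: "(complex \<Rightarrow> complex) \<times> (complex \<Rightarrow> complex) \<Rightarrow> complex \<Rightarrow> complex^3" where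
  "modular_pair f \<tau> = vector [0, fst f \<tau>, snd f \<tau>]"

lemma modular_pair_nth [simp]:
  "modular_pair f \<tau> $ 1 = 0" "modular_pair f \<tau> $ 2 = fst f \<tau>" "modular_pair f \<tau> $ 3 = snd f \<tau>"
  by (simp_all add: modular_pair_def vector_3)

text \<open>In coordinates \<open>(\<tau>, z\<^sub>1, z\<^sub>2)\<close> this is \<open>d\<tau>\<^sup>2 \<otimes> (f\<^sub>1 \<partial>/\<partial>z\<^sub>1 + f\<^sub>2 \<partial>/\<partial>z\<^sub>2)\<close>.\<close>

definition modular_form_tensor ::
    "(complex \<Rightarrow> complex) \<times> (complex \<Rightarrow> complex) \<Rightarrow> complex \<Rightarrow> complex^3 \<Rightarrow> complex^3 \<Rightarrow> complex^3" where
  "modular_form_tensor f \<tau> v w = (v $ 1 * w $ 1) *s modular_pair f \<tau>"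

lemma holo_fun_on_first:
  assumes "f holomorphic_on upper_half_plane"
  shows "holo_fun_on (\<lambda>x :: complex^3. f (x $ 1)) kuga_cover"
proof (rule holo_fun_onI)
  fix x :: "complex^3" assume "x \<in> kuga_cover"
  then have "(f has_field_derivative deriv f (x $ 1)) (at (x $ 1))"
    using holomorphic_derivI[OF assms open_upper_half_plane] by (simp add: kuga_cover_iff)
  then have d: "(f has_derivative (\<lambda>h. deriv f (x $ 1) * h)) (at (x $ 1))"
    by (simp add: has_field_derivative_def)
  show "((\<lambda>x. f (x $ 1)) has_derivative (\<lambda>v. deriv f (x $ 1) * v $ 1)) (at x)"
    by (rule has_derivative_compose[OF bounded_linear.has_derivative[OF bounded_linear_vec_nth has_derivative_ident] d])
qed simp

context kuga_group
begin

abbreviation "forms \<equiv> H0_K32 \<Gamma> \<times> H0_K32 \<Gamma>"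

definition modular_tensor :: "(complex \<Rightarrow> complex) \<times> (complex \<Rightarrow> complex) \<Rightarrow> ((complex^3) set, 3) sym_tensor" where
  "modular_tensor f = tensor_of atlas0 (\<lambda>c p. modular_form_tensor f (coord c p $ 1))"

lemma modular_pair_transform:
  assumes f: "f \<in> forms" and g: "g \<in> \<Gamma>" and \<tau>: "\<tau> \<in> upper_half_plane"
  shows "modular_pair f (moebius g \<tau>) = (aut_factor g \<tau> ^ 3) *s modular_pair f \<tau>"
proof -
  have "fst f (moebius g \<tau>) = aut_factor g \<tau> ^ 3 * fst f \<tau>" "snd f (moebius g \<tau>) = aut_factor g \<tau> ^ 3 * snd f \<tau>"
    using f g \<tau> by (auto simp: H0_K32_def)
  then show ?thesis by (simp add: vec3_eq_iff)
qed

lemma modular_form_tensor_symbil: "symbil (modular_form_tensor f \<tau>)"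
  by (rule symbilI) (simp_all add: modular_form_tensor_def vec_eq_iff algebra_simps)

lemma modular_form_tensor_tr: "tr (modular_form_tensor f \<tau> v) = 0"
  by (simp add: tr_def modular_form_tensor_def sum_3 axis_def)

text \<open>Count of powers of j: the two factors d\<tau> give -4, the forms give 3, and together
  they give the -1 by which vertical vectors scale.\<close>

lemma modular_form_tensor_transform:
  assumes f: "f \<in> forms" and g: "g \<in> \<Gamma>" and x: "x \<in> kuga_cover"
  shows "modular_form_tensor f (moebius g (x $ 1)) (dact g l x v) (dact g l x w) = dact g l x (modular_form_tensor f (x $ 1) v w)"
proof -
  note n = dact_nth[OF det1[OF g] x]
  have \<tau>: "x $ 1 \<in> upper_half_plane" using x by (simp add: kuga_cover_iff)
  have nz: "aut_factor g (x $ 1) \<noteq> 0" by (rule aut_factor_nonzero[OF det1[OF g] \<tau>])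
  have "dact g l x (modular_form_tensor f (x $ 1) v w) = (1 / aut_factor g (x $ 1)) *s modular_form_tensor f (x $ 1) v w"
    by (rule n(2)) (simp add: modular_form_tensor_def)
  then show ?thesis
    using nz by (simp add: modular_form_tensor_def n(1) modular_pair_transform[OF f g \<tau>] vector_smult_assoc
        power2_eq_square power3_eq_cube field_simps)
qed

lemma
  assumes f: "f \<in> forms"
  shows modular_tensor_sym: "modular_tensor f \<in> sym_tensors manifold"
    and modular_tensor_comp: "chart_dom W \<Longrightarrow> x \<in> W \<Longrightarrow>
      comp_in (modular_tensor f) (chart_of W) (orb x) = modular_form_tensor f (x $ 1)"
proof -
  let ?T = "\<lambda>c p. modular_form_tensor f (coord c p $ 1)"
  have nat: "?T d p (jac c d p v) (jac c d p w) = jac c d p (?T c p v w)"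
    if cd: "c \<in> atlas0" "d \<in> atlas0" "p \<in> fst c" "p \<in> fst d" for c d p v w
  proof -
    obtain W W' where W: "chart_dom W" "c = chart_of W" and W': "chart_dom W'" "d = chart_of W'"
      using cd by (auto simp: atlas0_def)
    obtain x y where x: "x \<in> W" "p = orb x" and y: "y \<in> W'" "orb x = orb y"
      using cd W W' by auto
    obtain g l where g: "g \<in> \<Gamma>" "l \<in> L" "y = act g l x" using orb_eqD[OF y(2)] by blast
    have xX: "x \<in> kuga_cover" using W x by (auto simp: chart_dom_def)
    have J: "jac c d p = dact g l x"
      unfolding W W' x using jac_chart_of(1)[OF W(1) x(1) W'(1) _ g(1,2)] y g by simp
    have "coord c p = x"
      unfolding W(2) x(2) by (rule coord_chart_of[OF W(1) x(1)])
    moreover have "coord d p = act g l x"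
      unfolding W'(2) x(2) y(2) coord_chart_of[OF W'(1) y(1)] by (rule g(3))
    ultimately show ?thesis unfolding J using modular_form_tensor_transform[OF f g(1) xX, of l v w] by simp
  qed
  have holo: "\<exists>N. open_in_mfd manifold N \<and> p \<in> N \<and>
      (\<forall>v w. holo_map_on (\<lambda>x. ?T c (param c x) v w) (coord c ` (fst c \<inter> N)))"
    if c: "c \<in> atlas0" "p \<in> fst c" for c p
  proof -
    obtain W where W: "chart_dom W" "c = chart_of W" using c by (auto simp: atlas0_def)
    have S: "coord c ` (fst c \<inter> fst c) = W" using coord_image_chart_of[OF W(1), of "orb ` W"] W by auto
    have WX: "open W" "W \<subseteq> kuga_cover" using W by (auto simp: chart_dom_def)
    have "holo_map_on (\<lambda>x. ?T c (param c x) v w) W" for v w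
    proof (rule holo_map_on_cong[OF WX(1)])
      have "holo_fun_on (\<lambda>x. fst f (x $ 1)) kuga_cover" "holo_fun_on (\<lambda>x. snd f (x $ 1)) kuga_cover"
        using f by (auto simp: H0_K32_def intro!: holo_fun_on_first)
      then have "holo_fun_on (\<lambda>x. modular_pair f (x $ 1) $ i) W" for i
        using exhaust_3[of i] holo_fun_on_subset[OF _ WX(2)] by auto
      then show "holo_map_on (\<lambda>x. modular_form_tensor f (x $ 1) v w) W"
        unfolding modular_form_tensor_def by (intro holo_map_on_scale) (auto simp: holo_map_on_def)
    qed (use W in auto)
    moreover have "open_in_mfd manifold (fst c)" using open_mfd_chart[OF chart_of_in[OF W(1)]] W by simp
    ultimately show ?thesis using c(2) S by (intro exI[of _ "fst c"]) simp
  qed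
  show "modular_tensor f \<in> sym_tensors manifold"
    unfolding modular_tensor_def
    by (rule tensor_of_sym_tensor[OF atlas0_subset carrier_atlas0 modular_form_tensor_symbil]; (rule nat holo; assumption))
  show "comp_in (modular_tensor f) (chart_of W) (orb x) = modular_form_tensor f (x $ 1)" if W: "chart_dom W" "x \<in> W"
  proof -
    have c: "chart_of W \<in> atlas0" "orb x \<in> fst (chart_of W)" using W by (auto simp: atlas0_def)
    have "comp_in (modular_tensor f) (chart_of W) (orb x) = ?T (chart_of W) (orb x)"
      unfolding modular_tensor_def
      by (rule tensor_of_comp[OF atlas0_subset carrier_atlas0 modular_form_tensor_symbil _ _ c]; (rule nat holo; assumption))
    then show ?thesis using W by simp
  qed
qed

lemma modular_tensor_tracefree:
  assumes "f \<in> forms" shows "modular_tensor f \<in> tracefree_tensors manifold"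
  unfolding tracefree_iff[OF modular_tensor_sym[OF assms] atlas0_subset carrier_atlas0]
proof (intro ballI allI)
  fix c p v assume c: "c \<in> atlas0" "p \<in> fst c"
  then obtain W x where "chart_dom W" "c = chart_of W" "x \<in> W" "p = orb x" by (auto simp: atlas0_def)
  then show "tr (comp_in (modular_tensor f) c p v) = 0"
    using modular_tensor_comp[OF assms] by (simp add: modular_form_tensor_tr)
qed

subsection \<open>Holomorphic functions along the fibres\<close>

text \<open>The displacement caused by l in the fibre over \<tau>. It is defined for all real
  matrices and, when Im \<tau> > 0, is a real isomorphism onto the vectors with first component
  0.\<close>

definition fibre_vec :: "complex \<Rightarrow> mat2 \<Rightarrow> complex^3" where
  "fibre_vec \<tau> l = vector [0, of_real (l $ 1 $ 1) * \<tau> + of_real (l $ 1 $ 2), of_real (l $ 2 $ 1) * \<tau> + of_real (l $ 2 $ 2)]"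

lemma fibre_vec_nth [simp]:
  "fibre_vec \<tau> l $ 1 = 0"
  "fibre_vec \<tau> l $ 2 = of_real (l $ 1 $ 1) * \<tau> + of_real (l $ 1 $ 2)"
  "fibre_vec \<tau> l $ 3 = of_real (l $ 2 $ 1) * \<tau> + of_real (l $ 2 $ 2)"
  by (simp_all add: fibre_vec_def vector_3)

lemma act_translation: "act (mat 1) l x = x + fibre_vec (x $ 1) l"
  by (simp add: vec3_eq_iff)

lemma dact_translation:
  "dact (mat 1) l x v = v + (v $ 1) *s (of_real (l $ 1 $ 1) *s axis 2 1 + of_real (l $ 2 $ 1) *s axis 3 1)"
  by (simp add: dact_def vec3_eq_iff vector_3 axis_def)

lemma linear_fibre_vec: "linear (fibre_vec \<tau>)"
  by (rule linearI) (simp_all add: vec3_eq_iff scaleR_conv_of_real[where 'a = complex] algebra_simps)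

definition fibre_inv :: "complex \<Rightarrow> complex^3 \<Rightarrow> mat2" where
  "fibre_inv \<tau> w = vector
     [vector [Im (w $ 2) / Im \<tau>, Re (w $ 2) - Im (w $ 2) / Im \<tau> * Re \<tau>],
      vector [Im (w $ 3) / Im \<tau>, Re (w $ 3) - Im (w $ 3) / Im \<tau> * Re \<tau>]]"

lemma fibre_vec_inv: "\<tau> \<in> upper_half_plane \<Longrightarrow> w $ 1 = 0 \<Longrightarrow> fibre_vec \<tau> (fibre_inv \<tau> w) = w"
  by (simp add: vec3_eq_iff fibre_inv_def vector_2 complex_eq_iff upper_half_plane_def)

lemma linear_fibre_inv: "linear (fibre_inv \<tau>)"
  by (rule linearI) (simp_all add: mat2_eq_iff fibre_inv_def vector_2 algebra_simps add_divide_distrib diff_divide_distrib)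

text \<open>Fractional parts of the coordinates: the unit cell is a compact set meeting every class
  modulo L.\<close>

lemma lattice_cell: "\<exists>l\<in>L. \<exists>c\<in>cbox 0 1. X = comb e c + l"
proof -
  obtain d where d: "X = comb e d" using basis by (metis surjD)
  define c where "c = (\<chi> r. frac (d $ r))"
  have "d = c + (\<chi> r. of_int \<lfloor>d $ r\<rfloor>)" by (simp add: vec_eq_iff c_def frac_def)
  then have "X = comb e c + comb e (\<chi> r. of_int \<lfloor>d $ r\<rfloor>)"
    unfolding d using linear_add[OF linear_comb] by metis
  moreover have "c \<in> cbox 0 1" by (auto simp: c_def mem_box_cart frac_lt_1 less_imp_le)
  ultimately show ?thesis using comb_in_L[of "\<lambda>r. \<lfloor>d $ r\<rfloor>"] by blast
qed

text \<open>An entire function on the fibre that is quasi-periodic with an additive linear multiplier grows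
  at most linearly, so it is affine on complex lines; its derivative is a complex linear form that
  agrees with the multiplier, which vanishes on the real subspace \<open>l\<^sub>1\<^sub>1 = l\<^sub>2\<^sub>1 = 0\<close>.\<close>

lemma fibre_liouville:
  assumes G: "holo_fun_on G kuga_cover" and \<tau>: "\<tau> \<in> upper_half_plane"
    and per: "\<And>x l. x $ 1 = \<tau> \<Longrightarrow> l \<in> L \<Longrightarrow>
      G (act (mat 1) l x) = G x + b * of_real (l $ 1 $ 1) + b' * of_real (l $ 2 $ 1)"
  shows "b = 0" "b' = 0" "x $ 1 = \<tau> \<Longrightarrow> y $ 1 = \<tau> \<Longrightarrow> G x = G y"
proof -
  define \<beta> where "\<beta> l = b * of_real (l $ 1 $ 1) + b' * of_real (l $ 2 $ 1)" for l :: mat2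
  have lin\<beta>: "linear \<beta>" by (rule linearI) (simp_all add: \<beta>_def algebra_simps scaleR_conv_of_real[where 'a = complex])
  have X: "x \<in> kuga_cover" if "x $ 1 = \<tau>" for x using that \<tau> by (simp add: kuga_cover_iff)
  have per': "G (x + fibre_vec \<tau> l) = G x + \<beta> l" if "x $ 1 = \<tau>" "l \<in> L" for x l
    using per[OF that] that(1) unfolding act_translation by (simp add: \<beta>_def algebra_simps)
  \<comment> \<open>On the compact unit cell G is bounded; quasi-periodicity carries this bound
    everywhere at the price of the multiplier.\<close>
  have growth: "\<exists>C. \<forall>Y. norm (G (x + fibre_vec \<tau> Y)) \<le> C + norm (\<beta> Y)" if x: "x $ 1 = \<tau>" for x
  proof -
    let ?h = "\<lambda>c. x + fibre_vec \<tau> (comb e c)"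
    have ch: "continuous_on (cbox 0 1) ?h" and cb: "continuous_on (cbox 0 1) (\<lambda>c. \<beta> (comb e c))"
      using linear_continuous_on[OF linear_conv_bounded_linear[THEN iffD1, OF linear_compose[OF linear_comb linear_fibre_vec]]]
        linear_continuous_on[OF linear_conv_bounded_linear[THEN iffD1, OF linear_compose[OF linear_comb lin\<beta>]]]
      by (auto simp: comp_def intro!: continuous_intros)
    have "continuous_on (cbox 0 1) (\<lambda>c. norm (G (?h c)) + norm (\<beta> (comb e c)))"
      by (intro continuous_intros cb continuous_on_compose2[OF holo_fun_on_imp_continuous[OF G] ch])
        (use X x in auto)
    then have "bounded ((\<lambda>c. norm (G (?h c)) + norm (\<beta> (comb e c))) ` cbox 0 1)"
      by (intro compact_imp_bounded compact_continuous_image compact_cbox)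
    then obtain C where C: "\<And>c. c \<in> cbox 0 1 \<Longrightarrow> norm (G (?h c)) + norm (\<beta> (comb e c)) \<le> C"
      by (auto simp: bounded_iff)
    have "norm (G (x + fibre_vec \<tau> Y)) \<le> C + norm (\<beta> Y)" for Y
    proof -
      obtain l c where lc: "l \<in> L" "c \<in> cbox 0 1" "Y = comb e c + l" using lattice_cell by blast
      have e: "x + fibre_vec \<tau> Y = ?h c + fibre_vec \<tau> l"
        unfolding lc(3) linear_add[OF linear_fibre_vec] by (simp add: add.assoc)
      have "G (x + fibre_vec \<tau> Y) = G (?h c) + \<beta> l"
        unfolding e by (rule per'[OF _ lc(1)]) (use x in simp)
      moreover have "\<beta> l = \<beta> Y - \<beta> (comb e c)" unfolding lc(3) linear_add[OF lin\<beta>] by simp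
      ultimately have "norm (G (x + fibre_vec \<tau> Y)) \<le> norm (G (?h c)) + (norm (\<beta> Y) + norm (\<beta> (comb e c)))"
        using norm_triangle_ineq[of "G (?h c)" "\<beta> l"] norm_triangle_ineq4[of "\<beta> Y" "\<beta> (comb e c)"] by simp
      then show ?thesis using C[OF lc(2)] by linarith
    qed
    then show ?thesis by blast
  qed
  have affine: "G (x + t *s w) = G x + fd G x w * t" if x: "x $ 1 = \<tau>" and w: "w $ 1 = 0" for x w t
  proof -
    let ?q = "\<lambda>t. G (x + t *s w)"
    have d: "(?q has_field_derivative fd G (x + t *s w) w) (at t)" for t
      by (rule has_field_derivative_line[OF G]) (use X x w in simp)
    obtain C where C: "\<And>Y. norm (G (x + fibre_vec \<tau> Y)) \<le> C + norm (\<beta> Y)" using growth[OF x] by blast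
    obtain K where K: "K > 0" "\<And>w. norm (\<beta> (fibre_inv \<tau> w)) \<le> K * norm w"
      using linear_bounded_pos[OF linear_compose[OF linear_fibre_inv lin\<beta>]] by (auto simp: comp_def)
    \<comment> \<open>Linear growth in the complex parameter; beyond norm t = 1 the constant C is
      absorbed by C times norm t.\<close>
    have "norm (?q t) \<le> (\<bar>C\<bar> + K * norm w) * norm t ^ 1" if t: "1 \<le> norm t" for t
    proof -
      have "norm (?q t) \<le> C + norm (\<beta> (fibre_inv \<tau> (t *s w)))"
        using C[of "fibre_inv \<tau> (t *s w)"] fibre_vec_inv[OF \<tau>, of "t *s w"] w by simp
      also have "\<dots> \<le> \<bar>C\<bar> + K * (norm t * norm w)"
        using K(2)[of "t *s w"] by (simp add: norm_cscale)
      also have "\<bar>C\<bar> \<le> \<bar>C\<bar> * norm t" using t mult_left_mono[of 1 "norm t" "\<bar>C\<bar>"] by simp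
      finally show ?thesis by (simp add: algebra_simps)
    qed
    moreover have "?q holomorphic_on UNIV"
      unfolding holomorphic_on_def field_differentiable_def using d by blast
    ultimately have "?q t = (\<Sum>k\<le>1. (deriv ^^ k) ?q 0 / fact k * t ^ k)"
      by (intro Liouville_polynomial) auto
    then show ?thesis using DERIV_imp_deriv[OF d[of 0]] by simp
  qed
  \<comment> \<open>Both sides are real linear in Y, and on the lattice basis they agree by
    comparing the affine formula at t = 1 with quasi-periodicity.\<close>
  have agree: "fd G x (fibre_vec \<tau> Y) = \<beta> Y" if x: "x $ 1 = \<tau>" for x Y
  proof -
    have linG: "linear (fd G x)" using has_derivative_linear[OF holo_fun_onD(1)[OF G X[OF x]]] .
    have basic: "fd G x (fibre_vec \<tau> (e r)) = \<beta> (e r)" for r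
      using affine[OF x, of "fibre_vec \<tau> (e r)" 1] per'[OF x basis_in_L] by simp
    obtain c where c: "Y = comb e c" using basis by (metis surjD)
    show ?thesis
      unfolding c comb_def
      by (simp add: linear_sum[OF linear_fibre_vec] linear_sum[OF linG] linear_sum[OF lin\<beta>]
          linear_scale[OF linear_fibre_vec] linear_scale[OF linG] linear_scale[OF lin\<beta>] basic)
  qed
  have zero: "fd G x w = 0" if x: "x $ 1 = \<tau>" and w: "w $ 1 = 0" for x w
  proof -
    \<comment> \<open>Matrix units of the second column have zero multiplier, yet their
      displacements span the fibre directions over the complex numbers; complex linearity of the
      derivative does the rest.\<close>
    have r2: "fibre_vec \<tau> (vector [vector [0, 1], vector [0, 0]]) = axis 2 1"
      and r3: "fibre_vec \<tau> (vector [vector [0, 0], vector [0, 1]]) = axis 3 1"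
      by (simp_all add: vec3_eq_iff vector_2 axis_def)
    have "fd G x (axis 2 1) = 0" "fd G x (axis 3 1) = 0"
      using agree[OF x, of "vector [vector [0, 1], vector [0, 0]]"]
        agree[OF x, of "vector [vector [0, 0], vector [0, 1]]"] unfolding r2 r3
      by (simp_all add: \<beta>_def vector_2)
    then show ?thesis
      using holo_fun_on_fd_expansion[OF G X[OF x], of w] w by (simp add: sum_3)
  qed
  define x0 :: "complex^3" where "x0 = vector [\<tau>, 0, 0]"
  have x0: "x0 $ 1 = \<tau>" by (simp add: x0_def vector_3)
  \<comment> \<open>Matrix units of the first column now isolate b and b'.\<close>
  have "\<beta> Y = 0" for Y using agree[OF x0, of Y] zero[OF x0, of "fibre_vec \<tau> Y"] by simp
  from this[of "vector [vector [1, 0], vector [0, 0]]"] this[of "vector [vector [0, 0], vector [1, 0]]"]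
  show "b = 0" "b' = 0" by (simp_all add: \<beta>_def vector_2)
  show "G x = G y" if "x $ 1 = \<tau>" "y $ 1 = \<tau>" for x y
    using affine[OF that(1), of "y - x" 1] zero[OF that(1), of "y - x"] that by simp
qed

subsection \<open>Classification of trace-free tensors\<close>

definition lift_tensor :: "((complex^3) set, 3) sym_tensor \<Rightarrow> complex^3 \<Rightarrow> complex^3 \<Rightarrow> complex^3 \<Rightarrow> complex^3" where
  "lift_tensor \<Theta> x = comp_in \<Theta> (chart_of (SOME W. chart_dom W \<and> x \<in> W)) (orb x)"

lemma comp_in_transform:
  assumes \<Theta>: "\<Theta> \<in> sym_tensors manifold" and W: "chart_dom W" "x \<in> W" and W': "chart_dom W'" "act g l x \<in> W'"
    and g: "g \<in> \<Gamma>" "l \<in> L"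
  shows "comp_in \<Theta> (chart_of W') (orb x) (dact g l x v) (dact g l x w) = dact g l x (comp_in \<Theta> (chart_of W) (orb x) v w)"
proof -
  have "x \<in> kuga_cover" using W by (auto simp: chart_dom_def)
  then have "orb x \<in> orb ` W'" using orb_act[OF g] W'(2) by (metis imageI)
  then show ?thesis
    using comp_in_natural[OF \<Theta> chart_of_in[OF W(1)] _ chart_of_in[OF W'(1)], of "orb x" v w]
      jac_chart_of(1)[OF W W' g] W by simp
qed

text \<open>Two chart domains containing the same point x are related there by the identity element,
  so the components agree and the choice in \<open>lift_tensor\<close> is harmless.\<close>

lemma lift_tensor_eq:
  assumes \<Theta>: "\<Theta> \<in> sym_tensors manifold" and W: "chart_dom W" "x \<in> W"
  shows "comp_in \<Theta> (chart_of W) (orb x) = lift_tensor \<Theta> x"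
proof -
  define W' where "W' = (SOME W. chart_dom W \<and> x \<in> W)"
  have W': "chart_dom W'" "x \<in> W'" using someI[of "\<lambda>W. chart_dom W \<and> x \<in> W" W] W by (auto simp: W'_def)
  have d: "dact (mat 1) 0 x v = v" for v by (simp add: dact_translation)
  have "comp_in \<Theta> (chart_of W') (orb x) v w = comp_in \<Theta> (chart_of W) (orb x) v w" for v w
    using comp_in_transform[OF \<Theta> W W'(1) _ one zero_in_L, of v w] W'(2) by (simp add: act_one d)
  then show ?thesis by (simp add: lift_tensor_def W'_def fun_eq_iff)
qed

lemma lift_tensor_transform:
  assumes \<Theta>: "\<Theta> \<in> sym_tensors manifold" and x: "x \<in> kuga_cover" and g: "g \<in> \<Gamma>" "l \<in> L"
  shows "lift_tensor \<Theta> (act g l x) (dact g l x v) (dact g l x w) = dact g l x (lift_tensor \<Theta> x v w)"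
proof -
  obtain W where W: "chart_dom W" "x \<in> W" using chart_dom_neighbourhood[OF x] by blast
  obtain W' where W': "chart_dom W'" "act g l x \<in> W'" using chart_dom_neighbourhood[OF act_cover[OF det1[OF g(1)] x]] by blast
  show ?thesis
    using comp_in_transform[OF \<Theta> W W' g, of v w] lift_tensor_eq[OF \<Theta> W] lift_tensor_eq[OF \<Theta> W']
    by (simp add: orb_act[OF g x])
qed

lemma lift_tensor_symbil:
  assumes \<Theta>: "\<Theta> \<in> sym_tensors manifold" and x: "x \<in> kuga_cover"
  shows "symbil (lift_tensor \<Theta> x)"
proof -
  obtain W where W: "chart_dom W" "x \<in> W" using chart_dom_neighbourhood[OF x] by blast
  show ?thesis
    using comp_in_symbil[OF \<Theta> chart_of_in[OF W(1)], of "orb x"] W lift_tensor_eq[OF \<Theta> W] by simp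
qed

lemma lift_tensor_holo:
  assumes \<Theta>: "\<Theta> \<in> sym_tensors manifold"
  shows "holo_fun_on (\<lambda>x. lift_tensor \<Theta> x v w $ k) kuga_cover"
proof (rule holo_fun_on_local)
  fix x assume "x \<in> kuga_cover"
  then obtain W where W: "chart_dom W" "x \<in> W" using chart_dom_neighbourhood by blast
  let ?c = "chart_of W" and ?U = "orb ` W"
  have c: "?c \<in> manifold" using W by simp
  have U: "open_in_mfd manifold ?U" using open_mfd_chart[OF c] by simp
  have S: "coord ?c ` (fst ?c \<inter> ?U) = W" using coord_image_chart_of[OF W(1), of ?U] by auto
  have oW: "open W" using W by (simp add: chart_dom_def)
  have f: "const_field ?c ?U v \<in> vector_fields manifold ?U" for v
    by (rule const_field_vector_field[OF U _ c]) simp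
  have "holo_map_on (\<lambda>x. \<Theta> (param ?c x) (const_field ?c ?U v (param ?c x)) (const_field ?c ?U w (param ?c x)) ?c) W"
    using vector_fieldsD(3)[OF sym_tensors_field[OF \<Theta> U f f] c] unfolding S .
  then have "holo_map_on (\<lambda>x. lift_tensor \<Theta> x v w) W"
  proof (rule holo_map_on_cong[OF oW, rotated])
    fix y assume y: "y \<in> W"
    show "\<Theta> (param ?c y) (const_field ?c ?U v (param ?c y)) (const_field ?c ?U w (param ?c y)) ?c = lift_tensor \<Theta> y v w"
      unfolding lift_tensor_eq[OF \<Theta> W(1) y, symmetric] comp_in_def using y W(1) by simp
  qed
  then show "\<exists>T. open T \<and> x \<in> T \<and> holo_fun_on (\<lambda>x. lift_tensor \<Theta> x v w $ k) T"
    using W oW by (auto simp: holo_map_on_def)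
qed

abbreviation ax :: "3 \<Rightarrow> complex^3" where "ax i \<equiv> axis i 1"

text \<open>The unipotent action of the lattice forces the components to vanish one after the other,
  beginning with those of \<open>dz\<^sub>a dz\<^sub>b \<otimes> \<partial>/\<partial>\<tau>\<close>.\<close>

lemma lift_tensor_fibre:
  assumes \<Theta>: "\<Theta> \<in> tracefree_tensors manifold" and \<tau>: "\<tau> \<in> upper_half_plane"
  shows "\<exists>F. F $ 1 = 0 \<and> (\<forall>x v w. x $ 1 = \<tau> \<longrightarrow> lift_tensor \<Theta> x v w = (v $ 1 * w $ 1) *s F)"
proof -
  have \<Theta>s: "\<Theta> \<in> sym_tensors manifold" by (rule tracefree_sym[OF \<Theta>])
  let ?S = "lift_tensor \<Theta>"
  define T where "T i j k x = ?S x (ax i) (ax j) $ k" for i j k x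
  have X: "x \<in> kuga_cover" if "x $ 1 = \<tau>" for x using that \<tau> by (simp add: kuga_cover_iff)
  note sb = symbilD[OF lift_tensor_symbil[OF \<Theta>s X]]
  have Tsym: "T i j k x = T j i k x" if "x $ 1 = \<tau>" for i j k x
    using sb(2)[OF that, of "ax i" "ax j"] by (simp add: T_def)
  have holo: "holo_fun_on (T i j k) kuga_cover" for i j k
    unfolding T_def by (rule lift_tensor_holo[OF \<Theta>s])
  let ?p = "\<lambda>l :: mat2. of_real (l $ 1 $ 1) :: complex" and ?q = "\<lambda>l :: mat2. of_real (l $ 2 $ 1) :: complex"
  have eq: "?S (act (mat 1) l x) (v + v $ 1 *s (?p l *s ax 2 + ?q l *s ax 3)) (w + w $ 1 *s (?p l *s ax 2 + ?q l *s ax 3)) =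
      ?S x v w + ?S x v w $ 1 *s (?p l *s ax 2 + ?q l *s ax 3)" if "x $ 1 = \<tau>" "l \<in> L" for x l v w
    using lift_tensor_transform[OF \<Theta>s X[OF that(1)] one that(2), of v w] by (simp only: dact_translation)
  have tau: "act (mat 1) l x $ 1 = x $ 1" for l x by simp
  define x0 :: "complex^3" where "x0 = vector [\<tau>, 0, 0]"
  have x0: "x0 $ 1 = \<tau>" by (simp add: x0_def vector_3)
  \<comment> \<open>The vertical vector by which the translation l changes
    \<partial>/\<partial>\<tau>; through it l enters all transformation rules below.\<close>
  define U where "U l k = (?p l *s ax 2 + ?q l *s ax 3) $ k" for l and k :: 3
  have U: "U l 1 = 0" "U l 2 = ?p l" "U l 3 = ?q l" for l by (simp_all add: U_def axis_def)
  have e_ab: "T a b k (act (mat 1) l x) = T a b k x + T a b 1 x * U l k"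
    if "x $ 1 = \<tau>" "l \<in> L" "a \<noteq> 1" "b \<noteq> 1" for a b k x l
  proof -
    have z: "ax a $ 1 = 0" "ax b $ 1 = 0" using that by (auto simp: axis_def)
    show ?thesis using arg_cong[OF eq[OF that(1,2), of "ax a" "ax b"], of "\<lambda>y. y $ k"]
      by (simp add: z T_def U_def distrib_left mult.assoc)
  qed
  have e_1a: "T 1 a k (act (mat 1) l x) + (?p l * T 2 a k (act (mat 1) l x) + ?q l * T 3 a k (act (mat 1) l x)) =
      T 1 a k x + T 1 a 1 x * U l k"
    if "x $ 1 = \<tau>" "l \<in> L" "a \<noteq> 1" for a k x l
  proof -
    have z: "ax a $ 1 = 0" "ax 1 $ 1 = 1" using that by (auto simp: axis_def)
    have t: "act (mat 1) l x $ 1 = \<tau>" using that(1) by simp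
    show ?thesis using arg_cong[OF eq[OF that(1,2), of "ax 1" "ax a"], of "\<lambda>y. y $ k"]
      by (simp only: z sb(3,4)[OF t]) (simp add: T_def U_def distrib_left mult.assoc)
  qed
  have e_11: "T 1 1 k (act (mat 1) l x) + 2 * (?p l * T 1 2 k (act (mat 1) l x) + ?q l * T 1 3 k (act (mat 1) l x)) +
      (?p l * (?p l * T 2 2 k (act (mat 1) l x)) + 2 * (?p l * (?q l * T 2 3 k (act (mat 1) l x))) + ?q l * (?q l * T 3 3 k (act (mat 1) l x))) =
      T 1 1 k x + T 1 1 1 x * U l k"
    if "x $ 1 = \<tau>" "l \<in> L" for k x l
  proof -
    have z: "ax 1 $ 1 = 1" by (simp add: axis_def)
    have t: "act (mat 1) l x $ 1 = \<tau>" using that(1) by simp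
    have "?S (act (mat 1) l x) (ax 1 + 1 *s (?p l *s ax 2 + ?q l *s ax 3)) (ax 1 + 1 *s (?p l *s ax 2 + ?q l *s ax 3)) $ k =
        T 1 1 k x + T 1 1 1 x * U l k"
      using arg_cong[OF eq[OF that(1,2), of "ax 1" "ax 1"], of "\<lambda>y. y $ k"] by (simp only: z) (simp add: T_def U_def distrib_left mult.assoc)
    then show ?thesis
      using Tsym[OF t, of 2 1 k] Tsym[OF t, of 3 1 k] Tsym[OF t, of 3 2 k]
      by (simp only: sb(3-6)[OF t] vector_smult_lid vector_add_component vector_smult_component T_def[symmetric])
        (simp add: algebra_simps)
  qed
  note liouville = fibre_liouville[OF holo \<tau>]
  \<comment> \<open>Pattern of every round: components already constant along the fibre become the
    multipliers of the next ones. \<open>liouville\<close> forces these multipliers to vanish and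
    makes the next components constant.\<close>
  have c1: "T a b 1 x = T a b 1 x0" if "x $ 1 = \<tau>" "a \<noteq> 1" "b \<noteq> 1" for a b x
    by (rule liouville(3)[where b = 0 and b' = 0, OF _ that(1) x0]) (simp add: e_ab that(2,3) U)
  have r2: "T 1 a 1 (act (mat 1) l x) = T 1 a 1 x + (- T 2 a 1 x0) * of_real (l $ 1 $ 1) + (- T 3 a 1 x0) * of_real (l $ 2 $ 1)"
    if "x $ 1 = \<tau>" "l \<in> L" "a \<noteq> 1" for a x l
  proof -
    have t: "act (mat 1) l x $ 1 = \<tau>" using that(1) by simp
    show ?thesis using e_1a[OF that, of 1] c1[OF t, of 2 a] c1[OF t, of 3 a] that(3) by (simp add: U algebra_simps)
  qed
  have v1: "T a b 1 x = 0" if "x $ 1 = \<tau>" "a \<noteq> 1" "b \<noteq> 1" for a b x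
  proof -
    have "T 2 b 1 x0 = 0" "T 3 b 1 x0 = 0"
      using liouville(1)[OF r2] liouville(2)[OF r2] that(3) by auto
    moreover have "a = 2 \<or> a = 3" using exhaust_3[of a] that(2) by auto
    ultimately show ?thesis using c1[OF that] by auto
  qed
  have c2: "T 1 a 1 x = T 1 a 1 x0" if "x $ 1 = \<tau>" "a \<noteq> 1" for a x
    by (rule liouville(3)[OF r2 that(1) x0]) (use that in auto)
  have c3: "T a b k x = T a b k x0" if "x $ 1 = \<tau>" "a \<noteq> 1" "b \<noteq> 1" for a b k x
    by (rule liouville(3)[where b = 0 and b' = 0, OF _ that(1) x0]) (simp add: e_ab that(2,3) v1)
  \<comment> \<open>The part of \<open>e_11\<close> quadratic in l carries components killed by
    \<open>v1\<close>, so the multiplier is linear as \<open>liouville\<close> requires.\<close>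
  have r4: "T 1 1 1 (act (mat 1) l x) = T 1 1 1 x + (- 2 * T 1 2 1 x0) * of_real (l $ 1 $ 1) + (- 2 * T 1 3 1 x0) * of_real (l $ 2 $ 1)"
    if "x $ 1 = \<tau>" "l \<in> L" for x l
  proof -
    have t: "act (mat 1) l x $ 1 = \<tau>" using that(1) by simp
    show ?thesis using e_11[OF that, of 1] c2[OF t, of 2] c2[OF t, of 3] v1[OF t] by (simp add: U algebra_simps)
  qed
  have v2: "T 1 a 1 x = 0" if "x $ 1 = \<tau>" "a \<noteq> 1" for a x
    using liouville(1)[OF r4] liouville(2)[OF r4] c2[OF that] exhaust_3[of a] that(2) by auto
  have c4: "T 1 1 1 x = T 1 1 1 x0" if "x $ 1 = \<tau>" for x
    by (rule liouville(3)[OF r4 that x0])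
  have r5: "T 1 a k (act (mat 1) l x) = T 1 a k x + (- T 2 a k x0) * of_real (l $ 1 $ 1) + (- T 3 a k x0) * of_real (l $ 2 $ 1)"
    if "x $ 1 = \<tau>" "l \<in> L" "a \<noteq> 1" for a k x l
  proof -
    have t: "act (mat 1) l x $ 1 = \<tau>" using that(1) by simp
    show ?thesis using e_1a[OF that, of k] c3[OF t, of 2 a k] c3[OF t, of 3 a k] v2[OF that(1,3)] that(3)
      by (simp add: algebra_simps)
  qed
  have v3: "T a b k x = 0" if "x $ 1 = \<tau>" "a \<noteq> 1" "b \<noteq> 1" for a b k x
  proof -
    have "T 2 b k x0 = 0" "T 3 b k x0 = 0"
      using liouville(1)[OF r5] liouville(2)[OF r5] that(3) by auto
    moreover have "a = 2 \<or> a = 3" using exhaust_3[of a] that(2) by auto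
    ultimately show ?thesis using c3[OF that] by auto
  qed
  have c5: "T 1 a k x = T 1 a k x0" if "x $ 1 = \<tau>" "a \<noteq> 1" for a k x
    by (rule liouville(3)[OF r5 that(1) x0]) (use that in auto)
  have e6: "T 1 1 k (act (mat 1) l x) = T 1 1 k x + T 1 1 1 x0 * U l k - 2 * T 1 2 k x0 * ?p l - 2 * T 1 3 k x0 * ?q l"
    if "x $ 1 = \<tau>" "l \<in> L" for k x l
  proof -
    have t: "act (mat 1) l x $ 1 = \<tau>" using that(1) by simp
    show ?thesis using e_11[OF that, of k] c5[OF t, of 2 k] c5[OF t, of 3 k] v3[OF t] c4[OF that(1)] by (simp add: algebra_simps)
  qed
  \<comment> \<open>Two components now enter one multiplier, so its vanishing gives only a relation
    between T 1 1 1 and T 1 2 2, respectively T 1 3 3.\<close>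
  have r6: "T 1 1 2 (act (mat 1) l x) = T 1 1 2 x + (T 1 1 1 x0 - 2 * T 1 2 2 x0) * of_real (l $ 1 $ 1) + (- 2 * T 1 3 2 x0) * of_real (l $ 2 $ 1)"
    and r7: "T 1 1 3 (act (mat 1) l x) = T 1 1 3 x + (- 2 * T 1 2 3 x0) * of_real (l $ 1 $ 1) + (T 1 1 1 x0 - 2 * T 1 3 3 x0) * of_real (l $ 2 $ 1)"
    if "x $ 1 = \<tau>" "l \<in> L" for x l
    using e6[OF that, of 2] e6[OF that, of 3] by (simp_all add: U algebra_simps)
  have l6: "T 1 1 1 x0 = 2 * T 1 2 2 x0" "T 1 3 2 x0 = 0" using liouville(1,2)[OF r6] by auto
  have l7: "T 1 2 3 x0 = 0" "T 1 1 1 x0 = 2 * T 1 3 3 x0" using liouville(1,2)[OF r7] by auto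
  \<comment> \<open>The relations T 1 1 1 = 2 T 1 2 2 = 2 T 1 3 3 still allow multiples of
    d\<tau>(v) w + d\<tau>(w) v, a pure trace tensor; the trace condition removes it.\<close>
  have "tr (?S x0 (ax 1)) = 0"
  proof -
    obtain W where W: "chart_dom W" "x0 \<in> W" using chart_dom_neighbourhood[OF X[OF x0]] by blast
    show ?thesis
      using tracefree_comp[OF \<Theta> chart_of_in[OF W(1)], of "orb x0"] W lift_tensor_eq[OF \<Theta>s W] by simp
  qed
  then have "T 1 1 1 x0 + T 1 2 2 x0 + T 1 3 3 x0 = 0" by (simp add: tr_def sum_3 T_def)
  then have "4 * T 1 3 3 x0 = 0" using l6 l7 by simp
  then have t0: "T 1 1 1 x0 = 0" "T 1 2 2 x0 = 0" "T 1 3 3 x0 = 0" using l6 l7 by auto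
  have v5: "T 1 a k x = 0" if "x $ 1 = \<tau>" "a \<noteq> 1" for a k x
    using c5[OF that, of k] v2[OF that] t0 l6 l7 exhaust_3[of a] exhaust_3[of k] that(2) by auto
  define F where "F = ?S x0 (ax 1) (ax 1)"
  have v6: "T 1 1 k x = F $ k" if "x $ 1 = \<tau>" for k x
  proof -
    have "T 1 1 k x = T 1 1 k x0"
      using liouville(3)[OF r4 that x0] liouville(3)[OF r6 that x0] liouville(3)[OF r7 that x0] exhaust_3[of k] by auto
    then show ?thesis by (simp add: F_def T_def)
  qed
  have "?S x v w = (v $ 1 * w $ 1) *s F" if x: "x $ 1 = \<tau>" for x v w
  proof -
    have "?S x (ax i) (ax j) = (if i = 1 \<and> j = 1 then F else 0)" for i j
    proof (cases "i = 1 \<and> j = 1")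
      case True
      then show ?thesis using v6[OF x] by (simp add: vec_eq_iff T_def)
    next
      case False
      have "T i j k x = 0" for k
        using v5[OF x, of j k] v5[OF x, of i k] Tsym[OF x, of i 1 k] v3[OF x, of i j k] False by (cases "i = 1"; cases "j = 1") auto
      then show ?thesis using False by (auto simp: vec_eq_iff T_def)
    qed
    then show ?thesis
      using symbil_expansion[OF lift_tensor_symbil[OF \<Theta>s X[OF x]], of v w] by (simp add: sum_3)
  qed
  moreover have "F $ 1 = 0" using v6[OF x0, of 1] t0 by simp
  ultimately show ?thesis by blast
qed

text \<open>What is left depends on \<tau> alone. Invariance under g reads j^(-4) F(g \<tau>) =
  j^(-1) F(\<tau>), that is, weight 3.\<close>

lemma tracefree_tensor_is_modular:
  assumes \<Theta>: "\<Theta> \<in> tracefree_tensors manifold"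
  shows "\<exists>f\<in>forms. \<Theta> = modular_tensor f"
proof -
  have \<Theta>s: "\<Theta> \<in> sym_tensors manifold" by (rule tracefree_sym[OF \<Theta>])
  obtain F where F: "\<And>\<tau>. \<tau> \<in> upper_half_plane \<Longrightarrow> F \<tau> $ 1 = 0"
    "\<And>\<tau> x v w. \<tau> \<in> upper_half_plane \<Longrightarrow> x $ 1 = \<tau> \<Longrightarrow> lift_tensor \<Theta> x v w = (v $ 1 * w $ 1) *s F \<tau>"
    using lift_tensor_fibre[OF \<Theta>] by metis
  define f where "f k \<tau> = (if \<tau> \<in> upper_half_plane then F \<tau> $ k else 0)" for k :: 3 and \<tau>
  have f_in: "f k \<in> H0_K32 \<Gamma>" if k: "k \<noteq> 1" for k
    unfolding H0_K32_def
  proof (intro CollectI conjI ballI allI impI)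
    \<comment> \<open>Holomorphy of the coefficient is read off along the section \<tau> \<mapsto>
      (\<tau>, 0, 0).\<close>
    have "(\<lambda>\<tau>. lift_tensor \<Theta> (0 + \<tau> *s axis 1 1) (axis 1 1) (axis 1 1) $ k) holomorphic_on upper_half_plane"
      unfolding holomorphic_on_def field_differentiable_def
    proof
      fix \<tau> assume "\<tau> \<in> upper_half_plane"
      then have "0 + \<tau> *s axis 1 1 \<in> kuga_cover" by (simp add: kuga_cover_iff axis_def)
      from has_field_derivative_at_within[OF has_field_derivative_line[OF lift_tensor_holo[OF \<Theta>s] this]]
      show "\<exists>f'. ((\<lambda>\<tau>. lift_tensor \<Theta> (0 + \<tau> *s axis 1 1) (axis 1 1) (axis 1 1) $ k) has_field_derivative f') (at \<tau> within upper_half_plane)"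
        by blast
    qed
    then show "f k holomorphic_on upper_half_plane"
    proof (rule holomorphic_transform)
      fix \<tau> assume "\<tau> \<in> upper_half_plane"
      then show "lift_tensor \<Theta> (0 + \<tau> *s axis 1 1) (axis 1 1) (axis 1 1) $ k = f k \<tau>"
        using F(2)[of \<tau> "0 + \<tau> *s axis 1 1"] by (simp add: f_def axis_def)
    qed
    show "f k \<tau> = 0" if "\<tau> \<notin> upper_half_plane" for \<tau> using that by (simp add: f_def)
    fix g \<tau> assume g: "g \<in> \<Gamma>" and \<tau>: "\<tau> \<in> upper_half_plane"
    let ?j = "aut_factor g \<tau>"
    have nz: "?j \<noteq> 0" by (rule aut_factor_nonzero[OF det1[OF g] \<tau>])
    have g\<tau>: "moebius g \<tau> \<in> upper_half_plane" by (rule moebius_upper_half_plane[OF det1[OF g] \<tau>])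
    define x :: "complex^3" where "x = \<tau> *s axis 1 1"
    have x: "x $ 1 = \<tau>" "x \<in> kuga_cover" using \<tau> by (simp_all add: x_def kuga_cover_iff axis_def)
    have "(dact g 0 x (axis 1 1) $ 1 * dact g 0 x (axis 1 1) $ 1) *s F (moebius g \<tau>) = dact g 0 x (F \<tau>)"
      using lift_tensor_transform[OF \<Theta>s x(2) g zero_in_L, of "axis 1 1" "axis 1 1"] F(2)[OF \<tau> x(1)]
        F(2)[OF g\<tau>, of "act g 0 x"] x by (simp add: axis_def)
    also have "dact g 0 x (F \<tau>) = (1 / ?j) *s F \<tau>"
      using dact_nth(2)[OF det1[OF g] x(2) F(1)[OF \<tau>]] x by simp
    finally have "(1 / ?j\<^sup>2 * (1 / ?j\<^sup>2)) * F (moebius g \<tau>) $ k = (1 / ?j) * F \<tau> $ k"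
      using dact_nth(1)[OF det1[OF g] x(2), of 0 "axis 1 1"] x by (simp add: vec_eq_iff axis_def)
    then have "F (moebius g \<tau>) $ k = ?j ^ 3 * F \<tau> $ k"
      using nz by (simp add: field_simps power2_eq_square power3_eq_cube)
    then show "f k (moebius g \<tau>) = ?j ^ 3 * f k \<tau>" using \<tau> g\<tau> by (simp add: f_def)
  qed
  let ?f = "(f 2, f 3)"
  have ff: "?f \<in> forms" using f_in by simp
  have "\<Theta> = modular_tensor ?f"
  proof (rule sym_tensor_eqI[OF \<Theta>s modular_tensor_sym[OF ff] atlas0_subset carrier_atlas0], intro ext)
    fix c p v w assume c: "c \<in> atlas0" "p \<in> fst c"
    then obtain W x where W: "chart_dom W" "c = chart_of W" "x \<in> W" "p = orb x" by (auto simp: atlas0_def)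
    then have \<tau>: "x $ 1 \<in> upper_half_plane" by (auto simp: chart_dom_def kuga_cover_iff)
    show "comp_in \<Theta> c p v w = comp_in (modular_tensor ?f) c p v w"
      unfolding W(2,4) lift_tensor_eq[OF \<Theta>s W(1,3)] modular_tensor_comp[OF ff W(1,3)]
      using F(1)[OF \<tau>] F(2)[OF \<tau> refl] \<tau> by (simp add: modular_form_tensor_def vec3_eq_iff f_def)
  qed
  then show ?thesis using ff by blast
qed

end

section \<open>Pairs of modular forms as a model of the space of trace-free tensors\<close>

context kuga_group
begin

lemma modular_tensor_inj: "inj_on modular_tensor forms"
proof (rule inj_onI)
  fix f h assume f: "f \<in> forms" and h: "h \<in> forms" and eq: "modular_tensor f = modular_tensor h"
  have "fst f \<tau> = fst h \<tau> \<and> snd f \<tau> = snd h \<tau>" for \<tau>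
  proof (cases "\<tau> \<in> upper_half_plane")
    case True
    define x :: "complex^3" where "x = \<tau> *s axis 1 1"
    have x: "x $ 1 = \<tau>" by (simp add: x_def axis_def)
    then have "x \<in> kuga_cover" using True by (simp add: kuga_cover_iff)
    then obtain W where W: "chart_dom W" "x \<in> W" using chart_dom_neighbourhood by blast
    have "modular_form_tensor f \<tau> = modular_form_tensor h \<tau>"
      using modular_tensor_comp[OF f W] modular_tensor_comp[OF h W] eq x by simp
    then have "modular_form_tensor f \<tau> (axis 1 1) (axis 1 1) = modular_form_tensor h \<tau> (axis 1 1) (axis 1 1)" by simp
    then show ?thesis by (simp add: modular_form_tensor_def axis_def vec3_eq_iff)
  next
    case False
    then show ?thesis using f h by (auto simp: H0_K32_def)
  qed
  then show "f = h" by (simp add: prod_eq_iff fun_eq_iff)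
qed

lemma modular_tensor_eqI:
  assumes f: "f \<in> forms" and \<Theta>: "\<Theta> \<in> sym_tensors manifold"
    and eq: "\<And>W x v w. chart_dom W \<Longrightarrow> x \<in> W \<Longrightarrow> comp_in \<Theta> (chart_of W) (orb x) v w = modular_form_tensor f (x $ 1) v w"
  shows "modular_tensor f = \<Theta>"
proof (rule sym_tensor_eqI[OF modular_tensor_sym[OF f] \<Theta> atlas0_subset carrier_atlas0], intro ext)
  fix c p v w assume "c \<in> atlas0" "p \<in> fst c"
  then obtain W x where W: "chart_dom W" "c = chart_of W" "x \<in> W" "p = orb x" by (auto simp: atlas0_def)
  show "comp_in (modular_tensor f) c p v w = comp_in \<Theta> c p v w"
    unfolding W(2,4) modular_tensor_comp[OF f W(1,3)] eq[OF W(1,3)] ..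
qed

lemma modular_tensor_add:
  assumes f: "f \<in> forms" and h: "h \<in> forms"
  shows "modular_tensor (f + h) = modular_tensor f + modular_tensor h"
proof (rule modular_tensor_eqI)
  have "a + b \<in> H0_K32 \<Gamma>" if "a \<in> H0_K32 \<Gamma>" "b \<in> H0_K32 \<Gamma>" for a b
    using that by (auto simp: H0_K32_def plus_fun_def algebra_simps intro!: holomorphic_intros)
  then show "f + h \<in> forms" using f h by (auto simp: mem_Times_iff)
  show "modular_tensor f + modular_tensor h \<in> sym_tensors manifold"
    by (rule sym_tensors_add[OF modular_tensor_sym[OF f] modular_tensor_sym[OF h]])
  show "comp_in (modular_tensor f + modular_tensor h) (chart_of W) (orb x) v w = modular_form_tensor (f + h) (x $ 1) v w"
    if "chart_dom W" "x \<in> W" for W x v w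
    unfolding comp_in_add modular_tensor_comp[OF f that] modular_tensor_comp[OF h that]
    by (simp add: modular_form_tensor_def vec3_eq_iff algebra_simps)
qed

lemma modular_tensor_scale:
  assumes f: "(f, h) \<in> forms"
  shows "modular_tensor (\<lambda>\<tau>. k * f \<tau>, \<lambda>\<tau>. k * h \<tau>) = tensor_scale k (modular_tensor (f, h))"
proof (rule modular_tensor_eqI)
  have "(\<lambda>\<tau>. k * a \<tau>) \<in> H0_K32 \<Gamma>" if "a \<in> H0_K32 \<Gamma>" for a
    using that by (auto simp: H0_K32_def intro!: holomorphic_intros)
  then show "(\<lambda>\<tau>. k * f \<tau>, \<lambda>\<tau>. k * h \<tau>) \<in> forms" using f by simp
  show "tensor_scale k (modular_tensor (f, h)) \<in> sym_tensors manifold"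
    by (rule sym_tensors_scale[OF modular_tensor_sym[OF f]])
  show "comp_in (tensor_scale k (modular_tensor (f, h))) (chart_of W) (orb x) v w =
      modular_form_tensor (\<lambda>\<tau>. k * f \<tau>, \<lambda>\<tau>. k * h \<tau>) (x $ 1) v w"
    if "chart_dom W" "x \<in> W" for W x v w
    unfolding comp_in_scale modular_tensor_comp[OF f that]
    by (simp add: modular_form_tensor_def vec3_eq_iff algebra_simps)
qed

lemma projective_connection_modular:
  assumes P: "projective_connection manifold P"
  shows "\<exists>f\<in>forms. (translate (modular_tensor f) std_pconn, P) \<in> proj_equiv manifold"
  using projective_difference_tensor[OF projective_connection_std_pconn P] tracefree_tensor_is_modular by metis

subsection \<open>Flatness\<close>

text \<open>The half plane is convex, so primitives exist globally on it; two successive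
  integrations are possible.\<close>

lemma second_primitive:
  assumes "f holomorphic_on upper_half_plane"
  shows "\<exists>F G. (\<forall>\<tau>\<in>upper_half_plane. (F has_field_derivative G \<tau>) (at \<tau>)) \<and>
    (\<forall>\<tau>\<in>upper_half_plane. (G has_field_derivative f \<tau>) (at \<tau>))"
proof -
  have c: "convex upper_half_plane" unfolding upper_half_plane_def by (rule convex_halfspace_Im_gt)
  have "\<exists>g. \<forall>\<tau>\<in>upper_half_plane. (g has_field_derivative h \<tau>) (at \<tau>)" if "h holomorphic_on upper_half_plane" for h
    using holomorphic_convex_primitive'[OF c open_upper_half_plane that]
    by (metis at_within_open open_upper_half_plane)
  then obtain G where G: "\<forall>\<tau>\<in>upper_half_plane. (G has_field_derivative f \<tau>) (at \<tau>)" using assms by blast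
  then have "G holomorphic_on upper_half_plane"
    unfolding holomorphic_on_def field_differentiable_def using has_field_derivative_at_within by blast
  then show ?thesis using G \<open>\<And>h. h holomorphic_on upper_half_plane \<Longrightarrow> _\<close> by blast
qed

definition shear :: "(complex \<Rightarrow> complex) \<Rightarrow> (complex \<Rightarrow> complex) \<Rightarrow> complex^3 \<Rightarrow> complex^3" where
  "shear F H x = x + vector [0, F (x $ 1), H (x $ 1)]"

lemma shear_nth [simp]:
  "shear F H x $ 1 = x $ 1" "shear F H x $ 2 = x $ 2 + F (x $ 1)" "shear F H x $ 3 = x $ 3 + H (x $ 1)"
  by (simp_all add: shear_def vector_3)

lemma has_derivative_first:
  assumes "(F has_field_derivative D) (at (x $ 1))"
  shows "((\<lambda>x :: complex^3. F (x $ 1)) has_derivative (\<lambda>v. D * v $ 1)) (at x)"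
  by (rule has_derivative_compose[OF bounded_linear.has_derivative[OF bounded_linear_vec_nth has_derivative_ident]])
    (use assms in \<open>simp add: has_field_derivative_def\<close>)

lemma has_derivative_shear:
  assumes "(F has_field_derivative F') (at (x $ 1))" "(H has_field_derivative H') (at (x $ 1))"
  shows "(shear F H has_derivative (\<lambda>v. v + v $ 1 *s vector [0, F', H'])) (at x)"
proof (rule fd_vec)
  fix i :: 3
  have n: "((\<lambda>x :: complex^3. x $ j) has_derivative (\<lambda>v. v $ j)) (at x)" for j
    by (rule bounded_linear.has_derivative[OF bounded_linear_vec_nth has_derivative_ident])
  consider "i = 1" | "i = 2" | "i = 3" using exhaust_3 by blast
  then show "((\<lambda>x. shear F H x $ i) has_derivative (\<lambda>v. (v + v $ 1 *s vector [0, F', H']) $ i)) (at x)"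
    using n[of 1] has_derivative_add[OF n[of 2] has_derivative_first[OF assms(1)]]
      has_derivative_add[OF n[of 3] has_derivative_first[OF assms(2)]]
    by cases (simp_all add: vector_3 mult.commute)
qed

lemma holo_shear:
  assumes "\<And>\<tau>. \<tau> \<in> upper_half_plane \<Longrightarrow> (F has_field_derivative F' \<tau>) (at \<tau>)"
    "\<And>\<tau>. \<tau> \<in> upper_half_plane \<Longrightarrow> (H has_field_derivative H' \<tau>) (at \<tau>)"
  shows "holo_map_on (shear F H) kuga_cover"
  unfolding holo_map_on_def
proof (intro allI holo_fun_onI)
  fix i and x :: "complex^3" assume x: "x \<in> kuga_cover"
  then have \<tau>: "x $ 1 \<in> upper_half_plane" by (simp add: kuga_cover_iff)
  show "((\<lambda>x. shear F H x $ i) has_derivative (\<lambda>v. (v + v $ 1 *s vector [0, F' (x $ 1), H' (x $ 1)]) $ i)) (at x)"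
    using bounded_linear.has_derivative[OF bounded_linear_vec_nth has_derivative_shear[OF assms(1)[OF \<tau>] assms(2)[OF \<tau>]]] .
qed (simp add: algebra_simps)

text \<open>If \<open>F'' = f\<close>, the coordinates \<open>(\<tau>, z + F(\<tau>))\<close> absorb the tensor \<open>d\<tau>\<^sup>2 \<otimes> f \<partial>/\<partial>z\<close>.\<close>

lemma shear_chart:
  assumes f: "f \<in> forms" and W: "chart_dom W"
  shows "\<exists>\<psi>. (orb ` W, \<psi>) \<in> manifold \<and>
    standard_in_chart manifold (orb ` W, \<psi>) (add_tensor (modular_tensor f) (std_conn (chart_of W)))"
proof -
  let ?H = upper_half_plane
  have fh: "fst f holomorphic_on ?H" "snd f holomorphic_on ?H" using f by (auto simp: H0_K32_def)
  obtain F F' where F: "\<And>\<tau>. \<tau> \<in> ?H \<Longrightarrow> (F has_field_derivative F' \<tau>) (at \<tau>)"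
    "\<And>\<tau>. \<tau> \<in> ?H \<Longrightarrow> (F' has_field_derivative fst f \<tau>) (at \<tau>)"
    using second_primitive[OF fh(1)] by blast
  obtain G G' where G: "\<And>\<tau>. \<tau> \<in> ?H \<Longrightarrow> (G has_field_derivative G' \<tau>) (at \<tau>)"
    "\<And>\<tau>. \<tau> \<in> ?H \<Longrightarrow> (G' has_field_derivative snd f \<tau>) (at \<tau>)"
    using second_primitive[OF fh(2)] by blast
  let ?\<phi> = "shear F G" and ?\<phi>' = "shear (\<lambda>\<tau>. - F \<tau>) (\<lambda>\<tau>. - G \<tau>)" and ?\<Theta> = "modular_tensor f"
  have WX: "W \<subseteq> kuga_cover" "open W" using W by (auto simp: chart_dom_def)
  let ?c = "chart_of W"
  let ?d = "(orb ` W, ?\<phi> \<circ> snd ?c)"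
  have c: "?c \<in> manifold" using W by simp
  have "(fst ?c, ?\<phi> \<circ> snd ?c) \<in> maximal_atlas atlas0"
  proof (rule maximal_atlas_biholomorphic[OF complex_manifold_atlas0, where S = kuga_cover and S' = kuga_cover and \<psi> = ?\<phi>'])
    show "?c \<in> maximal_atlas atlas0" using c by (simp add: manifold_def)
    show "coord ?c ` fst ?c \<subseteq> kuga_cover" using coord_image_chart_of[OF W, of "orb ` W"] WX by auto
    show "holo_map_on ?\<phi> kuga_cover" by (rule holo_shear[OF F(1) G(1)])
    show "holo_map_on ?\<phi>' kuga_cover" by (rule holo_shear[OF DERIV_minus[OF F(1)] DERIV_minus[OF G(1)]])
  qed (simp_all add: vec3_eq_iff kuga_cover_iff open_kuga_cover)
  then have d: "?d \<in> manifold" by (simp add: manifold_def)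
  have trans: "transition ?c ?d x = ?\<phi> x" if "x \<in> W" for x
  proof -
    have "snd ?c (orb x) = x" using coord_chart_of[OF W that] by (simp add: coord_def)
    then show ?thesis using param_chart_of[OF W that] by (simp add: transition_def coord_def)
  qed
  have dtrans: "fd (transition ?c ?d) x = (\<lambda>v. v + v $ 1 *s vector [0, F' (x $ 1), G' (x $ 1)])" if x: "x \<in> W" for x
  proof -
    have "x $ 1 \<in> ?H" using x WX by (auto simp: kuga_cover_iff)
    then show ?thesis
      using fd_cong[OF WX(2) x, of "transition ?c ?d" ?\<phi>, OF trans] fd_eqI[OF has_derivative_shear[OF F(1) G(1)]] by simp
  qed
  \<comment> \<open>The choice F'' = f makes the second derivative of the change of coordinates
    equal to the tensor itself.\<close>
  have ddtrans: "fd (\<lambda>y. fd (transition ?c ?d) y w) x v = modular_form_tensor f (x $ 1) v w" if x: "x \<in> W" for x v w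
  proof -
    have \<tau>: "x $ 1 \<in> ?H" using x WX by (auto simp: kuga_cover_iff)
    have n: "vector [0, fst f (x $ 1), snd f (x $ 1)] = modular_pair f (x $ 1)" by (simp add: modular_pair_def)
    have "fd (\<lambda>y. fd (transition ?c ?d) y w) x = fd (\<lambda>y. w + w $ 1 *s vector [0, F' (y $ 1), G' (y $ 1)]) x"
      by (rule fd_cong[OF WX(2) x]) (simp add: dtrans)
    also have "\<dots> = (\<lambda>v. (w $ 1 * v $ 1) *s modular_pair f (x $ 1))"
    proof (rule fd_eqI, rule fd_vec)
      fix i :: 3
      note h = has_derivative_mult_right[OF has_derivative_first[OF F(2)[OF \<tau>]], of "w $ 1"]
        has_derivative_mult_right[OF has_derivative_first[OF G(2)[OF \<tau>]], of "w $ 1"]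
      consider "i = 1" | "i = 2" | "i = 3" using exhaust_3 by blast
      then show "((\<lambda>y. (w + w $ 1 *s vector [0, F' (y $ 1), G' (y $ 1)]) $ i) has_derivative
          (\<lambda>v. ((w $ 1 * v $ 1) *s modular_pair f (x $ 1)) $ i)) (at x)"
        using has_derivative_add[OF has_derivative_const[of "w $ 2"] h(1)] has_derivative_add[OF has_derivative_const[of "w $ 3"] h(2)]
        by cases (simp_all add: vector_3 mult_ac)
    qed
    finally show ?thesis by (simp add: modular_form_tensor_def vector_smult_assoc mult.commute)
  qed
  have "standard_in_chart manifold ?d (add_tensor ?\<Theta> (std_conn ?c))"
    unfolding standard_in_chart_def
  proof (intro allI impI ballI)
    fix V X Y p assume V': "open_in_mfd manifold V \<and> V \<subseteq> fst ?d"
      and X: "X \<in> vector_fields manifold V" and Y: "Y \<in> vector_fields manifold V" and p: "p \<in> V"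
    have V: "open_in_mfd manifold V" "V \<subseteq> fst ?c" using V' by auto
    have pc: "p \<in> fst ?c" "p \<in> fst ?d" using V p by auto
    obtain x where x: "x \<in> W" "p = orb x" using pc by auto
    have cp: "coord ?c p = x" using x W by simp
    have J: "jac ?c ?d p = (\<lambda>v. v + v $ 1 *s vector [0, F' (x $ 1), G' (x $ 1)])"
      using dtrans[OF x(1)] cp by (simp add: jac_def)
    have Xp: "X p \<in> tangent_space manifold p" and Yp: "Y p \<in> tangent_space manifold p"
      using vector_fieldsD(1)[OF X p] vector_fieldsD(1)[OF Y p] by auto
    have t: "std_conn ?c V X Y p \<in> tangent_space manifold p"
      by (rule vector_fieldsD(1)[OF std_conn_vector_field[OF c V X Y] p])
    \<comment> \<open>The values of the tensor are vertical, and the Jacobian of a shear fixes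
      vertical vectors.\<close>
    have Jt: "jac ?c ?d p (modular_form_tensor f (x $ 1) v w) = modular_form_tensor f (x $ 1) v w" for v w
      unfolding J by (simp add: modular_form_tensor_def)
    have "?\<Theta> p (X p) (Y p) ?d = jac ?c ?d p (?\<Theta> p (X p) (Y p) ?c)"
      by (rule tangent_jac[OF sym_tensorsD(1)[OF modular_tensor_sym[OF f] Xp Yp Yp] c pc(1) d pc(2)])
    also have "?\<Theta> p (X p) (Y p) ?c = modular_form_tensor f (x $ 1) (X p ?c) (Y p ?c)"
      unfolding comp_in_apply[OF Xp Yp c pc(1)] using modular_tensor_comp[OF f W x(1)] x(2) by simp
    finally have T: "?\<Theta> p (X p) (Y p) ?d = modular_form_tensor f (x $ 1) (X p ?c) (Y p ?c)" by (simp only: Jt)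
    have "add_tensor ?\<Theta> (std_conn ?c) V X Y p ?d = jac ?c ?d p (std_conn ?c V X Y p ?c) + modular_form_tensor f (x $ 1) (X p ?c) (Y p ?c)"
      using tangent_jac[OF t c pc(1) d pc(2)] T by (simp add: add_tensor_def)
    \<comment> \<open>The tensor supplies exactly the inhomogeneous term of
      \<open>fd_component_transition\<close>, so the sum is the plain derivative of components in
      the sheared chart.\<close>
    also have "\<dots> = fd (\<lambda>x. fd (transition ?c ?d) x (Y p ?c)) (coord ?c p) (X p ?c) +
        jac ?c ?d p (fd (\<lambda>x. Y (param ?c x) ?c) (coord ?c p) (X p ?c))"
      unfolding std_conn_apply[OF c p pc(1)] cp ddtrans[OF x(1)] by (rule add.commute)
    also have "\<dots> = fd (\<lambda>x. Y (param ?d x) ?d) (coord ?d p) (jac ?c ?d p (X p ?c))"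
      by (rule fd_component_transition[symmetric, OF V(1) Y p pc c d])
    also have "jac ?c ?d p (X p ?c) = X p ?d"
      by (rule tangent_jac[symmetric, OF Xp c pc(1) d pc(2)])
    finally show "add_tensor ?\<Theta> (std_conn ?c) V X Y p ?d = fd (\<lambda>x. Y (param ?d x) ?d) (coord ?d p) (X p ?d)" .
  qed
  then show ?thesis using d by blast
qed

text \<open>The witness is the translated standard connection: each of its local pieces is standard
  in the sheared coordinates of the same domain.\<close>

lemma projective_connection_flat:
  assumes P: "projective_connection manifold P"
  shows "flat manifold P"
proof -
  obtain f where f: "f \<in> forms" "(translate (modular_tensor f) std_pconn, P) \<in> proj_equiv manifold"
    using projective_connection_modular[OF P] by blast
  let ?Q = "translate (modular_tensor f) std_pconn"
  have "\<exists>\<psi>. (U, \<psi>) \<in> manifold \<and> standard_in_chart manifold (U, \<psi>) D" if UD: "(U, D) \<in> ?Q" for U D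
  proof -
    obtain W where "chart_dom W" "U = orb ` W" "D = add_tensor (modular_tensor f) (std_conn (chart_of W))"
      using UD by (auto simp: translate_eq std_pconn_def)
    then show ?thesis using shear_chart[OF f(1)] by simp
  qed
  moreover have "(P, ?Q) \<in> proj_equiv manifold" using f(2) by (simp add: proj_equiv_iff)
  ultimately show ?thesis unfolding flat_def by blast
qed

subsection \<open>The fibres are totally geodesic\<close>

definition fibre :: "complex set \<Rightarrow> (complex^3) set set" where
  "fibre s = {p \<in> orb ` kuga_cover. kuga_fibration p = s}"

lemma kuga_fibration_orb: "kuga_fibration (orb x) = {moebius g (x $ 1) | g. g \<in> \<Gamma>}"
proof
  show "kuga_fibration (orb x) \<subseteq> {moebius g (x $ 1) | g. g \<in> \<Gamma>}"
    by (auto simp: kuga_fibration_def orb_def)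
  show "{moebius g (x $ 1) | g. g \<in> \<Gamma>} \<subseteq> kuga_fibration (orb x)"
  proof
    fix \<tau> assume "\<tau> \<in> {moebius g (x $ 1) | g. g \<in> \<Gamma>}"
    then obtain g where g: "g \<in> \<Gamma>" "\<tau> = act g 0 x $ 1" by auto
    have "act g 0 x \<in> orb x" unfolding orb_def using g(1) zero_in_L by blast
    then show "\<tau> \<in> kuga_fibration (orb x)" unfolding kuga_fibration_def g(2) by (rule imageI)
  qed
qed

text \<open>Points of W with \<Gamma>-equivalent first coordinates then share that coordinate, so a
  fibre meets W in a single slice.\<close>

definition small_dom :: "(complex^3) set \<Rightarrow> bool" where
  "small_dom W \<longleftrightarrow> chart_dom W \<and> (\<forall>g\<in>\<Gamma>. \<forall>y\<in>W. moebius g (y $ 1) \<in> (\<lambda>y. y $ 1) ` W \<longrightarrow> g = mat 1)"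

lemma fibre_first_coordinate:
  assumes W: "small_dom W" and xy: "x \<in> W" "y \<in> W" and x: "orb x \<in> fibre s"
  shows "orb y \<in> fibre s \<longleftrightarrow> y $ 1 = x $ 1"
proof
  assume "orb y \<in> fibre s"
  then have "kuga_fibration (orb y) = kuga_fibration (orb x)" using x by (simp add: fibre_def)
  moreover have "y $ 1 \<in> kuga_fibration (orb y)" unfolding kuga_fibration_def using orb_self by blast
  ultimately obtain g where g: "g \<in> \<Gamma>" "y $ 1 = moebius g (x $ 1)" unfolding kuga_fibration_orb by auto
  then have "g = mat 1" using W xy unfolding small_dom_def by (metis imageI)
  then show "y $ 1 = x $ 1" using g by simp
next
  assume "y $ 1 = x $ 1"
  moreover have "y \<in> kuga_cover" using W xy by (auto simp: small_dom_def chart_dom_def)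
  ultimately show "orb y \<in> fibre s" using x by (simp add: fibre_def kuga_fibration_orb)
qed

text \<open>A curve in the fibre has constant first coordinate in the chart, which forces the first
  component of its velocity to vanish; conversely, a vertical vector is the velocity of a straight
  line in the slice.\<close>

lemma tangent_to_fibre:
  assumes W: "small_dom W" and x: "x \<in> W" and s: "orb x \<in> fibre s"
  shows "v \<in> tangent_to manifold (fibre s) (orb x) \<longleftrightarrow>
    v \<in> tangent_space manifold (orb x) \<and> v (chart_of W) $ 1 = 0"
proof
  let ?c = "chart_of W" and ?p = "orb x"
  have gW: "chart_dom W" using W by (simp add: small_dom_def)
  have c: "?c \<in> manifold" "?p \<in> fst ?c" using gW x by auto
  {
    assume v: "v \<in> tangent_to manifold (fibre s) ?p"
    then have t: "v \<in> tangent_space manifold ?p" by (simp add: tangent_to_def)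
    obtain g where g: "g 0 = ?p" "\<forall>c\<in>manifold. ?p \<in> fst c \<longrightarrow> (\<exists>e>0. g ` ball 0 e \<subseteq> fst c \<inter> fibre s \<and>
              (\<forall>i. (\<lambda>t. coord c (g t) $ i) holomorphic_on ball 0 e \<and>
                   deriv (\<lambda>t. coord c (g t) $ i) 0 = v c $ i))"
      using v unfolding tangent_to_def by blast
    obtain e where e: "e > 0" "g ` ball 0 e \<subseteq> fst ?c \<inter> fibre s" "deriv (\<lambda>t. coord ?c (g t) $ 1) 0 = v ?c $ 1"
      using g(2)[rule_format, OF c] by blast
    have const: "coord ?c (g t) $ 1 = x $ 1" if t: "t \<in> ball 0 e" for t
    proof -
      have gt: "g t \<in> orb ` W" "g t \<in> fibre s" using e(2) t by auto
      then obtain y where y: "y \<in> W" "g t = orb y" by auto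
      then show ?thesis using fibre_first_coordinate[OF W x y(1) s] gt gW by simp
    qed
    have "((\<lambda>t. coord ?c (g t) $ 1) has_field_derivative 0) (at 0)"
      by (rule has_field_derivative_transform_within_open[of "\<lambda>t. x $ 1" 0 0 "ball 0 e"]) (use e const in auto)
    then have "v ?c $ 1 = 0" using e(3) DERIV_imp_deriv by metis
    then show "v \<in> tangent_space manifold ?p \<and> v ?c $ 1 = 0" using t by simp
  }
  {
    assume v: "v \<in> tangent_space manifold ?p \<and> v ?c $ 1 = 0"
    let ?w = "v ?c"
    \<comment> \<open>One curve has to serve all charts d around the point at once; in d it is the
      image of this line under a holomorphic transition.\<close>
    let ?g = "\<lambda>t. orb (x + t *s ?w)"
    have "\<exists>e>0. ?g ` ball 0 e \<subseteq> fst d \<inter> fibre s \<and> (\<forall>i. (\<lambda>t. coord d (?g t) $ i) holomorphic_on ball 0 e \<and>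
                   deriv (\<lambda>t. coord d (?g t) $ i) 0 = v d $ i)"
      if d: "d \<in> manifold" "?p \<in> fst d" for d
    proof -
      let ?O = "coord ?c ` (fst ?c \<inter> fst d)"
      have O: "open ?O" "x \<in> ?O"
        using chart_open[OF c(1) d(1)] c d coord_chart_of[OF gW x] by (auto intro!: image_eqI[of _ _ ?p])
      obtain r e where re: "r > 0" "e > 0" "\<And>y z. y \<in> ball x e \<Longrightarrow> norm (z::complex) \<le> r \<Longrightarrow> y + z *s ?w \<in> ?O"
        using uniform_radius[OF O] by metis
      have inO: "x + t *s ?w \<in> ?O" if "t \<in> ball 0 r" for t
        by (rule re(3)) (use re that in auto)
      have O_eq: "?O = {y \<in> W. orb y \<in> fst d}" using coord_image_chart_of[OF gW] by simp
      have inW: "x + t *s ?w \<in> W" "?g t \<in> fst d" if "t \<in> ball 0 r" for t using inO[OF that] O_eq by auto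
      have Tc: "coord d (?g t) = transition ?c d (x + t *s ?w)" if "t \<in> ball 0 r" for t
        using inW[OF that] gW by (simp add: transition_def)
      have h: "holo_fun_on (\<lambda>y. transition ?c d y $ i) ?O" for i
        using transition_holo[OF c(1) d(1)] by (simp add: holo_map_on_def)
      have der: "((\<lambda>t. coord d (?g t) $ i) has_field_derivative fd (\<lambda>y. transition ?c d y $ i) (x + t *s ?w) ?w) (at t)"
        if t: "t \<in> ball 0 r" for t i
        by (rule has_field_derivative_transform_within_open[OF has_field_derivative_line[OF h inO[OF t]] open_ball t])
          (simp add: Tc)
      have "?g ` ball 0 r \<subseteq> fst d \<inter> fibre s"
        using inW fibre_first_coordinate[OF W x _ s] v by auto
      moreover have "(\<lambda>t. coord d (?g t) $ i) holomorphic_on ball 0 r" for i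
        unfolding holomorphic_on_def field_differentiable_def using der has_field_derivative_at_within by blast
      moreover have "deriv (\<lambda>t. coord d (?g t) $ i) 0 = v d $ i" for i
      proof -
        have "deriv (\<lambda>t. coord d (?g t) $ i) 0 = fd (\<lambda>y. transition ?c d y $ i) x ?w"
          using DERIV_imp_deriv[OF der[of 0 i]] re(1) by simp
        also have "\<dots> = jac ?c d ?p ?w $ i"
          unfolding jac_def coord_chart_of[OF gW x] by (rule holo_map_onD(2)[OF transition_holo[OF c(1) d(1)] O(2), symmetric])
        also have "jac ?c d ?p ?w = v d" using tangent_jac[OF _ c d] v by simp
        finally show ?thesis .
      qed
      ultimately show ?thesis using re(1) by blast
    qed
    then show "v \<in> tangent_to manifold (fibre s) ?p"
      unfolding tangent_to_def using v by (intro CollectI conjI exI[of _ ?g]) auto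
  }
qed

text \<open>On vertical v and w the Thomas symbol vanishes, so the Christoffel symbol is a
  combination of v and w and hence vertical. The other contribution to the first component of D X Y
  is the derivative of the first component of Y along X.\<close>

lemma fibre_totally_geodesic:
  assumes P: "projective_connection manifold P"
  shows "totally_geodesic manifold P (fibre s)"
  unfolding totally_geodesic_def
proof (clarify)
  fix U D V X Y p assume UD: "(U, D) \<in> P" and V: "open_in_mfd manifold V" "V \<subseteq> U"
    and X: "X \<in> vector_fields manifold V" and Y: "Y \<in> vector_fields manifold V"
    and tan: "\<forall>p\<in>V \<inter> fibre s. X p \<in> tangent_to manifold (fibre s) p \<and> Y p \<in> tangent_to manifold (fibre s) p"
    and p: "p \<in> V" "p \<in> fibre s"
  obtain f where f: "f \<in> forms" "(translate (modular_tensor f) std_pconn, P) \<in> proj_equiv manifold"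
    using projective_connection_modular[OF P] by blast
  have D: "open_in_mfd manifold U" "affine_connection manifold U D"
    using projective_connectionD(2)[OF P UD] by (auto simp: connection_on_def)
  obtain x where x: "x \<in> kuga_cover" "p = orb x" using p(2) by (auto simp: fibre_def)
  obtain W where W: "small_dom W" "x \<in> W" using chart_dom_neighbourhood[OF x(1)] unfolding small_dom_def by blast
  have gW: "chart_dom W" using W by (simp add: small_dom_def)
  let ?c = "chart_of W"
  have c: "?c \<in> manifold" "p \<in> fst ?c" using gW W x by auto
  have cp: "coord ?c p = x" using gW W x by simp
  have first: "X q ?c $ 1 = 0" "Y q ?c $ 1 = 0" if q: "q \<in> V" "y \<in> W" "q = orb y" "y $ 1 = x $ 1" for q y
  proof -
    have "q \<in> fibre s" using fibre_first_coordinate[OF W(1,2) q(2)] p(2) x q by simp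
    then show "X q ?c $ 1 = 0" "Y q ?c $ 1 = 0"
      using tan q tangent_to_fibre[OF W(1) q(2)] by auto
  qed
  let ?v = "X p ?c" and ?w = "Y p ?c"
  have v1: "?v $ 1 = 0" "?w $ 1 = 0" using first[OF p(1) W(2) x(2)] by auto
  have "thomas U D ?c p ?v ?w = thomas_at (translate (modular_tensor f) std_pconn) ?c p ?v ?w"
    using thomas_at_eq[OF P UD _ c] V p f(2) c by (auto simp: proj_equiv_iff)
  also have "\<dots> = modular_form_tensor f (x $ 1) ?v ?w"
    unfolding thomas_at_translate[OF projective_connection_std_pconn modular_tensor_tracefree[OF f(1)] c]
    using thomas_at_std_pconn[OF gW W(2)] modular_tensor_comp[OF f(1) gW W(2)] x by simp
  also have "\<dots> = 0" using v1 by (simp add: modular_form_tensor_def)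
  finally have "tracefree_part (christoffel U D ?c p) ?v ?w = 0" by (simp add: thomas_def)
  from arg_cong[OF tracefree_part_zeroD[OF this], of "\<lambda>y. y $ 1"]
  have chr1: "christoffel U D ?c p ?v ?w $ 1 = 0" using v1 by simp
  let ?k = "\<lambda>y. Y (param ?c y) ?c $ 1" and ?O = "coord ?c ` (fst ?c \<inter> V)"
  have k: "holo_fun_on ?k ?O" using vector_fieldsD(3)[OF Y c(1)] by (simp add: holo_map_on_def)
  have O: "open ?O" "x \<in> ?O" using open_coord[OF V(1) c(1)] c p cp by (auto intro!: image_eqI[of _ _ p])
  have O_eq: "?O = {y \<in> W. orb y \<in> V}" using coord_image_chart_of[OF gW] by simp
  \<comment> \<open>The line in direction X p stays in the slice, where the first component of Y is
    identically zero.\<close>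
  have "fd ?k x ?v = 0"
  proof -
    obtain r e where re: "r > 0" "e > 0" "\<And>y z. y \<in> ball x e \<Longrightarrow> norm (z::complex) \<le> r \<Longrightarrow> y + z *s ?v \<in> ?O"
      using uniform_radius[OF O] by metis
    have inO: "x + t *s ?v \<in> ?O" if "t \<in> ball 0 r" for t
      by (rule re(3)) (use re that in auto)
    have zero: "?k (x + t *s ?v) = 0" if t: "t \<in> ball 0 r" for t
    proof -
      have "x + t *s ?v \<in> W" "orb (x + t *s ?v) \<in> V" using inO[OF t] O_eq by auto
      then show ?thesis using first(2)[OF _ _ refl, of "x + t *s ?v"] v1 gW by simp
    qed
    have "((\<lambda>t. ?k (x + t *s ?v)) has_field_derivative 0) (at 0)"
    proof (rule has_field_derivative_transform_within_open[OF DERIV_const[of 0] open_ball])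
      show "0 = ?k (x + t *s ?v)" if "t \<in> ball 0 r" for t by (rule zero[OF that, symmetric])
    qed (simp add: re(1))
    moreover have "((\<lambda>t. ?k (x + t *s ?v)) has_field_derivative fd ?k (x + 0 *s ?v) ?v) (at 0)"
      by (rule has_field_derivative_line[OF k]) (use O in simp)
    then have "((\<lambda>t. ?k (x + t *s ?v)) has_field_derivative fd ?k x ?v) (at 0)"
      unfolding vector_smult_lzero add_0_right .
    ultimately show ?thesis by (rule DERIV_unique[symmetric])
  qed
  then have "fd (\<lambda>y. Y (param ?c y) ?c) (coord ?c p) ?v $ 1 = 0"
    using holo_map_onD(2)[OF vector_fieldsD(3)[OF Y c(1)] O(2)] cp by simp
  then have "D V X Y p ?c $ 1 = 0"
    using christoffel_formula[OF D(2,1) V X Y c(1) p(1) c(2)] chr1 by simp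
  moreover have "D V X Y p \<in> tangent_space manifold p"
    by (rule vector_fieldsD(1)[OF affine_connectionD(1)[OF D(2) V X Y] p(1)])
  ultimately show "D V X Y p \<in> tangent_to manifold (fibre s) p"
    using tangent_to_fibre[OF W] p(2) x(2) by simp
qed

end

section \<open>Transfer of the results to the given quaternionic data\<close>

theorem theorem2:
  fixes B \<Lambda> \<Gamma> :: "(real^2^2) set" and \<alpha> :: real
  assumes "kuga_shimura B \<Lambda> \<alpha> \<Gamma>"
  shows "let M = kuga_threefold \<Lambda> \<alpha> \<Gamma>; V = H0_K32 \<Gamma> \<times> H0_K32 \<Gamma> in
    affine_space_over (tracefree_tensors M) (translate_class M) (projective_classes M) \<and>
    (\<exists>\<Phi>. bij_betw \<Phi> V (tracefree_tensors M) \<and>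
         (\<forall>x\<in>V. \<forall>y\<in>V. \<Phi> (x + y) = \<Phi> x + \<Phi> y) \<and>
         (\<forall>k. \<forall>(f, h)\<in>V. \<Phi> (\<lambda>\<tau>. k * f \<tau>, \<lambda>\<tau>. k * h \<tau>) = tensor_scale k (\<Phi> (f, h)))) \<and>
    (\<forall>P. projective_connection M P \<longrightarrow> flat M P) \<and>
    (\<forall>P. projective_connection M P \<longrightarrow>
         (\<forall>s\<in>shimura_curve \<Gamma>. totally_geodesic M P (kuga_fiber \<Lambda> \<alpha> \<Gamma> s)))"
proof -
  obtain e where "kuga_group (lattice_coords \<alpha> ` \<Lambda>) e \<Gamma>" using kuga_shimura_group[OF assms] by blast
  then interpret kuga_group "lattice_coords \<alpha> ` \<Lambda>" e \<Gamma> .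
  \<comment> \<open>Once the orbits coincide, so do the charts of the quotient and the
    fibres.\<close>
  have orb: "kuga_orbit \<Lambda> \<alpha> \<Gamma> = orb"
    by (auto simp: fun_eq_iff kuga_orbit_def orb_def kuga_action_eq)
  have M: "kuga_threefold \<Lambda> \<alpha> \<Gamma> = manifold"
    unfolding kuga_threefold_def manifold_def atlas0_def chart_of_def orb chart_dom_def
    by (rule arg_cong[where f = maximal_atlas]) auto
  have fibre: "kuga_fiber \<Lambda> \<alpha> \<Gamma> s = fibre s" for s
    by (simp add: kuga_fiber_def fibre_def orb)
  \<comment> \<open>Surjectivity is the classification of trace-free tensors; it makes
    \<open>modular_tensor\<close> the isomorphism of translation spaces asked for.\<close>
  have "modular_tensor ` forms = tracefree_tensors manifold"
    using modular_tensor_tracefree tracefree_tensor_is_modular by blast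
  then have "bij_betw modular_tensor forms (tracefree_tensors manifold)"
    using modular_tensor_inj by (simp add: bij_betw_def)
  then show ?thesis
    unfolding Let_def M fibre
    using projective_classes_affine_space[OF projective_connection_std_pconn] modular_tensor_add modular_tensor_scale
      projective_connection_flat fibre_totally_geodesic
    by (intro conjI exI[of _ modular_tensor]) auto
qed

end
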